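(* Let $1/3<\beta\le1/2$, $\gamma>1/\beta$, $\omega(s,t)=|t-s|$, $\sigma\in\mathrm{Lip}^{\gamma-1}(\mathbb{R}^n\times\mathbb{R}^n,\mathcal{L}(\mathbb{R}^d,\mathbb{R}^n))$, $\xi\in\mathbb{R}^n$. Let $A:\mathcal{C}^{\beta}([0,T],\mathbb{R}^n\,|\,x_0=\xi)\to C([0,T],\mathbb{R}^n)$ satisfy: (a) for all $0\le t\le T$, $(A(x)_s)_{0\le s\le t}$ depends only on $(x_s)_{0\le s\le t}$; (b) there is $1/3<\beta_0<\beta$ such that $A$ extends to a continuous mapping (still denoted $A$) from $\mathcal{C}^{\beta_0}([0,T],\mathbb{R}^n\,|\,x_0=\xi)$ to $C([0,T],\mathbb{R}^n)$ with the uniform norm; (c) there is a non-decreasing positive continuous function $F$ on $[0,\infty)$ with $\|A(x)\|_{1\text{-}var,[s,t]}\le F(\|x\|_{(1/\beta_0)\text{-}var,[s,t]})\|x\|_{\infty\text{-}var,[s,t]}$ for all $x\in\mathcal{C}^{\beta_0}([0,T],\mathbb{R}^n\,|\,x_0=\xi)$ and $0\le s\le t\le T$. For a $\beta$-H\"older rough path $\mathbf{X}\in\mathscr{C}^\beta(\mathbb{R}^d)$ let $Sol(\mathbf{X})$ be the set of $(Z,Z')\in\mathscr{D}^{2\beta}_X(\mathbb{R}^n)$ with $$Z_t=\xi+\int_0^t\sigma(Z_s,A(Z)_s)d\mathbf{X}_s,\quad Z'_t=\sigma(Z_t,A(Z)_t),\quad 0\le t\le T.$$ Assume that for $\mathbf{X}_0\in\mathscr{C}^\beta(\mathbb{R}^d)$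 this equation has a unique solution $Z(\mathbf{X}_0)$. Then the multivalued mapping $\mathbf{X}\mapsto Sol(\mathbf{X})$ is continuous at $\mathbf{X}_0$ in the following sense: for any $\beta'\in(0,\beta)$, any $\theta'\in(0,2\beta)$ and any $\varepsilon>0$ there exists $\delta>0$ such that for any $\mathbf{X}\in\mathscr{C}^\beta(\mathbb{R}^d)$ with $|||\mathbf{X}-\mathbf{X}_0|||_\beta\le\delta$ and any $Z(\mathbf{X})\in Sol(\mathbf{X})$, $$\|Z(\mathbf{X})-Z(\mathbf{X}_0)\|_{\beta'}+\|R^{Z(\mathbf{X})}-R^{Z(\mathbf{X}_0)}\|_{\theta'}\le\varepsilon.$$
   Context: Fix $T>0$. Here $\omega(s,t)=|t-s|$, so H\"older norms are the usual ones. For a continuous path $x$ in a finite-dimensional normed space, $x_{s,t}=x_t-x_s$, $\|x\|_{\infty\text{-}var,[s,t]}=\max_{s\le u\le v\le t}|x_{u,v}|$, $\|x\|_{p\text{-}var,[s,t]}$ is the usual $p$-variation norm, $\|x\|_\theta=\sup_{s<t}|x_{s,t}|/|t-s|^\theta$; similarly $\|F\|_\theta=\sup_{s<t}|F_{s,t}|/|t-s|^\theta$ for two-parameter functions. $\mathcal{C}^\theta([0,T],E)$ is the space of $\theta$-H\"older paths, and $\mathcal{C}^\theta([0,T],E\,|\,x_0=\xi)$ the subset of those starting at $\xi$. For $\gamma=m+\theta$ ($m\in\mathbb{N}\cup\{0\}$, $0<\theta\le1$), $\mathrm{Lip}^\gamma(E,F)$ is the set of bounded $f:E\to F$, $m$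 times continuously differentiable with bounded derivatives up to order $m$ and $D^mf$ $\theta$-H\"older. $\mathscr{C}^\beta(\mathbb{R}^d)$: $\beta$-H\"older rough paths $\mathbf{X}=(X_{s,t},\mathbb{X}_{s,t})$, satisfying Chen's relation with $\|X\|_\beta<\infty$, $\|\mathbb{X}\|_{2\beta}<\infty$. $|||\mathbf{X}-\mathbf{Y}|||_\beta=\|X-Y\|_\beta+\sqrt{\|\mathbb{X}-\mathbb{Y}\|_{2\beta}}$. $\mathscr{D}^{2\beta}_X(\mathbb{R}^n)$: pairs $(Z,Z')\in\mathcal{C}^\beta([0,T],\mathbb{R}^n)\times\mathcal{C}^\beta([0,T],\mathcal{L}(\mathbb{R}^d,\mathbb{R}^n))$ such that $R^Z_{s,t}=Z_t-Z_s-Z'_sX_{s,t}$ satisfies $\|R^Z\|_{2\beta}<\infty$. For solutions, $R^{Z(\mathbf{X})}_{s,t}=Z_{s,t}-\sigma(Z_s,A(Z)_s)X_{s,t}$. For $(Z,Z')\in\mathscr{D}^{2\beta}_X$ and a continuous bounded variation path $\Psi$, $\int_s^t\sigma(Z_u,\Psi_u)d\mathbf{X}_u$ is the limit, as the mesh of partitions of $[s,t]$ tends to $0$, of $\sum_i\Xi_{t_{i-1},t_i}$ with $\Xi_{s,t}=\sigma(Z_s,\Psi_s)X_{s,t}+(D_1\sigma)(Z_s,\Psi_s)Z'_s\mathbb{X}_{s,t}+(D_2\sigma)(Z_s,\Psi_s)\int_s^t\Psi_{s,r}\otimes dX_r$ ($D_1,D_2$: derivatives in the first and second variables; Young integral in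 the last term). *)

theory Defs
  imports "HOL-Analysis.Analysis"
begin

text \<open>Paths on \<open>[0, T]\<close> are total functions on \<^typ>\<open>real\<close> of which only the values on
  \<open>[0, T]\<close> matter; two-parameter functions are only looked at for \<open>0 \<le> s \<le> t \<le> T\<close>.
  Norms take values in \<^typ>\<open>ennreal\<close>, so that an infinite norm is not a junk value.\<close>

definition partitions :: "real \<Rightarrow> real \<Rightarrow> real list set" where
  "partitions s t = {ts. ts \<noteq> [] \<and> sorted_wrt (<) ts \<and> hd ts = s \<and> last ts = t}"

definition partition_sum :: "(real \<Rightarrow> real \<Rightarrow> 'v::comm_monoid_add) \<Rightarrow> real list \<Rightarrow> 'v" where
  "partition_sum \<Xi> ts = (\<Sum>i<length ts - 1. \<Xi> (ts ! i) (ts ! Suc i))"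

text \<open>The filter of partitions of \<open>[s, t]\<close> as their mesh tends to 0.\<close>

definition mesh_filter :: "real \<Rightarrow> real \<Rightarrow> real list filter" where
  "mesh_filter s t = (INF \<delta>\<in>{0<..}.
     principal {ts \<in> partitions s t. \<forall>i. Suc i < length ts \<longrightarrow> ts ! Suc i - ts ! i < \<delta>})"

definition holder2_norm :: "real \<Rightarrow> real \<Rightarrow> (real \<Rightarrow> real \<Rightarrow> 'v::real_normed_vector) \<Rightarrow> ennreal" where
  "holder2_norm T \<theta> F =
     (SUP (s, t)\<in>{(s, t). 0 \<le> s \<and> s < t \<and> t \<le> T}. ennreal (norm (F s t) / (t - s) powr \<theta>))"

definition holder_norm :: "real \<Rightarrow> real \<Rightarrow> (real \<Rightarrow> 'v::real_normed_vector) \<Rightarrow> ennreal" where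
  "holder_norm T \<theta> x = holder2_norm T \<theta> (\<lambda>s t. x t - x s)"

definition holder_paths :: "real \<Rightarrow> real \<Rightarrow> (real \<Rightarrow> 'v::real_normed_vector) set" where
  "holder_paths T \<theta> = {x. holder_norm T \<theta> x < \<infinity>}"

definition holder_paths_from ::
    "real \<Rightarrow> real \<Rightarrow> 'v::real_normed_vector \<Rightarrow> (real \<Rightarrow> 'v) set" where
  "holder_paths_from T \<theta> \<xi> = {x \<in> holder_paths T \<theta>. x 0 = \<xi>}"

definition pvar :: "real \<Rightarrow> (real \<Rightarrow> 'v::real_normed_vector) \<Rightarrow> real \<Rightarrow> real \<Rightarrow> ennreal" where
  "pvar p x s t = (SUP ts\<in>partitions s t.
     ennreal (partition_sum (\<lambda>u v. norm (x v - x u) powr p) ts powr (1 / p)))"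

definition infvar :: "(real \<Rightarrow> 'v::real_normed_vector) \<Rightarrow> real \<Rightarrow> real \<Rightarrow> ennreal" where
  "infvar x s t = (SUP (u, v)\<in>{(u, v). s \<le> u \<and> u \<le> v \<and> v \<le> t}. ennreal (norm (x v - x u)))"

text \<open>\<open>iter_deriv f [v\<^sub>1, \<dots>, v\<^sub>k] x\<close> is the \<open>k\<close>-th Frechet derivative \<open>D\<^sup>kf(x)\<close> applied to
  \<open>v\<^sub>1, \<dots>, v\<^sub>k\<close>.\<close>

fun iter_deriv ::
    "('a::real_normed_vector \<Rightarrow> 'b::real_normed_vector) \<Rightarrow> 'a list \<Rightarrow> 'a \<Rightarrow> 'b" where
  "iter_deriv f [] x = f x"
| "iter_deriv f (v # vs) x = frechet_derivative (iter_deriv f vs) (at x) v"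

text \<open>The space of \<open>Lip\<close> functions of order \<open>\<gamma> = m + \<theta>\<close>. As the domain is finite dimensional,
  \<open>D\<^sup>kf\<close> is (continuously) differentiable as a map into the \<open>k\<close>-linear maps iff its evaluations
  at all \<open>v\<^sub>1, \<dots>, v\<^sub>k\<close> are. The bounds involving the product of the norms of the \<open>v\<^sub>i\<close> are bounds
  on the operator norm of \<open>k\<close>-linear maps.\<close>

definition lip_functions ::
    "real \<Rightarrow> ('a::euclidean_space \<Rightarrow> 'b::real_normed_vector) set" where
  "lip_functions \<gamma> = {f. \<exists>(m::nat) \<theta>. \<gamma> = real m + \<theta> \<and> 0 < \<theta> \<and> \<theta> \<le> 1 \<and>
     (\<forall>vs x. length vs < m \<longrightarrow> iter_deriv f vs differentiable (at x)) \<and>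
     (\<forall>vs. length vs \<le> m \<longrightarrow> continuous_on UNIV (iter_deriv f vs)) \<and>
     (\<forall>k\<le>m. \<exists>C. \<forall>vs x. length vs = k \<longrightarrow>
        norm (iter_deriv f vs x) \<le> C * prod_list (map norm vs)) \<and>
     (\<exists>C. \<forall>vs x y. length vs = m \<longrightarrow>
        norm (iter_deriv f vs y - iter_deriv f vs x)
          \<le> C * norm (y - x) powr \<theta> * prod_list (map norm vs))}"

text \<open>The tensor product of \<open>\<real>\<^sup>k\<close> and \<open>\<real>\<^sup>d\<close> is the space of \<open>k \<times> d\<close> matrices, with the
  Euclidean norm of the entries.\<close>

definition tensor :: "real^'k \<Rightarrow> real^'d \<Rightarrow> real^'d^'k" where
  "tensor a b = (\<chi> i j. a $ i * b $ j)"

text \<open>The linear extension of \<open>a \<otimes> b \<mapsto> B a b\<close>.\<close>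

definition tensor_apply ::
    "(real^'k \<Rightarrow> ((real^'d) \<Rightarrow>\<^sub>L (real^'n))) \<Rightarrow> real^'d^'k \<Rightarrow> real^'n" where
  "tensor_apply B M =
     (\<Sum>i\<in>UNIV. \<Sum>j\<in>UNIV. (M $ i $ j) *\<^sub>R blinfun_apply (B (axis i 1)) (axis j 1))"

type_synonym 'd rough = "(real \<Rightarrow> real \<Rightarrow> real^'d) \<times> (real \<Rightarrow> real \<Rightarrow> real^'d^'d)"

text \<open>Chen's relation is required of both levels; on the first level it says that
  \<open>X s t\<close> is the increment of the path \<open>\<lambda>t. X 0 t\<close>.\<close>

definition rough_paths :: "real \<Rightarrow> real \<Rightarrow> 'd::finite rough set" where
  "rough_paths T \<beta> = {(X, XX).
     (\<forall>s u t. 0 \<le> s \<and> s \<le> u \<and> u \<le> t \<and> t \<le> T \<longrightarrow>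
        X s t = X s u + X u t \<and>
        XX s t = XX s u + XX u t + tensor (X s u) (X u t)) \<and>
     holder2_norm T \<beta> X < \<infinity> \<and> holder2_norm T (2 * \<beta>) XX < \<infinity>}"

text \<open>Only used for rough paths, for which the two norms below are finite.\<close>

definition rough_dist :: "real \<Rightarrow> real \<Rightarrow> 'd::finite rough \<Rightarrow> 'd rough \<Rightarrow> real" where
  "rough_dist T \<beta> XXX YYY =
     enn2real (holder2_norm T \<beta> (\<lambda>s t. fst XXX s t - fst YYY s t)) +
     sqrt (enn2real (holder2_norm T (2 * \<beta>) (\<lambda>s t. snd XXX s t - snd YYY s t)))"

definition remainder ::
    "(real \<Rightarrow> real^'n) \<Rightarrow> (real \<Rightarrow> (real^'d) \<Rightarrow>\<^sub>L (real^'n)) \<Rightarrow> (real \<Rightarrow> real \<Rightarrow> real^'d) \<Rightarrow>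
     real \<Rightarrow> real \<Rightarrow> real^'n" where
  "remainder Z Z' X s t = Z t - Z s - blinfun_apply (Z' s) (X s t)"

definition controlled_paths ::
    "real \<Rightarrow> real \<Rightarrow> (real \<Rightarrow> real \<Rightarrow> real^'d) \<Rightarrow>
     ((real \<Rightarrow> real^'n) \<times> (real \<Rightarrow> (real^'d) \<Rightarrow>\<^sub>L (real^'n))) set" where
  "controlled_paths T \<beta> X = {(Z, Z').
     Z \<in> holder_paths T \<beta> \<and> Z' \<in> holder_paths T \<beta> \<and>
     holder2_norm T (2 * \<beta>) (remainder Z Z' X) < \<infinity>}"

text \<open>The Young integral of \<open>\<Psi> r - \<Psi> s\<close> (in the first tensor slot) against \<open>X\<close> over \<open>[s, t]\<close>.\<close>

definition young_integral ::
    "(real \<Rightarrow> real^'k) \<Rightarrow> (real \<Rightarrow> real \<Rightarrow> real^'d) \<Rightarrow> real \<Rightarrow> real \<Rightarrow> real^'d^'k" where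
  "young_integral \<Psi> X s t =
     Lim (mesh_filter s t) (partition_sum (\<lambda>u v. tensor (\<Psi> u - \<Psi> s) (X u v)))"

definition rough_germ ::
    "((real^'n) \<times> (real^'n) \<Rightarrow> (real^'d) \<Rightarrow>\<^sub>L (real^'n)) \<Rightarrow> (real \<Rightarrow> real^'n) \<Rightarrow>
     (real \<Rightarrow> (real^'d) \<Rightarrow>\<^sub>L (real^'n)) \<Rightarrow> (real \<Rightarrow> real^'n) \<Rightarrow> 'd rough \<Rightarrow>
     real \<Rightarrow> real \<Rightarrow> real^'n" where
  "rough_germ \<sigma> Z Z' \<Psi> XXX s t =
     blinfun_apply (\<sigma> (Z s, \<Psi> s)) (fst XXX s t) +
     tensor_apply
       (\<lambda>a. frechet_derivative (\<lambda>z. \<sigma> (z, \<Psi> s)) (at (Z s)) (blinfun_apply (Z' s) a))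
       (snd XXX s t) +
     tensor_apply
       (frechet_derivative (\<lambda>\<psi>. \<sigma> (Z s, \<psi>)) (at (\<Psi> s)))
       (young_integral \<Psi> (fst XXX) s t)"

definition has_rough_integral ::
    "((real^'n) \<times> (real^'n) \<Rightarrow> (real^'d) \<Rightarrow>\<^sub>L (real^'n)) \<Rightarrow> (real \<Rightarrow> real^'n) \<Rightarrow>
     (real \<Rightarrow> (real^'d) \<Rightarrow>\<^sub>L (real^'n)) \<Rightarrow> (real \<Rightarrow> real^'n) \<Rightarrow> 'd rough \<Rightarrow>
     real \<Rightarrow> real \<Rightarrow> real^'n \<Rightarrow> bool" where
  "has_rough_integral \<sigma> Z Z' \<Psi> XXX s t I \<longleftrightarrow>
     (partition_sum (rough_germ \<sigma> Z Z' \<Psi> XXX) \<longlongrightarrow> I) (mesh_filter s t)"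

definition Sol ::
    "real \<Rightarrow> real \<Rightarrow> ((real^'n) \<times> (real^'n) \<Rightarrow> (real^'d) \<Rightarrow>\<^sub>L (real^'n)) \<Rightarrow>
     ((real \<Rightarrow> real^'n) \<Rightarrow> real \<Rightarrow> real^'n) \<Rightarrow> real^'n \<Rightarrow> 'd rough \<Rightarrow>
     ((real \<Rightarrow> real^'n) \<times> (real \<Rightarrow> (real^'d) \<Rightarrow>\<^sub>L (real^'n))) set" where
  "Sol T \<beta> \<sigma> A \<xi> XXX = {(Z, Z') \<in> controlled_paths T \<beta> (fst XXX). \<forall>t\<in>{0..T}.
     (\<exists>I. has_rough_integral \<sigma> Z Z' (A Z) XXX 0 t I \<and> Z t = \<xi> + I) \<and>
     Z' t = \<sigma> (Z t, A Z t)}"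

end

theory Submission
  imports Defs "HOL-Complex_Analysis.Great_Picard"
begin

text \<open>The Young term of the germ is bounded by \<open>w(s,t) |t - s|\<^sup>\<beta>\<close> with \<open>w\<close> the 1-variation of \<open>A(Z)\<close>. As
  \<open>w\<close> is superadditive, these terms do not contribute to the integral, and sewing along dyadic
  partitions shows that the remaining germ differs from the increment of the solution by at most
  a constant times \<open>w(s,t) |t - s|\<^sup>\<beta> + |t - s|\<^sup>\<mu>\<close> with \<open>\<mu> > 1\<close>. Since \<open>\<sigma>\<close> is bounded, this bounds the
  solution and its remainder on intervals of a fixed small length, whatever the growth of \<open>F\<close>: a
  bound valid on tiny intervals is propagated by doubling their length. The error of a partition
  sum is then uniform over all solutions whose drivers satisfy a common bound. If continuity
  failed along \<open>X\<^sub>n \<longrightarrow> X\<^sub>0\<close>, by Arzela-Ascoli a subsequence of the solutions would converge, its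
  limit would solve the equation for \<open>X\<^sub>0\<close>, and uniqueness together with interpolation between
  the uniform and the Hoelder norms would give a contradiction.\<close>


subsection \<open>Partitions\<close>

text \<open>The obstacle is a circle: \<Psi> = A(Z) is controlled through \<open>F\<close> of the
  Hoelder norm of Z, the remainder of Z is controlled through \<Psi>, and \<open>F\<close> may grow
  at any rate. It breaks because the leading term \<sigma>(Z, \<Psi>) X is bounded by M K |t -
  s|^\<beta> whatever \<Psi> does. On short intervals the Hoelder constant of Z is therefore at most
  B = M K + 1, a number free of \<open>F\<close>, and the length of these intervals is fixed using
  only F(2B). Treating \<Psi> as a mere \<beta>-Hoelder path would produce a defect of order
  2\<beta> \<le> 1, which cannot be sewn. Kept in the form w(s,t) |t - s|^\<beta>, it can:
  superadditivity of w supplies the exponent 1 and |t - s|^\<beta> the excess. All other defects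
  have order at least \<mu> = (2 + \<alpha>) \<beta>, with \<alpha> a Hoelder exponent of the
  derivative of \<sigma>. The remainder constant enters its own estimate with a spare factor |t -
  s|^(\<alpha>\<beta>), so it is absorbed on short intervals. In the limit argument no rough
  integral has to converge: a fixed partition sum involves finitely many values, and its distance to
  the increment of the solution is bounded uniformly.\<close>

abbreviation mesh_less :: "real \<Rightarrow> real list \<Rightarrow> bool" where
  "mesh_less \<delta> \<equiv> successively (\<lambda>a b. b - a < \<delta>)"

lemma partition_sum_simps [simp]:
  "partition_sum \<Xi> [] = 0"
  "partition_sum \<Xi> [a] = 0"
  "partition_sum \<Xi> (a # b # ps) = \<Xi> a b + partition_sum \<Xi> (b # ps)"
  by (simp_all add: partition_sum_def sum.lessThan_Suc_shift del: sum.lessThan_Suc)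

lemma partitions_singleton_iff [simp]: "[a] \<in> partitions s t \<longleftrightarrow> a = s \<and> a = t"
  by (auto simp: partitions_def)

lemma partitions_Cons_iff [simp]:
  "a # b # ps \<in> partitions s t \<longleftrightarrow> a = s \<and> s < b \<and> b # ps \<in> partitions b t"
  by (auto simp: partitions_def)

lemma Nil_not_in_partitions [simp]: "[] \<notin> partitions s t"
  by (auto simp: partitions_def)

lemma partitions_le: "p \<in> partitions s t \<Longrightarrow> s \<le> t"
proof (induction p arbitrary: s rule: induct_list012)
  case (3 x y zs)
  then show ?case by force
qed auto

text \<open>Peels off the leftmost interval while the right end stays fixed; estimates of partition
  sums are proved in this form.\<close>

lemma partitions_induct [consumes 1, case_names single Cons]:
  assumes "p \<in> partitions s t"
    and "P t [t]"
    and "\<And>s u p. s < u \<Longrightarrow> u \<le> t \<Longrightarrow> u # p \<in> partitions u t \<Longrightarrow> P u (u # p) \<Longrightarrow> P s (s # u # p)"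
  shows "P s p"
  using assms(1)
proof (induction p arbitrary: s rule: induct_list012)
  case (3 x y zs)
  then show ?case
    using assms(3) partitions_le by (metis partitions_Cons_iff)
qed (use assms(2) in auto)

text \<open>A degenerate interval keeps one partition, with empty sum. This is what later makes the
  integral over [0, 0] equal to 0.\<close>

lemma partitions_refl [simp]: "p \<in> partitions s s \<longleftrightarrow> p = [s]"
proof
  assume "p \<in> partitions s s"
  then show "p = [s]"
    by (cases p rule: remdups_adj.cases) (auto dest: partitions_le)
qed auto

lemma eventually_mesh_filter:
  "eventually P (mesh_filter s t) \<longleftrightarrow>
     (\<exists>\<delta>>0. \<forall>p\<in>partitions s t. mesh_less \<delta> p \<longrightarrow> P p)"
proof -
  have "eventually P (mesh_filter s t) \<longleftrightarrow> (\<exists>\<delta>\<in>{0<..}. eventually P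
     (principal {ts \<in> partitions s t. \<forall>i. Suc i < length ts \<longrightarrow> ts ! Suc i - ts ! i < \<delta>}))"
    unfolding mesh_filter_def
  proof (rule eventually_INF_base)
    fix a b :: real assume "a \<in> {0<..}" "b \<in> {0<..}"
    then show "\<exists>x\<in>{0<..}. principal {ts \<in> partitions s t. \<forall>i. Suc i < length ts \<longrightarrow> ts ! Suc i - ts ! i < x}
      \<le> inf (principal {ts \<in> partitions s t. \<forall>i. Suc i < length ts \<longrightarrow> ts ! Suc i - ts ! i < a})
            (principal {ts \<in> partitions s t. \<forall>i. Suc i < length ts \<longrightarrow> ts ! Suc i - ts ! i < b})"
      by (intro bexI[of _ "min a b"]) auto
  qed auto
  then show ?thesis
    by (simp add: eventually_principal successively_conv_nth Bex_def Ball_def conj_commute)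
      (metis less_diff_conv)
qed

text \<open>The head of \<open>q\<close> is dropped because it is \<open>u\<close>, already the last
  point of \<open>p\<close>.\<close>

lemma partitions_append:
  assumes "p \<in> partitions s u" "q \<in> partitions u t"
  shows "p @ tl q \<in> partitions s t"
  using assms(1)
proof (induction rule: partitions_induct)
  case single
  then show ?case using assms(2) by (cases q) (auto simp: partitions_def)
qed auto

lemma mesh_less_append:
  assumes "p \<in> partitions s u" "q \<in> partitions u t" "mesh_less \<delta> p" "mesh_less \<delta> q"
  shows "mesh_less \<delta> (p @ tl q)"
  using assms(1,3)
proof (induction rule: partitions_induct)
  case single
  then show ?case using assms(2,4) by (cases q) (auto simp: partitions_def)
qed auto

lemma partition_sum_append:
  assumes "p \<in> partitions s u" "q \<in> partitions u t"
  shows "partition_sum \<Xi> (p @ tl q) = partition_sum \<Xi> p + partition_sum \<Xi> q"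
  using assms(1)
proof (induction rule: partitions_induct)
  case single
  then show ?case using assms(2) by (cases q) (auto simp: partitions_def)
qed (auto simp: add.assoc)

section \<open>Dyadic partitions and the mesh filter\<close>

fun dyadic :: "nat \<Rightarrow> real \<Rightarrow> real \<Rightarrow> real list" where
  "dyadic 0 s t = [s, t]"
| "dyadic (Suc k) s t = dyadic k s ((s + t) / 2) @ tl (dyadic k ((s + t) / 2) t)"

lemma dyadic_in_partitions: "s < t \<Longrightarrow> dyadic k s t \<in> partitions s t"
proof (induction k arbitrary: s t)
  case (Suc k)
  show ?case
    unfolding dyadic.simps by (rule partitions_append[OF Suc.IH Suc.IH]) (use Suc.prems in auto)
qed auto

lemma mesh_less_dyadic: "s < t \<Longrightarrow> (t - s) / 2 ^ k < \<delta> \<Longrightarrow> mesh_less \<delta> (dyadic k s t)"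
proof (induction k arbitrary: s t)
  case (Suc k)
  have eq: "((s + t) / 2 - s) / 2 ^ k = (t - s) / 2 ^ Suc k" "(t - (s + t) / 2) / 2 ^ k = (t - s) / 2 ^ Suc k"
    by (simp_all add: field_simps)
  have lt: "s < (s + t) / 2" "(s + t) / 2 < t" using Suc.prems by auto
  show ?case
    unfolding dyadic.simps
    by (rule mesh_less_append[OF dyadic_in_partitions dyadic_in_partitions Suc.IH Suc.IH])
      (use Suc.prems lt in \<open>simp_all only: eq\<close>)
qed auto

lemma filterlim_dyadic:
  assumes "s < t"
  shows "filterlim (\<lambda>k. dyadic k s t) (mesh_filter s t) sequentially"
  unfolding filterlim_iff eventually_mesh_filter
proof (intro allI impI, elim exE conjE)
  fix P and \<delta> :: real
  assume "0 < \<delta>" and P: "\<forall>p\<in>partitions s t. mesh_less \<delta> p \<longrightarrow> P p"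
  have "(\<lambda>k. (t - s) / 2 ^ k) \<longlonglongrightarrow> 0"
    by real_asymp
  from order_tendstoD(2)[OF this \<open>0 < \<delta>\<close>]
  show "\<forall>\<^sub>F k in sequentially. P (dyadic k s t)"
    by eventually_elim (use P assms dyadic_in_partitions mesh_less_dyadic in blast)
qed

text \<open>Dyadic sequences run into the filter, so it is proper. Uniqueness of limits and the
  passage of bounds to limits rest on this.\<close>

lemma mesh_filter_neq_bot [simp]: "s \<le> t \<Longrightarrow> mesh_filter s t \<noteq> bot"
proof (cases "s = t")
  case False
  assume "s \<le> t"
  then show ?thesis
    using filterlim_dyadic[of s t] False unfolding filterlim_def
    by (metis bot.extremum_uniqueI filtermap_bot_iff order_le_imp_less_or_eq trivial_limit_sequentially)
qed (auto simp: trivial_limit_def eventually_mesh_filter)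

lemma ex_fine_partition:
  assumes "s \<le> t" "0 < \<delta>"
  shows "\<exists>p\<in>partitions s t. mesh_less \<delta> p"
proof (rule ccontr)
  assume "\<not> ?thesis"
  then have "eventually (\<lambda>_. False) (mesh_filter s t)"
    using assms unfolding eventually_mesh_filter by blast
  then show False
    using mesh_filter_neq_bot[OF assms(1)] trivial_limit_def by blast
qed

section \<open>Controls and sums of germs along partitions\<close>

definition control :: "real \<Rightarrow> real \<Rightarrow> (real \<Rightarrow> real \<Rightarrow> real) \<Rightarrow> bool" where
  "control a b w \<longleftrightarrow> (\<forall>s t. a \<le> s \<and> s \<le> t \<and> t \<le> b \<longrightarrow> 0 \<le> w s t) \<and>
     (\<forall>s u t. a \<le> s \<and> s \<le> u \<and> u \<le> t \<and> t \<le> b \<longrightarrow> w s u + w u t \<le> w s t)"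

lemma controlD:
  assumes "control a b w" "a \<le> s" "s \<le> t" "t \<le> b"
  shows control_nonneg: "0 \<le> w s t"
    and control_superadd: "s \<le> u \<Longrightarrow> u \<le> t \<Longrightarrow> w s u + w u t \<le> w s t"
  using assms unfolding control_def by auto

lemma control_mono:
  assumes "control a b w" "a \<le> s" "s \<le> u" "u \<le> v" "v \<le> t" "t \<le> b"
  shows "w u v \<le> w s t"
proof -
  have "w s u + w u v \<le> w s v" "w s v + w v t \<le> w s t" "0 \<le> w s u" "0 \<le> w v t"
    using assms control_superadd[OF assms(1)] control_nonneg[OF assms(1)] by auto
  then show ?thesis by linarith
qed

lemma control_subset: "control a b w \<Longrightarrow> a \<le> a' \<Longrightarrow> b' \<le> b \<Longrightarrow> control a' b' w"
  unfolding control_def by fastforce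

lemma control_add:
  "control a b v \<Longrightarrow> control a b w \<Longrightarrow> control a b (\<lambda>s t. v s t + w s t)"
  unfolding control_def by (auto intro: add_nonneg_nonneg) (smt (verit, ccfv_SIG))

lemma control_scale: "control a b w \<Longrightarrow> 0 \<le> c \<Longrightarrow> control a b (\<lambda>s t. c * w s t)"
  unfolding control_def by (auto simp flip: distrib_left intro!: mult_left_mono)

lemma control_length: "control a b (\<lambda>s t. t - s)"
  unfolding control_def by auto

text \<open>Local bounds by a superadditive \<open>e\<close> add up to at most \<open>e s t\<close>,
  however many intervals the partition has.\<close>

lemma partition_sum_norm_le:
  fixes \<Xi> :: "real \<Rightarrow> real \<Rightarrow> 'v::real_normed_vector"
  assumes "p \<in> partitions s t" "mesh_less \<delta> p" "control s t e"
    and "\<And>u v. s \<le> u \<Longrightarrow> u < v \<Longrightarrow> v \<le> t \<Longrightarrow> v - u < \<delta> \<Longrightarrow> norm (\<Xi> u v) \<le> e u v"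
  shows "norm (partition_sum \<Xi> p) \<le> e s t"
  using assms
proof (induction rule: partitions_induct)
  case single
  then show ?case by (simp add: control_def)
next
  case (Cons s u p)
  have "norm (\<Xi> s u) \<le> e s u" using Cons.prems Cons.hyps by auto
  moreover have "norm (partition_sum \<Xi> (u # p)) \<le> e u t"
    by (rule Cons.IH) (use Cons.prems Cons.hyps in \<open>auto intro: control_subset\<close>)
  moreover have "e s u + e u t \<le> e s t"
    using Cons.prems Cons.hyps by (auto intro: control_superadd)
  ultimately show ?case by (auto intro: norm_triangle_le)
qed

lemma partition_sum_diff:
  fixes f g :: "real \<Rightarrow> real \<Rightarrow> 'v::real_normed_vector"
  shows "partition_sum (\<lambda>u v. f u v - g u v) p = partition_sum f p - partition_sum g p"
  by (simp add: partition_sum_def sum_subtractf)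

lemma partition_sum_increments:
  fixes f :: "real \<Rightarrow> 'v::real_normed_vector"
  assumes "p \<in> partitions s t"
  shows "partition_sum (\<lambda>u v. f v - f u) p = f t - f s"
  using assms by (induction rule: partitions_induct) auto

text \<open>Points are removed from the left and every defect is taken relative to the fixed right
  end, so each removal costs only \<open>w\<close> of the removed interval. Superadditivity adds the
  costs up with no geometric factor. Young germs have a defect of exactly this one-sided
  form.\<close>

lemma partition_sum_germ_bound:
  fixes \<Xi> :: "real \<Rightarrow> real \<Rightarrow> 'v::real_normed_vector"
  assumes "p \<in> partitions s t" "control s t w" "\<Xi> t t = 0" "0 \<le> K"
    and "\<And>u v. s \<le> u \<Longrightarrow> u < v \<Longrightarrow> v \<le> t \<Longrightarrow>
           norm (\<Xi> u v + \<Xi> v t - \<Xi> u t) \<le> K * w u v"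
  shows "norm (partition_sum \<Xi> p - \<Xi> s t) \<le> K * w s t"
  using assms
proof (induction rule: partitions_induct)
  case single
  then show ?case by (simp add: control_def)
next
  case (Cons s u p)
  have "norm (\<Xi> s u + \<Xi> u t - \<Xi> s t) \<le> K * w s u" using Cons.prems Cons.hyps by auto
  moreover have "norm (partition_sum \<Xi> (u # p) - \<Xi> u t) \<le> K * w u t"
    by (rule Cons.IH) (use Cons.prems Cons.hyps in \<open>auto intro: control_subset\<close>)
  moreover have "K * w s u + K * w u t \<le> K * w s t"
    using Cons.prems Cons.hyps by (auto intro!: control_superadd mult_left_mono simp flip: distrib_left)
  moreover have "partition_sum \<Xi> (s # u # p) - \<Xi> s t =
      (\<Xi> s u + \<Xi> u t - \<Xi> s t) + (partition_sum \<Xi> (u # p) - \<Xi> u t)"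
    by simp
  ultimately show ?case
    using norm_triangle_ineq[of "\<Xi> s u + \<Xi> u t - \<Xi> s t" "partition_sum \<Xi> (u # p) - \<Xi> u t"] by (simp only:)
qed

text \<open>Merging two halves costs one midpoint defect, and the errors of the halves together are
  at most \<open>q\<close> times that of the whole: e + q e / (1 - q) = e / (1 - q). Contraction
  under halving is the only structure of \<open>e\<close> involved, so sums of different kinds of
  errors are allowed. The bound does not depend on the depth.\<close>

lemma dyadic_sewing:
  fixes \<Xi> :: "real \<Rightarrow> real \<Rightarrow> 'v::real_normed_vector"
  assumes "s < t" "a \<le> s" "t \<le> b" "q < 1"
    and defect: "\<And>s u t. a \<le> s \<Longrightarrow> s < u \<Longrightarrow> u < t \<Longrightarrow> t \<le> b \<Longrightarrow>
           norm (\<Xi> s t - \<Xi> s u - \<Xi> u t) \<le> e s t"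
    and contract: "\<And>s t. a \<le> s \<Longrightarrow> s < t \<Longrightarrow> t \<le> b \<Longrightarrow>
           e s ((s + t) / 2) + e ((s + t) / 2) t \<le> q * e s t"
    and nonneg: "\<And>s t. a \<le> s \<Longrightarrow> s < t \<Longrightarrow> t \<le> b \<Longrightarrow> 0 \<le> e s t"
  shows "norm (partition_sum \<Xi> (dyadic k s t) - \<Xi> s t) \<le> e s t / (1 - q)"
  using assms(1-3)
proof (induction k arbitrary: s t)
  case 0
  then show ?case using nonneg \<open>q < 1\<close> by simp
next
  case (Suc k)
  define m where "m = (s + t) / 2"
  have m: "s < m" "m < t" using Suc.prems by (auto simp: m_def)
  have "partition_sum \<Xi> (dyadic (Suc k) s t) =
      partition_sum \<Xi> (dyadic k s m) + partition_sum \<Xi> (dyadic k m t)"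
    using partition_sum_append[OF dyadic_in_partitions dyadic_in_partitions, of s m t] m
    by (simp add: m_def)
  then have "partition_sum \<Xi> (dyadic (Suc k) s t) - \<Xi> s t =
     (partition_sum \<Xi> (dyadic k s m) - \<Xi> s m) + (partition_sum \<Xi> (dyadic k m t) - \<Xi> m t)
     - (\<Xi> s t - \<Xi> s m - \<Xi> m t)"
    by simp
  also have "norm \<dots> \<le> e s m / (1 - q) + e m t / (1 - q) + e s t"
    by (intro norm_triangle_le_diff norm_triangle_le add_mono Suc.IH defect)
      (use m Suc.prems in auto)
  also have "\<dots> = (e s m + e m t) / (1 - q) + e s t" by (simp add: add_divide_distrib)
  also have "\<dots> \<le> q * e s t / (1 - q) + e s t"
    using contract[of s t] Suc.prems \<open>q < 1\<close> by (auto simp: m_def intro!: divide_right_mono)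
  also have "\<dots> = e s t / (1 - q)" using \<open>q < 1\<close> by (simp add: field_simps)
  finally show ?case .
qed

subsection \<open>Norms\<close>

lemma holder2_norm_le_iff:
  assumes "0 \<le> C"
  shows "holder2_norm T \<theta> F \<le> ennreal C \<longleftrightarrow>
    (\<forall>s t. 0 \<le> s \<and> s < t \<and> t \<le> T \<longrightarrow> norm (F s t) \<le> C * (t - s) powr \<theta>)"
  unfolding holder2_norm_def SUP_le_iff using assms
  by (auto simp: ennreal_le_iff divide_le_eq)

lemma holder2_normD:
  assumes "holder2_norm T \<theta> F < \<infinity>" "0 \<le> s" "s < t" "t \<le> T"
  shows "norm (F s t) \<le> enn2real (holder2_norm T \<theta> F) * (t - s) powr \<theta>"
proof -
  have "holder2_norm T \<theta> F \<le> ennreal (enn2real (holder2_norm T \<theta> F))"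
    using assms(1) by simp
  then show ?thesis
    using assms by (subst (asm) holder2_norm_le_iff) auto
qed

lemma holder2_norm_finiteI:
  assumes "\<And>s t. 0 \<le> s \<Longrightarrow> s < t \<Longrightarrow> t \<le> T \<Longrightarrow> norm (F s t) \<le> C * (t - s) powr \<theta>"
  shows "holder2_norm T \<theta> F < \<infinity>"
proof -
  have "holder2_norm T \<theta> F \<le> ennreal (max C 0)"
    by (subst holder2_norm_le_iff) (auto intro: order_trans[OF assms] mult_right_mono)
  then show ?thesis
    by (metis ennreal_less_top infinity_ennreal_def le_less_trans)
qed

lemma holder2_norm_diff_finite:
  assumes "holder2_norm T \<theta> F < \<infinity>" "holder2_norm T \<theta> G < \<infinity>"
  shows "holder2_norm T \<theta> (\<lambda>s t. F s t - G s t) < \<infinity>"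
proof (rule holder2_norm_finiteI)
  fix s t assume "0 \<le> s" "s < t" "t \<le> T"
  from holder2_normD[OF assms(1) this] holder2_normD[OF assms(2) this]
  show "norm (F s t - G s t) \<le>
      (enn2real (holder2_norm T \<theta> F) + enn2real (holder2_norm T \<theta> G)) * (t - s) powr \<theta>"
    by (intro norm_triangle_le_diff) (auto simp: distrib_right)
qed

text \<open>The square root in the distance is why the second level is small of order
  \<open>\<delta>\<^sup>2\<close>. Finiteness of both difference norms excludes the default value 0
  of \<open>enn2real\<close> at infinity.\<close>

lemma rough_dist_bounds:
  assumes XY: "XXX \<in> rough_paths T \<beta>" "YYY \<in> rough_paths T \<beta>" and dist: "rough_dist T \<beta> XXX YYY \<le> \<delta>"
    and st: "0 \<le> s" "s < t" "t \<le> T"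
  shows "norm (fst XXX s t - fst YYY s t) \<le> \<delta> * (t - s) powr \<beta>"
    and "norm (snd XXX s t - snd YYY s t) \<le> \<delta>\<^sup>2 * (t - s) powr (2 * \<beta>)"
proof -
  define a where "a = enn2real (holder2_norm T \<beta> (\<lambda>s t. fst XXX s t - fst YYY s t))"
  define b where "b = enn2real (holder2_norm T (2 * \<beta>) (\<lambda>s t. snd XXX s t - snd YYY s t))"
  have ab: "0 \<le> a" "0 \<le> b" "a + sqrt b \<le> \<delta>"
    using dist by (auto simp: a_def b_def rough_dist_def)
  have fin: "holder2_norm T \<beta> (\<lambda>s t. fst XXX s t - fst YYY s t) < \<infinity>"
    "holder2_norm T (2 * \<beta>) (\<lambda>s t. snd XXX s t - snd YYY s t) < \<infinity>"
    by (rule holder2_norm_diff_finite; use XY in \<open>auto simp: rough_paths_def\<close>)+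
  have "norm (fst XXX s t - fst YYY s t) \<le> a * (t - s) powr \<beta>"
    unfolding a_def by (rule holder2_normD[OF fin(1) st])
  also have "\<dots> \<le> \<delta> * (t - s) powr \<beta>"
    using ab real_sqrt_ge_zero[OF \<open>0 \<le> b\<close>] by (intro mult_right_mono) (linarith, simp)
  finally show "norm (fst XXX s t - fst YYY s t) \<le> \<delta> * (t - s) powr \<beta>" .
  have "norm (snd XXX s t - snd YYY s t) \<le> b * (t - s) powr (2 * \<beta>)"
    unfolding b_def by (rule holder2_normD[OF fin(2) st])
  also have "\<dots> \<le> \<delta>\<^sup>2 * (t - s) powr (2 * \<beta>)"
    using ab by (intro mult_right_mono sqrt_le_D) (linarith, simp)
  finally show "norm (snd XXX s t - snd YYY s t) \<le> \<delta>\<^sup>2 * (t - s) powr (2 * \<beta>)" .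
qed

lemma ex_small_powr:
  fixes \<beta> K \<epsilon> :: real
  assumes "0 < \<beta>" "0 \<le> K" "0 < \<epsilon>"
  shows "\<exists>h>0. \<forall>x. 0 \<le> x \<and> x \<le> h \<longrightarrow> K * x powr \<beta> \<le> \<epsilon>"
\<comment> \<open>\<open>K + 1\<close> instead of \<open>K\<close> keeps the witness positive when
  \<open>K = 0\<close>.\<close>
proof (intro exI[of _ "(\<epsilon> / (K + 1)) powr (1 / \<beta>)"] conjI allI impI)
  fix x assume "0 \<le> x \<and> x \<le> (\<epsilon> / (K + 1)) powr (1 / \<beta>)"
  then have "x powr \<beta> \<le> ((\<epsilon> / (K + 1)) powr (1 / \<beta>)) powr \<beta>"
    using assms by (intro powr_mono2) auto
  also have "\<dots> = \<epsilon> / (K + 1)" using assms by (simp add: powr_powr)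
  finally have "K * x powr \<beta> \<le> K * (\<epsilon> / (K + 1))" using assms by (intro mult_left_mono)
  also have "\<dots> \<le> \<epsilon>" using assms by (simp add: field_simps)
  finally show "K * x powr \<beta> \<le> \<epsilon>" .
qed (use assms in auto)

lemma mesh_less_trivial: "p \<in> partitions s t \<Longrightarrow> t - s < \<delta> \<Longrightarrow> mesh_less \<delta> p"
proof (induction rule: partitions_induct)
  case (Cons s u p)
  then show ?case by auto
qed auto

text \<open>With p = 1 / \<open>\<beta>\<^sub>0\<close>, each summand is at most N^p (v - u)^(p
  \<beta>). Since p \<beta> \<ge> 1, one factor v - u can be kept and the rest estimated by the full
  length; lengths are additive, so the sum is bounded for every partition.\<close>

lemma pvar_holder_le:
  assumes x: "\<And>u v. s \<le> u \<Longrightarrow> u < v \<Longrightarrow> v \<le> t \<Longrightarrow> norm (x v - x u) \<le> N * (v - u) powr \<beta>"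
    and "0 < \<beta>\<^sub>0" "\<beta>\<^sub>0 \<le> \<beta>" "0 \<le> N"
  shows "pvar (1 / \<beta>\<^sub>0) x s t \<le> ennreal (N * (t - s) powr \<beta>)"
  unfolding pvar_def
proof (rule SUP_least, rule ennreal_leI)
  fix p assume p: "p \<in> partitions s t"
  then have "s \<le> t" by (rule partitions_le)
  define e where "e u v = N powr (1 / \<beta>\<^sub>0) * (t - s) powr (\<beta> / \<beta>\<^sub>0 - 1) * (v - u)" for u v
  have "control s t e"
    unfolding e_def by (intro control_scale control_length) auto
  have "norm (partition_sum (\<lambda>u v. norm (x v - x u) powr (1 / \<beta>\<^sub>0)) p) \<le> e s t"
  \<comment> \<open>A mesh larger than the interval is no restriction; \<open>+ 1\<close> is due to
    the strict inequality in \<open>mesh_less\<close>.\<close>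
  proof (rule partition_sum_norm_le[OF p mesh_less_trivial[OF p, of "t - s + 1"] \<open>control s t e\<close>])
    fix u v assume uv: "s \<le> u" "u < v" "v \<le> t"
    have "norm (x v - x u) powr (1 / \<beta>\<^sub>0) \<le> (N * (v - u) powr \<beta>) powr (1 / \<beta>\<^sub>0)"
      using x[OF uv] assms by (intro powr_mono2) auto
    also have "\<dots> = N powr (1 / \<beta>\<^sub>0) * ((v - u) powr (\<beta> / \<beta>\<^sub>0 - 1) * (v - u))"
      using uv assms by (simp add: powr_mult powr_powr powr_diff)
    also have "\<dots> \<le> N powr (1 / \<beta>\<^sub>0) * ((t - s) powr (\<beta> / \<beta>\<^sub>0 - 1) * (v - u))"
      using uv assms by (intro mult_left_mono mult_right_mono powr_mono2) auto
    finally show "norm (norm (x v - x u) powr (1 / \<beta>\<^sub>0)) \<le> e u v"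
      by (simp add: e_def)
  qed auto
  then have "partition_sum (\<lambda>u v. norm (x v - x u) powr (1 / \<beta>\<^sub>0)) p \<le> e s t"
    "0 \<le> partition_sum (\<lambda>u v. norm (x v - x u) powr (1 / \<beta>\<^sub>0)) p"
    by (auto simp: partition_sum_def intro!: sum_nonneg)
  then have "partition_sum (\<lambda>u v. norm (x v - x u) powr (1 / \<beta>\<^sub>0)) p powr (1 / (1 / \<beta>\<^sub>0)) \<le> e s t powr \<beta>\<^sub>0"
    using assms by (auto intro!: powr_mono2)
  also have "\<dots> \<le> N * (t - s) powr \<beta>"
  proof (cases "s = t")
    case False
    have "e s t = N powr (1 / \<beta>\<^sub>0) * (t - s) powr (\<beta> / \<beta>\<^sub>0)"
      using False \<open>s \<le> t\<close> by (simp add: e_def powr_diff)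
    then show ?thesis
      using assms False \<open>s \<le> t\<close> by (simp add: powr_mult powr_powr)
  qed (use assms in \<open>auto simp: e_def\<close>)
  finally show "partition_sum (\<lambda>u v. norm (x v - x u) powr (1 / \<beta>\<^sub>0)) p powr (1 / (1 / \<beta>\<^sub>0))
    \<le> N * (t - s) powr \<beta>" .
qed

lemma infvar_holder_le:
  assumes "\<And>u v. s \<le> u \<Longrightarrow> u < v \<Longrightarrow> v \<le> t \<Longrightarrow> norm (x v - x u) \<le> N * (v - u) powr \<beta>"
    and "0 \<le> N" "0 < \<beta>"
  shows "infvar x s t \<le> ennreal (N * (t - s) powr \<beta>)"
  unfolding infvar_def
proof (rule SUP_least, safe, rule ennreal_leI)
  fix u v assume uv: "s \<le> u" "u \<le> v" "v \<le> t"
  have "norm (x v - x u) \<le> N * (v - u) powr \<beta>"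
    using assms(1)[of u v] uv assms by (cases "u = v") auto
  also have "\<dots> \<le> N * (t - s) powr \<beta>"
    using uv assms by (intro mult_left_mono powr_mono2) auto
  finally show "norm (x v - x u) \<le> N * (t - s) powr \<beta>" .
qed

section \<open>The 1-variation as a control\<close>

lemma pvar_1: "pvar 1 x s t = (SUP p\<in>partitions s t. ennreal (partition_sum (\<lambda>u v. norm (x v - x u)) p))"
proof -
  have "0 \<le> partition_sum (\<lambda>u v. norm (x v - x u)) p" for p
    by (auto simp: partition_sum_def intro: sum_nonneg)
  then show ?thesis by (simp add: pvar_def)
qed

text \<open>Partitions of the two halves concatenate; the suprema over them are then taken one after
  the other. Finiteness makes \<open>enn2real\<close> faithful: its default 0 for an infinite
  variation would falsify the bound on increments.\<close>

lemma variation_control: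
  assumes fin: "\<And>s t. a \<le> s \<Longrightarrow> s \<le> t \<Longrightarrow> t \<le> b \<Longrightarrow> pvar 1 x s t < \<infinity>"
  shows "control a b (\<lambda>s t. enn2real (pvar 1 x s t))"
    and "a \<le> s \<Longrightarrow> s \<le> t \<Longrightarrow> t \<le> b \<Longrightarrow> norm (x t - x s) \<le> enn2real (pvar 1 x s t)"
proof -
  define W where "W s t = enn2real (pvar 1 x s t)" for s t
  define S where "S = partition_sum (\<lambda>u v. norm (x v - x u))"
  have S0: "0 \<le> S p" for p
    by (auto simp: S_def partition_sum_def intro: sum_nonneg)
  have upper: "S p \<le> W s t" if "a \<le> s" "s \<le> t" "t \<le> b" "p \<in> partitions s t" for s t p
  proof -
    have "ennreal (S p) \<le> pvar 1 x s t"
      unfolding pvar_1 S_def using that by (intro SUP_upper)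
    then show ?thesis
      using fin[OF that(1-3)] unfolding W_def
      by (metis S0 enn2real_ennreal enn2real_mono infinity_ennreal_def)
  qed
  have least: "W s t \<le> c" if "\<And>p. p \<in> partitions s t \<Longrightarrow> S p \<le> c" "0 \<le> c" for s t c
  proof -
    have "pvar 1 x s t \<le> ennreal c"
      unfolding pvar_1 using that by (intro SUP_least ennreal_leI) (auto simp: S_def)
    then show ?thesis
      unfolding W_def using \<open>0 \<le> c\<close> by (simp add: enn2real_leI)
  qed
  have "W s u + W u t \<le> W s t" if st: "a \<le> s" "s \<le> u" "u \<le> t" "t \<le> b" for s u t
  proof -
    have sum: "S p + S q \<le> W s t" if "p \<in> partitions s u" "q \<in> partitions u t" for p q
      using upper[of s t "p @ tl q"] partitions_append[OF that] st
      by (simp add: S_def partition_sum_append[OF that])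
    have "W s u \<le> W s t - S q" if q: "q \<in> partitions u t" for q
    proof (rule least)
      obtain p where "p \<in> partitions s u" using ex_fine_partition[of s u 1] st by auto
      then show "0 \<le> W s t - S q" using sum[of p q] S0[of p] q by auto
    qed (use sum q in fastforce)
    then have "W u t \<le> W s t - W s u"
    proof (intro least)
      obtain q where "q \<in> partitions u t" using ex_fine_partition[of u t 1] st by auto
      then show "0 \<le> W s t - W s u"
        using \<open>\<And>q. q \<in> partitions u t \<Longrightarrow> W s u \<le> W s t - S q\<close>[of q] S0[of q] by auto
    qed force
    then show ?thesis by simp
  qed
  then show "control a b (\<lambda>s t. enn2real (pvar 1 x s t))"
    unfolding control_def W_def by auto
  assume st: "a \<le> s" "s \<le> t" "t \<le> b"
  show "norm (x t - x s) \<le> enn2real (pvar 1 x s t)"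
  proof (cases "s = t")
    case False
    then show ?thesis using upper[OF st, of "[s, t]"] st by (auto simp: S_def W_def)
  qed auto
qed

subsection \<open>Refinement and Young integrals\<close>

lemma partitions_set:
  assumes "p \<in> partitions s t"
  shows "s \<in> set p" "t \<in> set p" "set p \<subseteq> {s..t}" "sorted_wrt (<) p"
proof -
  show "s \<in> set p" "t \<in> set p" "sorted_wrt (<) p"
    using assms by (auto simp: partitions_def)
  show "set p \<subseteq> {s..t}"
    using assms by (induction rule: partitions_induct) auto
qed

lemma partitionsI:
  assumes "sorted_wrt (<) p" "s \<in> set p" "t \<in> set p" "set p \<subseteq> {s..t}"
  shows "p \<in> partitions s t"
proof -
  have "p \<noteq> []" using assms by auto
  have "hd p \<le> s"
    using assms(1,2) by (cases p) auto
  moreover have "t \<le> last p"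
  proof -
    have "sorted_wrt (<) (butlast p @ [last p])" "t \<in> set (butlast p @ [last p])"
      using assms \<open>p \<noteq> []\<close> by simp_all
    then show ?thesis unfolding sorted_wrt_append by auto
  qed
  moreover have "hd p \<in> {s..t}" "last p \<in> {s..t}"
    using assms \<open>p \<noteq> []\<close> by (meson hd_in_set last_in_set subsetD)+
  ultimately show ?thesis
    using \<open>p \<noteq> []\<close> assms(1) by (auto simp: partitions_def)
qed

lemma common_refinement:
  assumes "p \<in> partitions s t" "q \<in> partitions s t"
  obtains r where "r \<in> partitions s t" "set p \<subseteq> set r" "set q \<subseteq> set r"
proof
  show "sorted_list_of_set (set p \<union> set q) \<in> partitions s t"
    using partitions_set[OF assms(1)] partitions_set[OF assms(2)]
    by (intro partitionsI) auto
qed auto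

text \<open>The last property says that no point to the right of \<open>b\<close> is lost, so that
  inclusion of a coarser partition in \<open>q\<close> is inherited by \<open>q2\<close>.\<close>

lemma split_partition:
  assumes "q \<in> partitions s t" "b \<in> set q"
  obtains q1 q2 where "q1 \<in> partitions s b" "q2 \<in> partitions b t" "q = q1 @ tl q2"
    "set q \<inter> {b..} \<subseteq> set q2"
proof -
  have "\<exists>q1\<in>partitions s b. \<exists>q2\<in>partitions b t. q = q1 @ tl q2 \<and> set q \<inter> {b..} \<subseteq> set q2"
    using assms
  proof (induction rule: partitions_induct)
    case single
    then show ?case by (intro bexI[of _ "[b]"]) auto
  next
    case (Cons s u p)
    show ?case
    proof (cases "b = s")
      case True
      then show ?thesis
        using Cons.hyps by (intro bexI[of _ "[s]"] bexI[of _ "s # u # p"]) auto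
    next
      case False
      then have b: "b \<in> set (u # p)" using Cons.prems by auto
      then have "u \<le> b" using partitions_set(3)[OF Cons.hyps(3)] by auto
      from Cons.IH[OF b] obtain q1 q2 where q: "q1 \<in> partitions u b" "q2 \<in> partitions b t"
        "u # p = q1 @ tl q2" "set (u # p) \<inter> {b..} \<subseteq> set q2" by blast
      have "s # q1 \<in> partitions s b"
        using q(1) Cons.hyps(1) by (cases q1) (auto simp: partitions_def)
      then show ?thesis
        using q Cons.hyps(1) \<open>u \<le> b\<close> by (intro bexI[of _ "s # q1"] bexI[of _ q2]) auto
    qed
  qed
  then show ?thesis using that by blast
qed

text \<open>A refinement subdivides each interval of \<open>p\<close> separately, so the one-sided
  germ bound applies on each of them. Only intervals shorter than \<open>\<delta>\<close> occur,
  hence the restricted defect hypothesis.\<close>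

lemma partition_sum_refinement:
  fixes \<Xi> :: "real \<Rightarrow> real \<Rightarrow> 'v::real_normed_vector"
  assumes "p \<in> partitions s t" "mesh_less \<delta> p" "q \<in> partitions s t" "set p \<subseteq> set q"
    and "control s t w" "0 \<le> c" "\<And>u. s \<le> u \<Longrightarrow> u \<le> t \<Longrightarrow> \<Xi> u u = 0"
    and "\<And>u v z. s \<le> u \<Longrightarrow> u < v \<Longrightarrow> v \<le> z \<Longrightarrow> z \<le> t \<Longrightarrow> z - u < \<delta> \<Longrightarrow>
           norm (\<Xi> u v + \<Xi> v z - \<Xi> u z) \<le> c * w u v"
  shows "norm (partition_sum \<Xi> q - partition_sum \<Xi> p) \<le> c * w s t"
  using assms
proof (induction arbitrary: q rule: partitions_induct)
  case single
  then show ?case by (auto simp: control_def)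
next
  case (Cons s u p)
  obtain q1 q2 where q: "q1 \<in> partitions s u" "q2 \<in> partitions u t" "q = q1 @ tl q2"
    "set q \<inter> {u..} \<subseteq> set q2"
    using split_partition[of q s t u] Cons.prems by auto
  have "set (u # p) \<subseteq> {u..}" using partitions_set(3)[OF Cons.hyps(3)] by auto
  then have "set (u # p) \<subseteq> set q2" using q(4) Cons.prems(3) by auto
  then have "norm (partition_sum \<Xi> q2 - partition_sum \<Xi> (u # p)) \<le> c * w u t"
    using q Cons.prems Cons.hyps by (intro Cons.IH) (auto intro: control_subset)
  moreover have "norm (partition_sum \<Xi> q1 - \<Xi> s u) \<le> c * w s u"
    using Cons.prems Cons.hyps
    by (intro partition_sum_germ_bound[OF q(1)]) (auto intro: control_subset)
  moreover have "c * w s u + c * w u t \<le> c * w s t"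
    using Cons.prems Cons.hyps by (auto intro!: control_superadd mult_left_mono simp flip: distrib_left)
  moreover have "partition_sum \<Xi> q - partition_sum \<Xi> (s # u # p) =
      (partition_sum \<Xi> q1 - \<Xi> s u) + (partition_sum \<Xi> q2 - partition_sum \<Xi> (u # p))"
    using partition_sum_append[OF q(1,2)] q(3) by simp
  ultimately show ?case
    using norm_triangle_ineq[of "partition_sum \<Xi> q1 - \<Xi> s u"
        "partition_sum \<Xi> q2 - partition_sum \<Xi> (u # p)"] by (simp only:)
qed

text \<open>Two fine partitions are compared through a common refinement, which yields a Cauchy
  property along the whole filter. The candidate for the limit is then the limit of the dyadic
  sums.\<close>

lemma partition_sum_convergent:
  fixes \<Xi> :: "real \<Rightarrow> real \<Rightarrow> 'v::banach"
  assumes "s < t" and w: "control s t w" and zero: "\<And>u. s \<le> u \<Longrightarrow> u \<le> t \<Longrightarrow> \<Xi> u u = 0"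
    and defect: "\<And>\<epsilon>. 0 < \<epsilon> \<Longrightarrow> \<exists>\<delta>>0. \<forall>u v z. s \<le> u \<and> u < v \<and> v \<le> z \<and> z \<le> t \<and> z - u < \<delta> \<longrightarrow>
           norm (\<Xi> u v + \<Xi> v z - \<Xi> u z) \<le> \<epsilon> * w u v"
  obtains L where "(partition_sum \<Xi> \<longlongrightarrow> L) (mesh_filter s t)"
proof -
  have "0 \<le> w s t" using w \<open>s < t\<close> by (auto simp: control_def)
  have cauchy: "\<exists>\<delta>>0. \<forall>p\<in>partitions s t. \<forall>q\<in>partitions s t. mesh_less \<delta> p \<longrightarrow> mesh_less \<delta> q \<longrightarrow>
      norm (partition_sum \<Xi> p - partition_sum \<Xi> q) \<le> \<epsilon>" if "0 < \<epsilon>" for \<epsilon>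
  proof -
    \<comment> \<open>The factor 2 pays for the two comparisons with the common refinement;
      \<open>+ 1\<close> keeps the denominator positive if \<open>w s t = 0\<close>.\<close>
    define \<eta> where "\<eta> = \<epsilon> / (2 * (w s t + 1))"
    have "0 < \<eta>" "2 * \<eta> * w s t \<le> \<epsilon>" using that \<open>0 \<le> w s t\<close> by (auto simp: \<eta>_def field_simps)
    from defect[OF \<open>0 < \<eta>\<close>] obtain \<delta> where "0 < \<delta>"
      and \<delta>: "\<And>u v z. s \<le> u \<Longrightarrow> u < v \<Longrightarrow> v \<le> z \<Longrightarrow> z \<le> t \<Longrightarrow> z - u < \<delta> \<Longrightarrow>
           norm (\<Xi> u v + \<Xi> v z - \<Xi> u z) \<le> \<eta> * w u v" by blast
    have "norm (partition_sum \<Xi> p - partition_sum \<Xi> q) \<le> \<epsilon>"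
      if pq: "p \<in> partitions s t" "q \<in> partitions s t" "mesh_less \<delta> p" "mesh_less \<delta> q" for p q
    proof -
      obtain r where r: "r \<in> partitions s t" "set p \<subseteq> set r" "set q \<subseteq> set r"
        using common_refinement pq by blast
      have "norm (partition_sum \<Xi> r - partition_sum \<Xi> p) \<le> \<eta> * w s t"
        "norm (partition_sum \<Xi> r - partition_sum \<Xi> q) \<le> \<eta> * w s t"
        using pq r w zero \<delta> \<open>0 < \<eta>\<close> by (auto intro!: partition_sum_refinement[where \<delta> = \<delta> and w = w and s = s and t = t])
      then have "norm ((partition_sum \<Xi> r - partition_sum \<Xi> q) - (partition_sum \<Xi> r - partition_sum \<Xi> p))
          \<le> \<eta> * w s t + \<eta> * w s t"
        by (intro norm_triangle_le_diff) auto
      then show ?thesis using \<open>2 * \<eta> * w s t \<le> \<epsilon>\<close> by simp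
    qed
    then show ?thesis using \<open>0 < \<delta>\<close> by blast
  qed
  have fine: "\<forall>\<^sub>F k in sequentially. dyadic k s t \<in> partitions s t \<and> mesh_less \<delta> (dyadic k s t)"
    if "0 < \<delta>" for \<delta>
  proof -
    have "\<forall>\<^sub>F p in mesh_filter s t. p \<in> partitions s t \<and> mesh_less \<delta> p"
      unfolding eventually_mesh_filter using that by (intro exI[of _ \<delta>]) auto
    then show ?thesis
      using filterlim_dyadic[OF \<open>s < t\<close>] by (rule eventually_compose_filterlim)
  qed
  have "Cauchy (\<lambda>k. partition_sum \<Xi> (dyadic k s t))"
  proof (rule metric_CauchyI)
    fix \<epsilon> :: real assume "0 < \<epsilon>"
    with cauchy[of "\<epsilon> / 2"] obtain \<delta> where "0 < \<delta>" and \<delta>: "\<And>p q. p \<in> partitions s t \<Longrightarrow>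
      q \<in> partitions s t \<Longrightarrow> mesh_less \<delta> p \<Longrightarrow> mesh_less \<delta> q \<Longrightarrow>
      norm (partition_sum \<Xi> p - partition_sum \<Xi> q) \<le> \<epsilon> / 2" by auto
    from fine[OF \<open>0 < \<delta>\<close>] obtain N where "\<And>k. N \<le> k \<Longrightarrow>
      dyadic k s t \<in> partitions s t \<and> mesh_less \<delta> (dyadic k s t)"
      unfolding eventually_sequentially by blast
    then show "\<exists>M. \<forall>m\<ge>M. \<forall>n\<ge>M. dist (partition_sum \<Xi> (dyadic m s t)) (partition_sum \<Xi> (dyadic n s t)) < \<epsilon>"
      using \<delta> \<open>0 < \<epsilon>\<close> unfolding dist_norm by (smt (verit) field_sum_of_halves)
  qed
  then obtain L where L: "(\<lambda>k. partition_sum \<Xi> (dyadic k s t)) \<longlonglongrightarrow> L"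
    using Cauchy_convergent convergent_def by blast
  have "(partition_sum \<Xi> \<longlongrightarrow> L) (mesh_filter s t)"
    unfolding tendsto_iff eventually_mesh_filter
  proof (intro allI impI)
    fix \<epsilon> :: real assume "0 < \<epsilon>"
    with cauchy[of "\<epsilon> / 2"] obtain \<delta> where "0 < \<delta>" and \<delta>: "\<And>p q. p \<in> partitions s t \<Longrightarrow>
      q \<in> partitions s t \<Longrightarrow> mesh_less \<delta> p \<Longrightarrow> mesh_less \<delta> q \<Longrightarrow>
      norm (partition_sum \<Xi> p - partition_sum \<Xi> q) \<le> \<epsilon> / 2" by auto
    have "dist (partition_sum \<Xi> p) L < \<epsilon>" if "p \<in> partitions s t" "mesh_less \<delta> p" for p
    proof -
      \<comment> \<open>The depth of the dyadic partition tends to infinity in the Cauchy estimate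
        while \<open>p\<close> is kept.\<close>
      have "norm (partition_sum \<Xi> p - L) \<le> \<epsilon> / 2"
        by (rule tendsto_upperbound[OF tendsto_norm[OF tendsto_diff[OF tendsto_const L]]])
          (use fine[OF \<open>0 < \<delta>\<close>] that \<delta> in \<open>auto elim: eventually_mono\<close>)
      then show ?thesis using \<open>0 < \<epsilon>\<close> by (simp add: dist_norm)
    qed
    then show "\<exists>\<delta>>0. \<forall>p\<in>partitions s t. mesh_less \<delta> p \<longrightarrow> dist (partition_sum \<Xi> p) L < \<epsilon>"
      using \<open>0 < \<delta>\<close> by blast
  qed
  then show ?thesis by (rule that)
qed

section \<open>Young integrals against a path of bounded variation\<close>

lemma norm_tensor: "norm (tensor a b) = norm a * norm b"
proof -
  have "(norm (tensor a b))\<^sup>2 = (norm a * norm b)\<^sup>2"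
    by (simp add: power_mult_distrib power2_norm_eq_inner inner_vec_def tensor_def sum_product
        algebra_simps) (rule sum.swap)
  then show ?thesis by simp
qed

lemma tensor_add_right: "tensor a (c + d) = tensor a c + tensor a d"
  and tensor_diff_left: "tensor (a - b) c = tensor a c - tensor b c"
  and tensor_zero_right: "tensor a 0 = 0"
  by (simp_all add: tensor_def vec_eq_iff algebra_simps)

text \<open>The defect of the germ is the tensor of \<Psi> v - \<Psi> u with X v z, a quantity small
  at small scales times \<open>w u v\<close>. Convergence has to be proved before any bound, since
  \<open>young_integral\<close> is a \<open>Lim\<close> and carries information only when the limit
  exists.\<close>

lemma young_integral_bound:
  fixes \<Psi> :: "real \<Rightarrow> real^'k" and X :: "real \<Rightarrow> real \<Rightarrow> real^'d"
  assumes "s < t" and w: "control s t w"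
    and \<Psi>: "\<And>u v. s \<le> u \<Longrightarrow> u \<le> v \<Longrightarrow> v \<le> t \<Longrightarrow> norm (\<Psi> v - \<Psi> u) \<le> w u v"
    and add: "\<And>u v z. s \<le> u \<Longrightarrow> u \<le> v \<Longrightarrow> v \<le> z \<Longrightarrow> z \<le> t \<Longrightarrow> X u z = X u v + X v z"
    and X: "\<And>u v. s \<le> u \<Longrightarrow> u < v \<Longrightarrow> v \<le> t \<Longrightarrow> norm (X u v) \<le> K * (v - u) powr \<beta>"
    and "0 < \<beta>" "0 \<le> K"
  shows "norm (young_integral \<Psi> X s t) \<le> K * (t - s) powr \<beta> * w s t"
proof -
  define \<Xi> where "\<Xi> u v = tensor (\<Psi> u - \<Psi> s) (X u v)" for u v
  have X0: "X u u = 0" if "s \<le> u" "u \<le> t" for u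
    using add[of u u u] that by simp
  then have zero: "\<Xi> u u = 0" if "s \<le> u" "u \<le> t" for u
    using that by (simp add: \<Xi>_def tensor_zero_right)
  have defect: "norm (\<Xi> u v + \<Xi> v z - \<Xi> u z) \<le> K * h powr \<beta> * w u v"
    if "s \<le> u" "u < v" "v \<le> z" "z \<le> t" "z - u \<le> h" for u v z h
  proof -
    have eq: "\<Xi> u v + \<Xi> v z - \<Xi> u z = tensor (\<Psi> v - \<Psi> u) (X v z)"
      using add[of u v z] that
      by (simp add: \<Xi>_def tensor_add_right tensor_diff_left)
    have "norm (X v z) \<le> K * h powr \<beta>"
    proof (cases "v = z")
      case False
      then have "norm (X v z) \<le> K * (z - v) powr \<beta>" using X that by auto
      also have "\<dots> \<le> K * h powr \<beta>" using that assms by (intro mult_left_mono powr_mono2) auto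
      finally show ?thesis .
    qed (use X0 that assms in auto)
    moreover have "norm (\<Psi> v - \<Psi> u) \<le> w u v" "0 \<le> w u v"
      using \<Psi>[of u v] w that by (auto simp: control_def)
    ultimately show ?thesis
      unfolding eq norm_tensor by (subst mult.commute) (intro mult_mono, use assms in auto)
  qed
  obtain L where L: "(partition_sum \<Xi> \<longlongrightarrow> L) (mesh_filter s t)"
  proof (rule partition_sum_convergent[OF \<open>s < t\<close> w zero])
    fix \<epsilon> :: real assume "0 < \<epsilon>"
    obtain h where h: "0 < h" "K * h powr \<beta> \<le> \<epsilon>"
      using ex_small_powr[OF \<open>0 < \<beta>\<close> \<open>0 \<le> K\<close> \<open>0 < \<epsilon>\<close>] by (metis less_imp_le order_refl)
    have "norm (\<Xi> u v + \<Xi> v z - \<Xi> u z) \<le> \<epsilon> * w u v"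
      if "s \<le> u" "u < v" "v \<le> z" "z \<le> t" "z - u < h" for u v z
    proof -
      have "norm (\<Xi> u v + \<Xi> v z - \<Xi> u z) \<le> K * h powr \<beta> * w u v"
        using that by (intro defect) auto
      also have "\<dots> \<le> \<epsilon> * w u v"
        using h w that by (intro mult_right_mono) (auto simp: control_def)
      finally show ?thesis .
    qed
    then show "\<exists>\<delta>>0. \<forall>u v z. s \<le> u \<and> u < v \<and> v \<le> z \<and> z \<le> t \<and> z - u < \<delta> \<longrightarrow>
           norm (\<Xi> u v + \<Xi> v z - \<Xi> u z) \<le> \<epsilon> * w u v"
      using h(1) by blast
  qed auto
  have "mesh_filter s t \<noteq> bot" using \<open>s < t\<close> by simp
  have "young_integral \<Psi> X s t = L"
    unfolding young_integral_def using tendsto_Lim[OF \<open>mesh_filter s t \<noteq> bot\<close> L]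
    by (simp add: \<Xi>_def[abs_def])
  moreover have "norm L \<le> K * (t - s) powr \<beta> * w s t"
  proof (rule tendsto_upperbound[OF tendsto_norm[OF L] _ \<open>mesh_filter s t \<noteq> bot\<close>])
    have "norm (partition_sum \<Xi> p) \<le> K * (t - s) powr \<beta> * w s t" if "p \<in> partitions s t" for p
    proof -
      have "norm (partition_sum \<Xi> p - \<Xi> s t) \<le> K * (t - s) powr \<beta> * w s t"
        by (rule partition_sum_germ_bound[OF that w zero]) (use assms defect in auto)
      \<comment> \<open>The germ over the whole interval vanishes, as its first factor is \<Psi> s -
        \<Psi> s. The sums consist of defects alone.\<close>
      then show ?thesis by (simp add: \<Xi>_def tensor_def vec_eq_iff zero_vec_def[symmetric])
    qed
    then show "\<forall>\<^sub>F p in mesh_filter s t. norm (partition_sum \<Xi> p) \<le> K * (t - s) powr \<beta> * w s t"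
      unfolding eventually_mesh_filter by (intro exI[of _ 1]) auto
  qed
  ultimately show ?thesis by simp
qed

subsection \<open>Vector fields\<close>

text \<open>Estimated entry by entry, hence the number of matrix entries as a factor.\<close>

lemma norm_tensor_apply_le:
  fixes B :: "real^'k \<Rightarrow> ((real^'d) \<Rightarrow>\<^sub>L (real^'n))" and Q :: "real^'d^'k"
  assumes "\<And>a. norm (B a) \<le> c * norm a" "0 \<le> c"
  shows "norm (tensor_apply B Q) \<le> real CARD('k) * real CARD('d) * c * norm Q"
proof -
  have entry: "norm ((Q $ i $ j) *\<^sub>R blinfun_apply (B (axis i 1)) (axis j 1)) \<le> c * norm Q" for i j
  proof -
    have "norm (blinfun_apply (B (axis i 1)) (axis j 1)) \<le> norm (B (axis i 1)) * norm (axis j 1 :: real^'d)"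
      by (rule norm_blinfun)
    also have "\<dots> \<le> c" using assms(1)[of "axis i 1"] by simp
    finally have "norm (blinfun_apply (B (axis i 1)) (axis j 1)) \<le> c" .
    moreover have "\<bar>Q $ i $ j\<bar> \<le> norm Q"
      using component_le_norm_cart[of "Q $ i" j] Finite_Cartesian_Product.norm_nth_le[of Q i]
      by linarith
    ultimately show ?thesis
      unfolding norm_scaleR by (subst mult.commute) (intro mult_mono, use assms in auto)
  qed
  have "norm (tensor_apply B Q) \<le> (\<Sum>i\<in>(UNIV::'k set). \<Sum>j\<in>(UNIV::'d set). c * norm Q)"
    unfolding tensor_apply_def by (intro sum_norm_le entry)
  then show ?thesis by (simp add: mult_ac)
qed

lemma tensor_apply_add: "tensor_apply B (P + Q) = tensor_apply B P + tensor_apply B Q"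
  by (simp add: tensor_apply_def scaleR_add_left sum.distrib)

lemma tensor_apply_diff_fun:
  "tensor_apply (\<lambda>a. B a - C a) Q = tensor_apply B Q - tensor_apply C Q"
  by (simp add: tensor_apply_def blinfun.diff_left scaleR_diff_right sum_subtractf)

text \<open>Turns the tensor produced by Chen's relation into the derivative applied to an
  increment, which is where the cancellation in the defect takes place.\<close>

lemma tensor_apply_tensor:
  assumes "linear B"
  shows "tensor_apply B (tensor a b) = blinfun_apply (B a) b"
proof -
  have "blinfun_apply (B a) b =
      blinfun_apply (B (\<Sum>i\<in>UNIV. a $ i *\<^sub>R axis i 1)) (\<Sum>j\<in>UNIV. b $ j *\<^sub>R axis j 1)"
    by (simp add: basis_expansion flip: scalar_mult_eq_scaleR)
  also have "\<dots> = tensor_apply B (tensor a b)"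
    by (simp add: tensor_apply_def tensor_def linear_sum[OF assms] linear_scale[OF assms]
        blinfun.sum_left blinfun.sum_right blinfun.scaleR_left blinfun.scaleR_right scaleR_sum_right)
      (subst sum.swap, simp add: mult.commute)
  finally show ?thesis by simp
qed

locale lip_field =
  fixes \<sigma> :: "'y::real_normed_vector \<Rightarrow> 'v::real_normed_vector"
    and D :: "'y \<Rightarrow> 'y \<Rightarrow> 'v" and M \<alpha> :: real
  assumes M_nonneg: "0 \<le> M" and alpha: "0 < \<alpha>" "\<alpha> \<le> 1"
    and bound: "norm (\<sigma> y) \<le> M"
    and deriv: "(\<sigma> has_derivative D y) (at y)"
    and deriv_bound: "norm (D y v) \<le> M * norm v"
    and deriv_holder: "norm (D y v - D x v) \<le> M * norm (y - x) powr \<alpha> * norm v"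
begin

lemma linear_D: "linear (D y)"
  using deriv has_derivative_linear by blast

lemma lipschitz: "norm (\<sigma> y - \<sigma> x) \<le> M * norm (y - x)"
proof (rule differentiable_bound[of UNIV \<sigma> D])
  show "onorm (D z) \<le> M" for z by (rule onorm_bound) (rule M_nonneg, rule deriv_bound)
qed (auto intro: deriv)

text \<open>Mean value estimate for \<sigma> minus its linearization at \<open>x\<close>, on the
  ball around \<open>x\<close> through \<open>y\<close>. There the derivative deviates from the one
  at \<open>x\<close> by at most M |y - x|^\<alpha>.\<close>

lemma taylor: "norm (\<sigma> y - \<sigma> x - D x (y - x)) \<le> M * norm (y - x) powr (1 + \<alpha>)"
proof (cases "y = x")
  case False
  have "norm (\<sigma> y - \<sigma> x - D x (y - x)) \<le> norm (y - x) * (M * norm (y - x) powr \<alpha>)"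
  proof (rule differentiable_bound_linearization[where S = "cball x (norm (y - x))"])
    fix z assume z: "z \<in> cball x (norm (y - x))"
    show "(\<sigma> has_derivative D z) (at z within cball x (norm (y - x)))"
      by (rule has_derivative_at_withinI[OF deriv])
    show "onorm (D z - D x) \<le> M * norm (y - x) powr \<alpha>"
    proof (rule onorm_bound)
      show "0 \<le> M * norm (y - x) powr \<alpha>" using M_nonneg by simp
    next
      fix v
      have "norm (D z v - D x v) \<le> M * norm (z - x) powr \<alpha> * norm v" by (rule deriv_holder)
      also have "\<dots> \<le> M * norm (y - x) powr \<alpha> * norm v"
        using z alpha M_nonneg
        by (intro mult_right_mono mult_left_mono powr_mono2) (auto simp: dist_norm norm_minus_commute)
      finally show "norm ((D z - D x) v) \<le> M * norm (y - x) powr \<alpha> * norm v" by simp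
    qed
  next
    fix t :: real assume "t \<in> {0..1}"
    then show "x + t *\<^sub>R (y - x) \<in> cball x (norm (y - x))"
      by (auto simp: dist_norm mult_left_le_one_le)
  qed auto
  also have "\<dots> = M * norm (y - x) powr (1 + \<alpha>)"
    using False by (simp add: powr_add)
  finally show ?thesis .
qed (use linear_0[OF linear_D] in auto)

end

text \<open>From \<gamma> > 1/\<beta> \<ge> 2 follows m \<ge> 1. If m = 1, then \<alpha> = \<theta>
  = \<gamma> - 2 and (2 + \<alpha>) \<beta> = \<gamma> \<beta> > 1. If m \<ge> 2, the bounded second
  derivative gives \<alpha> = 1, and 3 \<beta> > 1.\<close>

lemma lip_functions_lip_field:
  fixes \<sigma> :: "'y::euclidean_space \<Rightarrow> 'v::real_normed_vector"
  assumes "\<sigma> \<in> lip_functions (\<gamma> - 1)" and \<beta>: "1 / 3 < \<beta>" "\<beta> \<le> 1 / 2" "1 / \<beta> < \<gamma>"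
  obtains M \<alpha> where "lip_field \<sigma> (\<lambda>y. frechet_derivative \<sigma> (at y)) M \<alpha>" "1 < (2 + \<alpha>) * \<beta>"
proof -
  obtain m \<theta> where \<gamma>: "\<gamma> - 1 = real m + \<theta>" "0 < \<theta>" "\<theta> \<le> 1"
    and diff: "\<And>vs x. length vs < m \<Longrightarrow> iter_deriv \<sigma> vs differentiable (at x)"
    and bnd: "\<And>k. k \<le> m \<Longrightarrow> \<exists>C. \<forall>vs x. length vs = k \<longrightarrow>
        norm (iter_deriv \<sigma> vs x) \<le> C * prod_list (map norm vs)"
    and hol: "\<exists>C. \<forall>vs x y. length vs = m \<longrightarrow>
        norm (iter_deriv \<sigma> vs y - iter_deriv \<sigma> vs x)
          \<le> C * norm (y - x) powr \<theta> * prod_list (map norm vs)"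
    using assms(1) unfolding lip_functions_def by blast
  have "2 < \<gamma>" using \<beta> by (smt (verit) le_divide_eq_1_pos divide_le_eq field_simps)
  then have "1 \<le> m" using \<gamma> by (cases m) auto
  have nil: "iter_deriv \<sigma> [] = \<sigma>" by (rule ext) simp
  have single: "iter_deriv \<sigma> [v] x = frechet_derivative \<sigma> (at x) v" for v x
    by (simp add: nil)
  have deriv: "(\<sigma> has_derivative frechet_derivative \<sigma> (at y)) (at y)" for y
    using diff[of "[]" y] \<open>1 \<le> m\<close> nil frechet_derivative_works by auto
  obtain C0 where C0: "norm (\<sigma> x) \<le> C0" for x
    using bnd[of 0] by (metis le0 length_0_conv list.map(1) mult.right_neutral nil prod_list.Nil)
  obtain C1 where C1: "norm (frechet_derivative \<sigma> (at x) v) \<le> C1 * norm v" for x v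
  proof -
    obtain C where C: "\<And>vs x. length vs = 1 \<Longrightarrow> norm (iter_deriv \<sigma> vs x) \<le> C * prod_list (map norm vs)"
      using bnd[OF \<open>1 \<le> m\<close>] by blast
    show ?thesis using that[of C] C[of "[_]"] by (simp add: single nil)
  qed
  obtain \<alpha> C2 where \<alpha>: "0 < \<alpha>" "\<alpha> \<le> 1" "1 < (2 + \<alpha>) * \<beta>" and
    C2: "norm (frechet_derivative \<sigma> (at y) v - frechet_derivative \<sigma> (at x) v)
      \<le> C2 * norm (y - x) powr \<alpha> * norm v" for x y v
  proof (cases "m = 1")
    case True
    obtain C where C: "\<And>vs x y. length vs = 1 \<Longrightarrow> norm (iter_deriv \<sigma> vs y - iter_deriv \<sigma> vs x)
          \<le> C * norm (y - x) powr \<theta> * prod_list (map norm vs)"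
      using hol True by blast
    have "1 < (2 + \<theta>) * \<beta>"
      using \<gamma>(1) \<beta> True by (simp add: field_simps)
    then show ?thesis
      using that[of \<theta> C] C[of "[_]"] \<gamma> by (simp add: single nil)
  next
    case False
    then have "2 \<le> m" using \<open>1 \<le> m\<close> by auto
    then obtain C' where C': "\<And>vs x. length vs = 2 \<Longrightarrow> norm (iter_deriv \<sigma> vs x) \<le> C' * prod_list (map norm vs)"
      using bnd[of 2] by blast
    define C where "C = max C' 0"
    have pair: "norm (frechet_derivative (iter_deriv \<sigma> [v]) (at x) u) \<le> C * norm v * norm u" for u v x
    proof -
      have "norm (frechet_derivative (iter_deriv \<sigma> [v]) (at x) u) \<le> C' * (norm v * norm u)"
        using C'[of "[u, v]" x] by (simp add: mult_ac)
      also have "\<dots> \<le> C * (norm v * norm u)" by (intro mult_right_mono) (auto simp: C_def)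
      finally show ?thesis by (simp add: mult_ac)
    qed
    have nonneg: "0 \<le> C * norm v" for v by (simp add: C_def)
    have der: "(iter_deriv \<sigma> [v] has_derivative frechet_derivative (iter_deriv \<sigma> [v]) (at x)) (at x)" for v x
      using diff[of "[v]" x] \<open>2 \<le> m\<close> frechet_derivative_works by auto
    have "norm (iter_deriv \<sigma> [v] y - iter_deriv \<sigma> [v] x) \<le> C * norm v * norm (y - x)" for v x y
      by (rule differentiable_bound[of UNIV _ "\<lambda>x. frechet_derivative (iter_deriv \<sigma> [v]) (at x)"])
        (auto intro!: der onorm_bound pair nonneg simp del: iter_deriv.simps)
    then have "norm (frechet_derivative \<sigma> (at y) v - frechet_derivative \<sigma> (at x) v)
      \<le> C * norm (y - x) powr 1 * norm v" for x y v
      by (simp only: single) (simp add: mult_ac)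
    then show ?thesis
      using that[of 1 C] \<beta> by (simp add: field_simps)
  qed
  define M where "M = max 0 (max C0 (max C1 C2))"
  have "lip_field \<sigma> (\<lambda>y. frechet_derivative \<sigma> (at y)) M \<alpha>"
  proof
    fix x y v :: 'y
    show "norm (\<sigma> y) \<le> M" using C0[of y] by (auto simp: M_def)
    have "C1 * norm v \<le> M * norm v" by (intro mult_right_mono) (auto simp: M_def)
    then show "norm (frechet_derivative \<sigma> (at y) v) \<le> M * norm v"
      using C1 order_trans by blast
    have "C2 * norm (y - x) powr \<alpha> * norm v \<le> M * norm (y - x) powr \<alpha> * norm v"
      by (intro mult_right_mono) (auto simp: M_def)
    then show "norm (frechet_derivative \<sigma> (at y) v - frechet_derivative \<sigma> (at x) v)
        \<le> M * norm (y - x) powr \<alpha> * norm v"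
      using C2 order_trans by blast
  qed (use \<alpha> deriv in \<open>auto simp: M_def\<close>)
  then show ?thesis using that \<alpha> by blast
qed

text \<open>The germ of the rough integral without its Young term and with Z' replaced by
  \<sigma>(Z, \<Psi>). The partial derivative in the first variable is written as the total
  derivative in directions (a, 0).\<close>

definition reduced_germ ::
    "((real^'n) \<times> (real^'n) \<Rightarrow> (real^'d) \<Rightarrow>\<^sub>L (real^'n)) \<Rightarrow> ((real^'n) \<times> (real^'n) \<Rightarrow> (real^'n) \<times> (real^'n) \<Rightarrow> (real^'d) \<Rightarrow>\<^sub>L (real^'n)) \<Rightarrow>
     (real \<Rightarrow> (real^'n)) \<Rightarrow> (real \<Rightarrow> (real^'n)) \<Rightarrow> (real \<Rightarrow> real \<Rightarrow> real^'d) \<Rightarrow> (real \<Rightarrow> real \<Rightarrow> real^'d^'d) \<Rightarrow>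
     real \<Rightarrow> real \<Rightarrow> (real^'n)" where
  "reduced_germ \<sigma> D Z \<Psi> X XX s t = blinfun_apply (\<sigma> (Z s, \<Psi> s)) (X s t) +
     tensor_apply (\<lambda>a. D (Z s, \<Psi> s) (blinfun_apply (\<sigma> (Z s, \<Psi> s)) a, 0)) (XX s t)"

subsection \<open>A priori estimates\<close>

text \<open>Triangle inequality through the midpoint. The length of each half is estimated by that
  of the whole, which gives the plain factor 2.\<close>

lemma increments_doubling:
  fixes z :: "real \<Rightarrow> 'v::real_normed_vector"
  assumes z: "\<And>u v. 0 \<le> u \<Longrightarrow> u < v \<Longrightarrow> v \<le> T \<Longrightarrow> v - u \<le> h \<Longrightarrow> norm (z v - z u) \<le> N * (v - u) powr \<beta>"
    and "0 \<le> N" "0 < \<beta>" and st: "0 \<le> s" "s < t" "t \<le> T" "t - s \<le> 2 * h"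
  shows "norm (z t - z s) \<le> 2 * N * (t - s) powr \<beta>"
proof -
  define m where "m = (s + t) / 2"
  have m: "s < m" "m < t" "m - s \<le> h" "t - m \<le> h" using st by (simp_all add: m_def field_simps)
  have "norm (z t - z s) = norm ((z t - z m) + (z m - z s))" by simp
  also have "\<dots> \<le> N * (t - m) powr \<beta> + N * (m - s) powr \<beta>"
    using m st by (intro norm_triangle_le add_mono z) auto
  also have "\<dots> \<le> N * (t - s) powr \<beta> + N * (t - s) powr \<beta>"
    using m assms by (intro add_mono mult_left_mono powr_mono2) auto
  finally show ?thesis by simp
qed

text \<open>Gathers all data on which constants may depend, including a bound \<open>K\<close> for
  both levels of the drivers. Drivers and solutions enter only in a later locale, so any constant
  defined here is uniform over them.\<close>

locale rough_setting = lip_field \<sigma> D M \<alpha>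
  for \<sigma> :: "(real^'n) \<times> (real^'n) \<Rightarrow> (real^'d) \<Rightarrow>\<^sub>L (real^'n)" and D M \<alpha> +
  fixes T \<beta> K :: real and F :: "real \<Rightarrow> real"
  assumes T_pos: "0 < T" and beta: "0 < \<beta>" "1 < (2 + \<alpha>) * \<beta>" and K_nonneg: "0 \<le> K"
    and F_mono: "mono_on {0..} F" and F_nonneg: "\<And>r. 0 \<le> r \<Longrightarrow> 0 \<le> F r"
begin

text \<open>Order of the second level, 2\<beta>, plus the gain \<alpha>\<beta> from the Hoelder
  continuity of the derivative.\<close>

definition \<mu> :: real where "\<mu> = (2 + \<alpha>) * \<beta>"

text \<open>Halving shrinks w(s,t) |t - s|^\<beta>, summed over both halves, by 2^(-\<beta>), and |t
  - s|^\<mu> by 2 * 2^(-\<mu>). The worse of the two is the contraction factor of sewing.\<close>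

definition q :: real where "q = max (2 powr - \<beta>) (2 powr (1 - \<mu>))"

definition \<kappa> :: real where "\<kappa> = 1 / (1 - q)"

definition dd :: real where "dd = real CARD('d) * real CARD('d)"

text \<open>Coefficient of |t - s|^\<mu> in the defect. \<open>P\<close> is a Hoelder constant of
  (Z, \<Psi>) and \<open>R\<close> one of the remainder. The summands stem from the Taylor error,
  the remainder, and the variation of the second-order coefficient, in this order.\<close>

definition defect_const :: "real \<Rightarrow> real \<Rightarrow> real" where
  "defect_const P R = M * K * P\<^sup>2 + M * K * R + 2 * M\<^sup>2 * P * dd * K"

lemma q: "0 < q" "q < 1" and kappa_pos: "0 < \<kappa>"
proof -
  show "0 < q" by (simp add: q_def less_max_iff_disj)
  show "q < 1" using beta powr_less_mono[of "- \<beta>" 0 "2::real"] powr_less_mono[of "1 - \<mu>" 0 "2::real"]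
    by (simp add: q_def \<mu>_def)
  then show "0 < \<kappa>" by (simp add: \<kappa>_def)
qed

lemma dd_nonneg: "0 \<le> dd" by (simp add: dd_def)

lemma defect_const_nonneg: "0 \<le> P \<Longrightarrow> 0 \<le> R \<Longrightarrow> 0 \<le> defect_const P R"
  using M_nonneg K_nonneg dd_nonneg unfolding defect_const_def by (intro add_nonneg_nonneg mult_nonneg_nonneg) auto

lemma half_powr_beta: "0 \<le> x \<Longrightarrow> (x / 2) powr \<beta> \<le> q * x powr \<beta>"
  and half_powr_mu: "0 \<le> x \<Longrightarrow> 2 * (x / 2) powr \<mu> \<le> q * x powr \<mu>"
proof -
  assume x: "0 \<le> x"
  have "(x / 2) powr \<beta> = 2 powr - \<beta> * x powr \<beta>"
    using x by (simp add: powr_divide powr_minus field_simps)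
  also have "\<dots> \<le> q * x powr \<beta>" by (intro mult_right_mono) (auto simp: q_def)
  finally show "(x / 2) powr \<beta> \<le> q * x powr \<beta>" .
  have "2 * (x / 2) powr \<mu> = 2 powr (1 - \<mu>) * x powr \<mu>"
    using x by (simp add: powr_divide powr_diff field_simps)
  also have "\<dots> \<le> q * x powr \<mu>" by (intro mult_right_mono) (auto simp: q_def)
  finally show "2 * (x / 2) powr \<mu> \<le> q * x powr \<mu>" .
qed

end

text \<open>The hypothesis on \<open>w\<close> is an implication from any local Hoelder constant
  \<open>N\<close>, so it can be reused each time \<open>N\<close> has been improved. The remainder
  bound is purely qualitative: its constant may differ from solution to solution and must disappear
  from the final estimates.\<close>

locale reduced_solution = rough_setting \<sigma> D M \<alpha> T \<beta> K F
  for \<sigma> :: "(real^'n) \<times> (real^'n) \<Rightarrow> (real^'d) \<Rightarrow>\<^sub>L (real^'n)" and D M \<alpha> T \<beta> K F +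
  fixes Z \<Psi> :: "real \<Rightarrow> real^'n" and X :: "real \<Rightarrow> real \<Rightarrow> real^'d" and XX :: "real \<Rightarrow> real \<Rightarrow> real^'d^'d"
    and w :: "real \<Rightarrow> real \<Rightarrow> real"
  assumes X_add: "\<And>s u t. 0 \<le> s \<Longrightarrow> s \<le> u \<Longrightarrow> u \<le> t \<Longrightarrow> t \<le> T \<Longrightarrow> X s t = X s u + X u t"
    and chen: "\<And>s u t. 0 \<le> s \<Longrightarrow> s \<le> u \<Longrightarrow> u \<le> t \<Longrightarrow> t \<le> T \<Longrightarrow>
      XX s t = XX s u + XX u t + tensor (X s u) (X u t)"
    and X_bound: "\<And>s t. 0 \<le> s \<Longrightarrow> s < t \<Longrightarrow> t \<le> T \<Longrightarrow> norm (X s t) \<le> K * (t - s) powr \<beta>"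
    and XX_bound: "\<And>s t. 0 \<le> s \<Longrightarrow> s < t \<Longrightarrow> t \<le> T \<Longrightarrow> norm (XX s t) \<le> K * (t - s) powr (2 * \<beta>)"
    and w: "control 0 T w"
    and \<Psi>_w: "\<And>s t. 0 \<le> s \<Longrightarrow> s \<le> t \<Longrightarrow> t \<le> T \<Longrightarrow> norm (\<Psi> t - \<Psi> s) \<le> w s t"
    and w_bound: "\<And>N s t. 0 \<le> s \<Longrightarrow> s \<le> t \<Longrightarrow> t \<le> T \<Longrightarrow> 0 \<le> N \<Longrightarrow>
      (\<And>u v. s \<le> u \<Longrightarrow> u < v \<Longrightarrow> v \<le> t \<Longrightarrow> norm (Z v - Z u) \<le> N * (v - u) powr \<beta>) \<Longrightarrow>
      w s t \<le> F (N * (t - s) powr \<beta>) * (N * (t - s) powr \<beta>)"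
    and solves: "\<And>t. 0 \<le> t \<Longrightarrow> t \<le> T \<Longrightarrow>
      (partition_sum (reduced_germ \<sigma> D Z \<Psi> X XX) \<longlongrightarrow> Z t - Z 0) (mesh_filter 0 t)"
    and remainder_finite: "\<exists>R. \<forall>s t. 0 \<le> s \<and> s < t \<and> t \<le> T \<longrightarrow>
      norm (Z t - Z s - blinfun_apply (\<sigma> (Z s, \<Psi> s)) (X s t)) \<le> R * (t - s) powr (2 * \<beta>)"
begin

section \<open>The germ of a solution, its defect and its sewing\<close>

definition \<Xi> :: "real \<Rightarrow> real \<Rightarrow> real^'n" where "\<Xi> = reduced_germ \<sigma> D Z \<Psi> X XX"

definition Y :: "real \<Rightarrow> (real^'n) \<times> (real^'n)" where "Y s = (Z s, \<Psi> s)"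

text \<open>The coefficient of the second level: the derivative of \<sigma> in its first variable
  along \<sigma> itself.\<close>

definition G :: "real \<Rightarrow> real^'d \<Rightarrow> (real^'d) \<Rightarrow>\<^sub>L (real^'n)" where
  "G s a = D (Y s) (blinfun_apply (\<sigma> (Y s)) a, 0)"

definition R :: "real \<Rightarrow> real \<Rightarrow> real^'n" where
  "R s t = Z t - Z s - blinfun_apply (\<sigma> (Y s)) (X s t)"

lemma \<Xi>_eq: "\<Xi> s t = blinfun_apply (\<sigma> (Y s)) (X s t) + tensor_apply (G s) (XX s t)"
  by (simp add: \<Xi>_def Y_def G_def[abs_def] reduced_germ_def)

text \<open>The equation speaks of integrals starting at 0 only. Dyadic partitions of [0, s] and
  [s, t] are joined to fine partitions of [0, t], and the part over [0, s] is subtracted.\<close>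

lemma dyadic_sums_tendsto:
  assumes st: "0 \<le> s" "s < t" "t \<le> T"
  shows "(\<lambda>k. partition_sum \<Xi> (dyadic k s t)) \<longlonglongrightarrow> Z t - Z s"
proof (cases "s = 0")
  case True
  then show ?thesis
    using filterlim_compose[OF solves filterlim_dyadic, of t] st by (simp add: \<Xi>_def)
next
  case False
  then have "0 < s" using st by simp
  have "filterlim (\<lambda>k. dyadic k 0 s @ tl (dyadic k s t)) (mesh_filter 0 t) sequentially"
    unfolding filterlim_iff eventually_mesh_filter
  proof (intro allI impI, elim exE conjE)
    fix P and \<delta> :: real
    assume "0 < \<delta>" and P: "\<forall>p\<in>partitions 0 t. mesh_less \<delta> p \<longrightarrow> P p"
    have "(\<lambda>k. (s - 0) / 2 ^ k) \<longlonglongrightarrow> 0" "(\<lambda>k. (t - s) / 2 ^ k) \<longlonglongrightarrow> 0"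
      by real_asymp+
    from this[THEN order_tendstoD(2), OF \<open>0 < \<delta>\<close>]
    show "\<forall>\<^sub>F k in sequentially. P (dyadic k 0 s @ tl (dyadic k s t))"
    proof eventually_elim
      case (elim k)
      have p: "dyadic k 0 s \<in> partitions 0 s" "dyadic k s t \<in> partitions s t"
        using \<open>0 < s\<close> st by (auto intro: dyadic_in_partitions)
      have "mesh_less \<delta> (dyadic k 0 s)" "mesh_less \<delta> (dyadic k s t)"
        using \<open>0 < s\<close> st elim by (auto intro!: mesh_less_dyadic)
      then show ?case
        using P partitions_append[OF p] mesh_less_append[OF p] by blast
    qed
  qed
  then have "(\<lambda>k. partition_sum \<Xi> (dyadic k 0 s @ tl (dyadic k s t))) \<longlonglongrightarrow> Z t - Z 0"
    using filterlim_compose[OF solves[of t]] st by (simp add: \<Xi>_def)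
  moreover have "partition_sum \<Xi> (dyadic k 0 s @ tl (dyadic k s t)) =
      partition_sum \<Xi> (dyadic k 0 s) + partition_sum \<Xi> (dyadic k s t)" for k
    by (rule partition_sum_append) (use \<open>0 < s\<close> st in \<open>auto intro: dyadic_in_partitions\<close>)
  moreover have "(\<lambda>k. partition_sum \<Xi> (dyadic k 0 s)) \<longlonglongrightarrow> Z s - Z 0"
    using filterlim_compose[OF solves filterlim_dyadic, of s] \<open>0 < s\<close> st by (simp add: \<Xi>_def)
  ultimately have "(\<lambda>k. partition_sum \<Xi> (dyadic k 0 s) + partition_sum \<Xi> (dyadic k s t)
      - partition_sum \<Xi> (dyadic k 0 s)) \<longlonglongrightarrow> (Z t - Z 0) - (Z s - Z 0)"
    by (intro tendsto_diff) auto
  then show ?thesis by simp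
qed

lemma linear_G: "linear (G s)"
proof -
  have "linear (\<lambda>a. (blinfun_apply (\<sigma> (Y s)) a, 0 :: real^'n))"
    by (intro linearI) (auto simp: blinfun.add_right blinfun.scaleR_right)
  from linear_compose[OF this linear_D[of "Y s"]] show ?thesis
    by (simp add: G_def[abs_def] o_def)
qed

lemma sigma_apply_bound: "norm (blinfun_apply (\<sigma> y) a) \<le> M * norm a"
  by (rule order_trans[OF norm_blinfun]) (intro mult_right_mono bound norm_ge_zero)

lemma G_bound: "norm (G s a) \<le> M\<^sup>2 * norm a"
proof -
  have "norm (G s a) \<le> M * norm (blinfun_apply (\<sigma> (Y s)) a)"
    unfolding G_def using deriv_bound[of "Y s" "(blinfun_apply (\<sigma> (Y s)) a, 0)"] by (simp add: norm_Pair)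
  also have "\<dots> \<le> M * (M * norm a)" by (intro mult_left_mono sigma_apply_bound M_nonneg)
  finally show ?thesis by (simp add: power2_eq_square)
qed

text \<open>Two contributions: the derivative changes at a fixed direction, which gives
  h^(\<alpha>\<beta>), and the direction changes, which gives h^\<beta> \<le> h^(\<alpha>\<beta>)
  because h \<le> 1. The condition P \<ge> 1 allows P^\<alpha> to be replaced by P.\<close>

lemma G_increment:
  assumes "norm (Y u - Y s) \<le> P * h powr \<beta>" "1 \<le> P" "0 \<le> h" "h \<le> 1"
  shows "norm (G u a - G s a) \<le> 2 * M\<^sup>2 * P * h powr (\<alpha> * \<beta>) * norm a"
proof -
  define b where "b = blinfun_apply (\<sigma> (Y u)) a"
  define c where "c = blinfun_apply (\<sigma> (Y s)) a"
  have b: "norm b \<le> M * norm a" unfolding b_def by (rule sigma_apply_bound)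
  have "norm (b - c) \<le> norm (\<sigma> (Y u) - \<sigma> (Y s)) * norm a"
    unfolding b_def c_def by (metis blinfun.diff_left norm_blinfun)
  also have "\<dots> \<le> M * norm (Y u - Y s) * norm a"
    by (intro mult_right_mono lipschitz) auto
  also have "\<dots> \<le> M * (P * h powr (\<alpha> * \<beta>)) * norm a"
  proof (intro mult_right_mono mult_left_mono order_trans[OF assms(1)])
    show "h powr \<beta> \<le> h powr (\<alpha> * \<beta>)"
      using assms alpha beta by (intro powr_mono') auto
  qed (use assms M_nonneg in auto)
  finally have bc: "norm (b - c) \<le> M * (P * h powr (\<alpha> * \<beta>)) * norm a" .
  have "norm (Y u - Y s) powr \<alpha> \<le> (P * h powr \<beta>) powr \<alpha>"
    using assms alpha by (intro powr_mono2) auto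
  also have "\<dots> = P powr \<alpha> * h powr (\<alpha> * \<beta>)"
    using assms by (simp add: powr_mult powr_powr mult.commute)
  also have "\<dots> \<le> P * h powr (\<alpha> * \<beta>)"
    using assms alpha powr_mono[of \<alpha> 1 P] by (intro mult_right_mono) auto
  finally have y: "norm (Y u - Y s) powr \<alpha> \<le> P * h powr (\<alpha> * \<beta>)" .
  have "D (Y s) ((b, 0) - (b - c, 0)) = D (Y s) (b, 0) - D (Y s) (b - c, 0)"
    by (rule linear_diff[OF linear_D])
  then have "G u a - G s a = (D (Y u) (b, 0) - D (Y s) (b, 0)) + D (Y s) (b - c, 0)"
    unfolding G_def b_def[symmetric] c_def[symmetric] by simp
  also have "norm \<dots> \<le> M * norm (Y u - Y s) powr \<alpha> * norm b + M * norm (b - c)"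
    using deriv_holder[of "Y u" "(b, 0)" "Y s"] deriv_bound[of "Y s" "(b - c, 0)"]
    by (intro norm_triangle_le add_mono) (auto simp: norm_Pair)
  also have "\<dots> \<le> M * (P * h powr (\<alpha> * \<beta>)) * (M * norm a) + M * (M * (P * h powr (\<alpha> * \<beta>)) * norm a)"
    using assms M_nonneg y b bc by (intro add_mono mult_mono mult_left_mono) auto
  also have "\<dots> = 2 * M\<^sup>2 * P * h powr (\<alpha> * \<beta>) * norm a"
    by (simp add: power2_eq_square algebra_simps)
  finally show ?thesis .
qed

text \<open>Chen's relation contributes the term with \<sigma>(Z s, \<Psi> s) (X s u) as direction
  of the derivative. Writing (\<sigma> X s u, 0) as the increment of Y minus the increment of \<Psi>
  minus the remainder completes the Taylor expansion of \<sigma>. What stays is a Taylor error, a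
  term in \<Psi>, a term in the remainder, and the change of \<open>G\<close>.\<close>

lemma defect_identity:
  assumes "0 \<le> s" "s < u" "u < t" "t \<le> T"
  shows "\<Xi> s t - \<Xi> s u - \<Xi> u t =
    - blinfun_apply (\<sigma> (Y u) - \<sigma> (Y s) - D (Y s) (Y u - Y s)) (X u t)
    - blinfun_apply (D (Y s) (0, \<Psi> u - \<Psi> s)) (X u t)
    - blinfun_apply (D (Y s) (R s u, 0)) (X u t)
    - tensor_apply (\<lambda>a. G u a - G s a) (XX u t)"
proof -
  have "(blinfun_apply (\<sigma> (Y s)) (X s u), 0) = (Y u - Y s) - (0, \<Psi> u - \<Psi> s) - (R s u, 0)"
    by (simp add: Y_def R_def)
  then have "G s (X s u) = D (Y s) (Y u - Y s) - D (Y s) (0, \<Psi> u - \<Psi> s) - D (Y s) (R s u, 0)"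
    unfolding G_def by (simp add: linear_diff[OF linear_D])
  then have "tensor_apply (G s) (tensor (X s u) (X u t)) =
      blinfun_apply (D (Y s) (Y u - Y s)) (X u t) - blinfun_apply (D (Y s) (0, \<Psi> u - \<Psi> s)) (X u t)
      - blinfun_apply (D (Y s) (R s u, 0)) (X u t)"
    by (simp add: tensor_apply_tensor[OF linear_G] blinfun.diff_left)
  then show ?thesis
    using X_add[of s u t] chen[of s u t] assms
    by (simp add: \<Xi>_eq tensor_apply_add tensor_apply_diff_fun blinfun.diff_left blinfun.add_right)
qed

text \<open>Orders of the four terms: (1 + \<alpha>)\<beta> + \<beta> = \<mu> for the Taylor error,
  w(s,t) times order \<beta> for \<Psi>, 2\<beta> + \<beta> \<ge> \<mu> for the remainder as
  \<alpha> \<le> 1, and \<alpha>\<beta> + 2\<beta> = \<mu> for the change of \<open>G\<close>.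
  Lengths at most 1 allow exponents to be lowered.\<close>

lemma defect_bound:
  assumes st: "0 \<le> s" "s < u" "u < t" "t \<le> T" "t - s \<le> 1"
    and Y: "norm (Y u - Y s) \<le> P * (t - s) powr \<beta>" and "1 \<le> P"
    and R: "norm (R s u) \<le> r * (t - s) powr (2 * \<beta>)" and "0 \<le> r"
  shows "norm (\<Xi> s t - \<Xi> s u - \<Xi> u t) \<le>
    M * K * w s t * (t - s) powr \<beta> + defect_const P r * (t - s) powr \<mu>"
proof -
  define h where "h = t - s"
  have h: "0 < h" "h \<le> 1" using st by (auto simp: h_def)
  have X: "norm (X u t) \<le> K * h powr \<beta>"
    using st K_nonneg beta unfolding h_def
    by (intro order_trans[OF X_bound] mult_left_mono powr_mono2) auto
  have XX: "norm (XX u t) \<le> K * h powr (2 * \<beta>)"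
    using st K_nonneg beta unfolding h_def
    by (intro order_trans[OF XX_bound] mult_left_mono powr_mono2) auto
  have app: "norm (blinfun_apply B (X u t)) \<le> b * (K * h powr \<beta>)" if "norm B \<le> b" for b and B :: "(real^'d) \<Rightarrow>\<^sub>L (real^'n)"
    using that order_trans[OF norm_ge_zero that] by (intro order_trans[OF norm_blinfun] mult_mono X) auto
  have "norm (Y u - Y s) powr (1 + \<alpha>) \<le> (P * h powr \<beta>) powr (1 + \<alpha>)"
    using Y alpha by (intro powr_mono2) (auto simp: h_def)
  also have "\<dots> = P powr (1 + \<alpha>) * h powr ((1 + \<alpha>) * \<beta>)"
    using h \<open>1 \<le> P\<close> by (simp add: powr_mult powr_powr mult.commute)
  also have "\<dots> \<le> P\<^sup>2 * h powr ((1 + \<alpha>) * \<beta>)"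
    using alpha \<open>1 \<le> P\<close> powr_mono[of "1 + \<alpha>" 2 P] by (intro mult_right_mono) auto
  finally have "norm (\<sigma> (Y u) - \<sigma> (Y s) - D (Y s) (Y u - Y s)) \<le> M * (P\<^sup>2 * h powr ((1 + \<alpha>) * \<beta>))"
    using M_nonneg by (intro order_trans[OF taylor] mult_left_mono) auto
  note app[OF this]
  moreover have mu: "h powr \<mu> = h powr ((1 + \<alpha>) * \<beta>) * h powr \<beta>"
    by (simp add: \<mu>_def algebra_simps flip: powr_add)
  ultimately
  have 1: "norm (blinfun_apply (\<sigma> (Y u) - \<sigma> (Y s) - D (Y s) (Y u - Y s)) (X u t)) \<le> M * K * P\<^sup>2 * h powr \<mu>"
    by (simp add: mu mult_ac)
  have "w s u \<le> w s t" using st control_mono[OF w, of s s u t] by auto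
  then have "norm (\<Psi> u - \<Psi> s) \<le> w s t" using \<Psi>_w[of s u] st by auto
  then have "norm (D (Y s) (0, \<Psi> u - \<Psi> s)) \<le> M * w s t"
    using M_nonneg by (intro order_trans[OF deriv_bound] mult_left_mono) (auto simp: norm_Pair)
  from app[OF this]
  have 2: "norm (blinfun_apply (D (Y s) (0, \<Psi> u - \<Psi> s)) (X u t)) \<le> M * K * w s t * h powr \<beta>"
    by (simp add: mult_ac)
  have "norm (D (Y s) (R s u, 0)) \<le> M * (r * h powr (2 * \<beta>))"
    using M_nonneg R unfolding h_def
    by (intro order_trans[OF deriv_bound] mult_left_mono) (auto simp: norm_Pair)
  from app[OF this]
  have "norm (blinfun_apply (D (Y s) (R s u, 0)) (X u t)) \<le> M * K * r * h powr (3 * \<beta>)"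
    using powr_add[of h "2 * \<beta>" \<beta>] by (simp add: mult_ac)
  also have "\<dots> \<le> M * K * r * h powr \<mu>"
  proof (intro mult_left_mono powr_mono')
    show "\<mu> \<le> 3 * \<beta>" unfolding \<mu>_def using alpha beta by (intro mult_right_mono) auto
  qed (use h M_nonneg K_nonneg \<open>0 \<le> r\<close> in auto)
  finally have 3: "norm (blinfun_apply (D (Y s) (R s u, 0)) (X u t)) \<le> M * K * r * h powr \<mu>" .
  have "norm (tensor_apply (\<lambda>a. G u a - G s a) (XX u t)) \<le>
      real CARD('d) * real CARD('d) * (2 * M\<^sup>2 * P * h powr (\<alpha> * \<beta>)) * norm (XX u t)"
    using Y \<open>1 \<le> P\<close> h by (intro norm_tensor_apply_le G_increment) (auto simp: h_def)
  also have "\<dots> \<le> real CARD('d) * real CARD('d) * (2 * M\<^sup>2 * P * h powr (\<alpha> * \<beta>)) * (K * h powr (2 * \<beta>))"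
    using \<open>1 \<le> P\<close> by (intro mult_left_mono XX) auto
  also have "\<dots> = 2 * M\<^sup>2 * P * dd * K * h powr \<mu>"
    using powr_add[of h "\<alpha> * \<beta>" "2 * \<beta>"] by (simp add: dd_def \<mu>_def algebra_simps)
  finally have 4: "norm (tensor_apply (\<lambda>a. G u a - G s a) (XX u t)) \<le> 2 * M\<^sup>2 * P * dd * K * h powr \<mu>" .
  have "norm (\<Xi> s t - \<Xi> s u - \<Xi> u t) \<le> M * K * P\<^sup>2 * h powr \<mu> + M * K * w s t * h powr \<beta>
      + M * K * r * h powr \<mu> + 2 * M\<^sup>2 * P * dd * K * h powr \<mu>"
    unfolding defect_identity[OF st(1-4)]
    by (intro order_trans[OF norm_triangle_ineq4] add_mono 2 3 4) (use 1 in simp)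
  also have "\<dots> = M * K * w s t * h powr \<beta> + defect_const P r * h powr \<mu>"
    by (simp add: defect_const_def algebra_simps)
  finally show ?thesis unfolding h_def .
qed

lemma increment_estimate:
  assumes st: "0 \<le> s" "s < t" "t \<le> T" "t - s \<le> 1" and "1 \<le> P" "0 \<le> r"
    and Y: "\<And>u v. s \<le> u \<Longrightarrow> u < v \<Longrightarrow> v \<le> t \<Longrightarrow> norm (Y v - Y u) \<le> P * (v - u) powr \<beta>"
    and R: "\<And>u v. s \<le> u \<Longrightarrow> u < v \<Longrightarrow> v \<le> t \<Longrightarrow> norm (R u v) \<le> r * (v - u) powr (2 * \<beta>)"
  shows "norm (Z t - Z s - \<Xi> s t) \<le>
    \<kappa> * (M * K * w s t * (t - s) powr \<beta> + defect_const P r * (t - s) powr \<mu>)"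
proof -
  define e where "e u v = M * K * w u v * (v - u) powr \<beta> + defect_const P r * (v - u) powr \<mu>" for u v
  have const: "0 \<le> defect_const P r" using assms defect_const_nonneg by simp
  have MK: "0 \<le> M * K" using M_nonneg K_nonneg by simp
  have "norm (partition_sum \<Xi> (dyadic k s t) - \<Xi> s t) \<le> e s t / (1 - q)" for k
  proof (rule dyadic_sewing[of s t s t])
    fix a u b assume ab: "s \<le> a" "a < u" "u < b" "b \<le> t"
    have "norm (Y u - Y a) \<le> P * (u - a) powr \<beta>" using Y ab by auto
    also have "\<dots> \<le> P * (b - a) powr \<beta>"
      using ab \<open>1 \<le> P\<close> beta by (intro mult_left_mono powr_mono2) auto
    finally have Yua: "norm (Y u - Y a) \<le> P * (b - a) powr \<beta>" .
    have "norm (R a u) \<le> r * (u - a) powr (2 * \<beta>)" using R ab by auto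
    also have "\<dots> \<le> r * (b - a) powr (2 * \<beta>)"
      using ab \<open>0 \<le> r\<close> beta by (intro mult_left_mono powr_mono2) auto
    finally show "norm (\<Xi> a b - \<Xi> a u - \<Xi> u b) \<le> e a b"
      unfolding e_def using ab st assms Yua by (intro defect_bound) auto
  next
    fix a b assume ab: "s \<le> a" "a < b" "b \<le> t"
    define m where "m = (a + b) / 2"
    have m: "m - a = (b - a) / 2" "b - m = (b - a) / 2" "a < m" "m < b"
      using ab by (auto simp: m_def field_simps)
    have w': "w a m + w m b \<le> w a b" "0 \<le> w a m" "0 \<le> w m b" "0 \<le> w a b"
      using control_superadd[OF w, of a b m] control_nonneg[OF w] ab m st by auto
    \<comment> \<open>Both halves have equal length, so the powers factor out. The two values of
      \<open>w\<close> combine by superadditivity, and the contraction comes from the powers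
      alone.\<close>
    have "e a m + e m b = M * K * (w a m + w m b) * ((b - a) / 2) powr \<beta>
        + defect_const P r * (2 * ((b - a) / 2) powr \<mu>)"
      unfolding e_def m by (simp add: algebra_simps)
    also have "\<dots> \<le> M * K * w a b * (q * (b - a) powr \<beta>) + defect_const P r * (q * (b - a) powr \<mu>)"
    proof (rule add_mono)
      show "M * K * (w a m + w m b) * ((b - a) / 2) powr \<beta> \<le> M * K * w a b * (q * (b - a) powr \<beta>)"
        using ab w' M_nonneg K_nonneg by (intro mult_mono mult_left_mono half_powr_beta mult_nonneg_nonneg[OF MK]) auto
      show "defect_const P r * (2 * ((b - a) / 2) powr \<mu>) \<le> defect_const P r * (q * (b - a) powr \<mu>)"
        using ab const by (intro mult_left_mono half_powr_mu) auto
    qed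
    also have "\<dots> = q * e a b" by (simp add: e_def algebra_simps)
    finally show "e a ((a + b) / 2) + e ((a + b) / 2) b \<le> q * e a b" by (simp add: m_def)
    show "0 \<le> e a b" unfolding e_def using w' const M_nonneg K_nonneg by (intro add_nonneg_nonneg mult_nonneg_nonneg) auto
  qed (use st q in auto)
  then have "norm (Z t - Z s - \<Xi> s t) \<le> e s t / (1 - q)"
    using dyadic_sums_tendsto[of s t] st
    by (intro tendsto_upperbound[OF tendsto_norm[OF tendsto_diff[OF dyadic_sums_tendsto tendsto_const]]]) auto
  then show ?thesis by (simp add: \<kappa>_def e_def)
qed

end

section \<open>Constants and the length scale common to all solutions\<close>

context rough_setting
begin

text \<open>If Z has Hoelder constant \<open>N\<close> at scales up to 1, then w(s,t) \<le> W N |t -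
  s|^\<beta>, since \<open>F\<close> is monotone.\<close>

definition W :: "real \<Rightarrow> real" where "W N = F N * N"

text \<open>The constant part of the improvement r \<mapsto> b N + r/2 of a remainder constant. The
  last summand bounds the second-level term of the germ.\<close>

definition b :: "real \<Rightarrow> real" where
  "b N = \<kappa> * (M * K * W N + defect_const (N + W N + 1) 0) + dd * M\<^sup>2 * K"

text \<open>M K bounds the leading term \<sigma> X, and 1 leaves room for the remainder on short
  intervals.\<close>

definition B :: real where "B = M * K + 1"

text \<open>The third condition makes the old remainder constant reappear with factor at most 1/2.
  The last makes the resulting remainder small enough for the constant \<open>B\<close>; it uses
  \<open>b (2 * B)\<close> because the path bound available after a doubling is
  \<open>2 * B\<close>.\<close>

definition admissible :: "real \<Rightarrow> bool" where
  "admissible h \<longleftrightarrow> 0 < h \<and> h \<le> 1 \<and> \<kappa> * (M * K) * h powr (\<alpha> * \<beta>) \<le> 1 / 2 \<and> 2 * b (2 * B) * h powr \<beta> \<le> 1"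

lemma MK_nonneg: "0 \<le> M * K"
  using M_nonneg K_nonneg by simp

lemma W_nonneg: "0 \<le> N \<Longrightarrow> 0 \<le> W N"
  using F_nonneg by (simp add: W_def)

lemma b_nonneg: "0 \<le> N \<Longrightarrow> 0 \<le> b N"
  unfolding b_def using M_nonneg W_nonneg[of N] kappa_pos dd_nonneg K_nonneg defect_const_nonneg[of "N + W N + 1" 0]
  by (intro add_nonneg_nonneg mult_nonneg_nonneg) auto

lemma B_ge_1: "1 \<le> B"
  using MK_nonneg by (simp add: B_def)

lemma defect_const_eq: "defect_const P r = defect_const P 0 + M * K * r"
  by (simp add: defect_const_def)

lemma ex_admissible: "\<exists>h. admissible h"
proof -
  have "0 < \<alpha> * \<beta>" using alpha beta by simp
  from ex_small_powr[OF this, of "\<kappa> * (M * K)" "1 / 2"] obtain h1 where h1: "0 < h1"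
    "\<forall>x. 0 \<le> x \<and> x \<le> h1 \<longrightarrow> \<kappa> * (M * K) * x powr (\<alpha> * \<beta>) \<le> 1 / 2"
    using MK_nonneg kappa_pos by auto
  from ex_small_powr[OF beta(1), of "2 * b (2 * B)" 1] obtain h2 where h2: "0 < h2"
    "\<forall>x. 0 \<le> x \<and> x \<le> h2 \<longrightarrow> 2 * b (2 * B) * x powr \<beta> \<le> 1"
    using b_nonneg[of "2 * B"] B_ge_1 by auto
  have "admissible (min 1 (min h1 h2))"
    using h1 h2 by (auto simp: admissible_def)
  then show ?thesis by blast
qed

text \<open>Doubling passes through the scales h / 2^n, all of which must be admissible.\<close>

lemma admissible_antimono:
  assumes "admissible h" "0 < h'" "h' \<le> h"
  shows "admissible h'"
proof -
  have "\<kappa> * (M * K) * h' powr (\<alpha> * \<beta>) \<le> \<kappa> * (M * K) * h powr (\<alpha> * \<beta>)"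
    "2 * b (2 * B) * h' powr \<beta> \<le> 2 * b (2 * B) * h powr \<beta>"
    using assms M_nonneg K_nonneg kappa_pos alpha beta b_nonneg[of "2 * B"] B_ge_1
    by (auto intro!: mult_left_mono powr_mono2)
  then show ?thesis using assms by (auto simp: admissible_def)
qed

end

section \<open>Bounds on short intervals, uniform over solutions\<close>

context reduced_solution
begin

definition path_bound :: "real \<Rightarrow> real \<Rightarrow> bool" where
  "path_bound h N \<longleftrightarrow> (\<forall>u v. 0 \<le> u \<and> u < v \<and> v \<le> T \<and> v - u \<le> h \<longrightarrow>
     norm (Z v - Z u) \<le> N * (v - u) powr \<beta>)"

definition remainder_bound :: "real \<Rightarrow> real \<Rightarrow> bool" where
  "remainder_bound h r \<longleftrightarrow> (\<forall>u v. 0 \<le> u \<and> u < v \<and> v \<le> T \<and> v - u \<le> h \<longrightarrow>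
     norm (R u v) \<le> r * (v - u) powr (2 * \<beta>))"

lemma path_bound_mono: "path_bound h N \<Longrightarrow> N \<le> N' \<Longrightarrow> path_bound h N'"
  unfolding path_bound_def by (meson mult_right_mono order_trans powr_ge_zero)

lemma remainder_bound_mono: "remainder_bound h r \<Longrightarrow> r \<le> r' \<Longrightarrow> remainder_bound h r'"
  unfolding remainder_bound_def by (meson mult_right_mono order_trans powr_ge_zero)

lemma w_local:
  assumes "path_bound h N" "0 \<le> N" "h \<le> 1" and st: "0 \<le> s" "s \<le> t" "t \<le> T" "t - s \<le> h"
  shows "w s t \<le> W N * (t - s) powr \<beta>"
proof -
  have le: "(t - s) powr \<beta> \<le> 1" using assms beta by (intro powr_le1) auto
  have "w s t \<le> F (N * (t - s) powr \<beta>) * (N * (t - s) powr \<beta>)"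
    using assms by (intro w_bound) (auto simp: path_bound_def)
  also have "\<dots> \<le> F N * (N * (t - s) powr \<beta>)"
    using assms le by (intro mult_right_mono mono_onD[OF F_mono]) (auto intro: mult_left_le)
  finally show ?thesis by (simp add: W_def)
qed

text \<open>The summand 1 puts the constant above 1, as the defect bound demands.\<close>

lemma Y_local:
  assumes "path_bound h N" "0 \<le> N" "h \<le> 1" and st: "0 \<le> s" "s < t" "t \<le> T" "t - s \<le> h"
  shows "norm (Y t - Y s) \<le> (N + W N + 1) * (t - s) powr \<beta>"
proof -
  have "norm (Y t - Y s) \<le> norm (Z t - Z s) + norm (\<Psi> t - \<Psi> s)"
    unfolding Y_def by (simp add: norm_Pair sqrt_sum_squares_le_sum)
  also have "\<dots> \<le> N * (t - s) powr \<beta> + W N * (t - s) powr \<beta>"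
  proof (rule add_mono)
    show "norm (\<Psi> t - \<Psi> s) \<le> W N * (t - s) powr \<beta>"
      using \<Psi>_w[of s t] w_local[OF assms(1-3), of s t] st by simp
  qed (use assms in \<open>auto simp: path_bound_def\<close>)
  also have "\<dots> \<le> (N + W N + 1) * (t - s) powr \<beta>" by (simp add: algebra_simps)
  finally show ?thesis .
qed

lemma increment_local:
  assumes "path_bound h N" "remainder_bound h r" "0 \<le> N" "0 \<le> r" "h \<le> 1"
    and st: "0 \<le> s" "s < t" "t \<le> T" "t - s \<le> h"
  shows "norm (Z t - Z s - \<Xi> s t) \<le>
    \<kappa> * (M * K * w s t * (t - s) powr \<beta> + defect_const (N + W N + 1) r * (t - s) powr \<mu>)"
proof (rule increment_estimate)
  show "norm (Y v - Y u) \<le> (N + W N + 1) * (v - u) powr \<beta>" if "s \<le> u" "u < v" "v \<le> t" for u v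
    using that st assms by (intro Y_local[OF assms(1)]) auto
qed (use assms W_nonneg in \<open>auto simp: remainder_bound_def\<close>)

text \<open>The remainder is the sewing error plus the second-level term. In it \<open>r\<close>
  occurs only as a multiple of |t - s|^\<mu> = |t - s|^(\<alpha>\<beta>) |t - s|^(2\<beta>), and the
  first factor is made small by the choice of \<open>h\<close>.\<close>

lemma remainder_bound_improve:
  assumes path: "path_bound h N" and rem: "remainder_bound h r" and "0 \<le> N" "0 \<le> r" "h \<le> 1"
    and small: "\<kappa> * (M * K) * h powr (\<alpha> * \<beta>) \<le> 1 / 2"
  shows "remainder_bound h (b N + r / 2)"
  unfolding remainder_bound_def
proof (intro allI impI, elim conjE)
  fix s t assume st: "0 \<le> s" "s < t" "t \<le> T" "t - s \<le> h"
  define x where "x = t - s"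
  define c where "c = defect_const (N + W N + 1) 0"
  have x: "0 < x" "x \<le> h" "x \<le> 1" using st assms by (auto simp: x_def)
  have c: "0 \<le> c" unfolding c_def using assms W_nonneg by (intro defect_const_nonneg) auto
  have "x powr (\<alpha> * \<beta>) \<le> h powr (\<alpha> * \<beta>)" "x powr (\<alpha> * \<beta>) \<le> 1"
    using x alpha beta by (auto intro: powr_mono2 powr_le1)
  then have "\<kappa> * (M * K) * x powr (\<alpha> * \<beta>) \<le> \<kappa> * (M * K) * h powr (\<alpha> * \<beta>)"
    using MK_nonneg kappa_pos by (intro mult_left_mono) auto
  then have small_x: "\<kappa> * (M * K) * x powr (\<alpha> * \<beta>) * r \<le> 1 / 2 * r"
    using small \<open>0 \<le> r\<close> by (intro mult_right_mono) auto
  have "norm (tensor_apply (G s) (XX s t)) \<le> dd * M\<^sup>2 * norm (XX s t)"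
    unfolding dd_def by (rule norm_tensor_apply_le[OF G_bound]) simp
  also have "\<dots> \<le> dd * M\<^sup>2 * (K * x powr (2 * \<beta>))"
    unfolding x_def using st dd_nonneg by (intro mult_left_mono XX_bound) auto
  finally have tensor: "norm (tensor_apply (G s) (XX s t)) \<le> dd * M\<^sup>2 * K * x powr (2 * \<beta>)"
    by (simp add: mult_ac)
  have "w s t * x powr \<beta> \<le> W N * x powr \<beta> * x powr \<beta>"
    unfolding x_def using st assms by (intro mult_right_mono w_local[OF path]) auto
  also have "\<dots> = W N * x powr (2 * \<beta>)" using powr_add[of x \<beta> \<beta>] by (simp add: mult_ac)
  finally have "M * K * (w s t * x powr \<beta>) \<le> M * K * (W N * x powr (2 * \<beta>))"
    using MK_nonneg by (rule mult_left_mono)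
  then have w': "M * K * w s t * x powr \<beta> \<le> M * K * W N * x powr (2 * \<beta>)" by (simp add: mult_ac)
  have mu: "x powr \<mu> = x powr (\<alpha> * \<beta>) * x powr (2 * \<beta>)"
    by (simp add: \<mu>_def distrib_right add.commute flip: powr_add)
  have "R s t = (Z t - Z s - \<Xi> s t) + tensor_apply (G s) (XX s t)"
    by (simp add: R_def \<Xi>_eq)
  also have "norm \<dots> \<le> \<kappa> * (M * K * w s t * x powr \<beta> + defect_const (N + W N + 1) r * x powr \<mu>)
      + dd * M\<^sup>2 * K * x powr (2 * \<beta>)"
    unfolding x_def
    using increment_local[OF path rem, of s t] tensor st assms
    by (intro norm_triangle_le add_mono) (auto simp: x_def)
  also have "\<dots> \<le> \<kappa> * (M * K * W N * x powr (2 * \<beta>) + (c + M * K * r) * (x powr (\<alpha> * \<beta>) * x powr (2 * \<beta>)))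
      + dd * M\<^sup>2 * K * x powr (2 * \<beta>)"
    using kappa_pos w' by (intro add_mono mult_left_mono order_refl) (auto simp: c_def defect_const_eq[of _ r] mu)
  also have "\<dots> = (\<kappa> * (M * K * W N) + \<kappa> * (c * x powr (\<alpha> * \<beta>)) + \<kappa> * (M * K) * x powr (\<alpha> * \<beta>) * r + dd * M\<^sup>2 * K) * x powr (2 * \<beta>)"
    by (simp add: algebra_simps)
  also have "\<dots> \<le> (\<kappa> * (M * K * W N) + \<kappa> * (c * 1) + 1 / 2 * r + dd * M\<^sup>2 * K) * x powr (2 * \<beta>)"
  proof -
    have "\<kappa> * (c * x powr (\<alpha> * \<beta>)) \<le> \<kappa> * (c * 1)"
      using kappa_pos c \<open>x powr (\<alpha> * \<beta>) \<le> 1\<close> by (intro mult_left_mono) auto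
    then show ?thesis using small_x by (intro mult_right_mono) (linarith, simp)
  qed
  also have "\<dots> = (b N + r / 2) * x powr (2 * \<beta>)"
    by (simp add: b_def c_def distrib_left)
  finally show "norm (R s t) \<le> (b N + r / 2) * (t - s) powr (2 * \<beta>)" by (simp add: x_def)
qed

lemma ex_remainder_bound: "\<exists>r\<ge>0. \<forall>h. remainder_bound h r"
proof -
  obtain r where r: "\<And>s t. 0 \<le> s \<Longrightarrow> s < t \<Longrightarrow> t \<le> T \<Longrightarrow> norm (R s t) \<le> r * (t - s) powr (2 * \<beta>)"
    using remainder_finite by (auto simp: R_def Y_def)
  have "norm (R s t) \<le> max r 0 * (t - s) powr (2 * \<beta>)" if "0 \<le> s" "s < t" "t \<le> T" for s t
    using r[OF that] by (rule order_trans) (auto intro: mult_right_mono)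
  then show ?thesis by (intro exI[of _ "max r 0"]) (auto simp: remainder_bound_def)
qed

text \<open>The remainder bound of a given solution may be arbitrarily large; iterating
  the improvement step makes its contribution disappear.\<close>

lemma remainder_bound_uniform:
  assumes "path_bound h N" "0 \<le> N" "h \<le> 1" "\<kappa> * (M * K) * h powr (\<alpha> * \<beta>) \<le> 1 / 2"
  shows "remainder_bound h (2 * b N)"
proof -
  obtain r where r: "0 \<le> r" "remainder_bound h r" using ex_remainder_bound by blast
  have "remainder_bound h (2 * b N + r / 2 ^ k)" for k
  proof (induction k)
    case 0
    show ?case
      using b_nonneg[OF \<open>0 \<le> N\<close>] by (auto intro: remainder_bound_mono[OF r(2)])
  next
    case (Suc k)
    have "remainder_bound h (b N + (2 * b N + r / 2 ^ k) / 2)"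
      using assms r b_nonneg[OF \<open>0 \<le> N\<close>] by (intro remainder_bound_improve Suc) auto
    \<comment> \<open>\<open>2 * b N\<close> is the fixed point of the improvement map, and the
      excess over it halves.\<close>
    moreover have "b N + (2 * b N + r / 2 ^ k) / 2 = 2 * b N + r / 2 ^ Suc k" by (simp add: field_simps)
    ultimately show ?case by (simp only:)
  qed
  then have le: "norm (R s t) \<le> (2 * b N + r / 2 ^ k) * (t - s) powr (2 * \<beta>)"
    if "0 \<le> s" "s < t" "t \<le> T" "t - s \<le> h" for s t k
    using that by (auto simp: remainder_bound_def)
  have "(\<lambda>k. r / 2 ^ k) \<longlonglongrightarrow> 0" by real_asymp
  then have "(\<lambda>k. (2 * b N + r / 2 ^ k) * (t - s) powr (2 * \<beta>)) \<longlonglongrightarrow> (2 * b N + 0) * (t - s) powr (2 * \<beta>)" for s t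
    by (intro tendsto_intros)
  then have "norm (R s t) \<le> (2 * b N + 0) * (t - s) powr (2 * \<beta>)"
    if "0 \<le> s" "s < t" "t \<le> T" "t - s \<le> h" for s t
    by (rule LIMSEQ_le_const) (use le[OF that] in blast)
  then show ?thesis by (auto simp: remainder_bound_def)
qed

text \<open>Converse direction to the remainder estimate: the leading term gives M K, and a
  remainder of order 2\<beta> contributes at most 1 once r h^\<beta> \<le> 1. No previous Hoelder
  constant of Z enters the result.\<close>

lemma path_bound_of_remainder:
  assumes "remainder_bound h r" "r * h powr \<beta> \<le> 1" "0 \<le> r"
  shows "path_bound h B"
  unfolding path_bound_def
proof (intro allI impI, elim conjE)
  fix s t assume st: "0 \<le> s" "s < t" "t \<le> T" "t - s \<le> h"
  have "Z t - Z s = blinfun_apply (\<sigma> (Y s)) (X s t) + R s t" by (simp add: R_def)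
  also have "norm \<dots> \<le> M * (K * (t - s) powr \<beta>) + r * (t - s) powr (2 * \<beta>)"
    using st assms M_nonneg
    by (intro norm_triangle_le add_mono order_trans[OF sigma_apply_bound] mult_left_mono X_bound)
      (auto simp: remainder_bound_def)
  also have "\<dots> = (M * K + r * (t - s) powr \<beta>) * (t - s) powr \<beta>"
    using powr_add[of "t - s" \<beta> \<beta>] by (simp add: algebra_simps)
  also have "\<dots> \<le> B * (t - s) powr \<beta>"
  proof -
    have "r * (t - s) powr \<beta> \<le> r * h powr \<beta>"
      using st assms beta by (intro mult_left_mono powr_mono2) auto
    then show ?thesis using assms by (intro mult_right_mono) (auto simp: B_def)
  qed
  finally show "norm (Z t - Z s) \<le> B * (t - s) powr \<beta>" .
qed

lemma path_bound_double: "path_bound h N \<Longrightarrow> 0 \<le> N \<Longrightarrow> path_bound (2 * h) (2 * N)"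
  unfolding path_bound_def using increments_doubling[of T h Z N \<beta>] beta by auto

text \<open>A bound valid at a tiny scale depending on the solution is doubled up to the scale \<open>h\<close>:
  doubling costs a factor 2, which the equation gives back.\<close>

lemma uniform_local_bounds:
  assumes "admissible h"
  shows "path_bound h B" "remainder_bound h (2 * b (2 * B))"
proof -
  have step: "path_bound h' B \<and> remainder_bound h' (2 * b (2 * B))"
    if "path_bound h' (2 * B)" "admissible h'" for h'
  proof -
    have "remainder_bound h' (2 * b (2 * B))"
      using that B_ge_1 by (intro remainder_bound_uniform) (auto simp: admissible_def)
    then show ?thesis
      using that b_nonneg[of "2 * B"] B_ge_1
      by (auto simp: admissible_def intro!: path_bound_of_remainder)
  qed
  have h: "0 < h" using assms by (simp add: admissible_def)
  have up: "path_bound (h / 2 ^ n) B \<Longrightarrow> path_bound h B" for n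
  proof (induction n)
    case (Suc n)
    have "path_bound (2 * (h / 2 ^ Suc n)) (2 * B)"
      using Suc.prems B_ge_1 by (intro path_bound_double) auto
    then have "path_bound (h / 2 ^ n) (2 * B)" by simp
    moreover have "admissible (h / 2 ^ n)"
      using h by (intro admissible_antimono[OF assms]) (auto simp: divide_le_eq)
    ultimately show ?case using step Suc.IH by blast
  qed simp
  \<comment> \<open>Start of the doubling: this solution has some finite remainder constant, and the
    bound \<open>B\<close> holds at every scale where r x^\<beta> \<le> 1, however tiny.\<close>
  obtain r where r: "0 \<le> r" "\<And>h. remainder_bound h r" using ex_remainder_bound by blast
  obtain h0 where h0: "0 < h0" "\<And>x. 0 \<le> x \<Longrightarrow> x \<le> h0 \<Longrightarrow> r * x powr \<beta> \<le> 1"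
    using ex_small_powr[OF beta(1) r(1), of 1] by auto
  have "(\<lambda>n. h / 2 ^ n) \<longlonglongrightarrow> 0" by real_asymp
  then obtain n where "h / 2 ^ n < h0"
    using eventually_happens'[OF trivial_limit_sequentially order_tendstoD(2)[OF _ \<open>0 < h0\<close>]] by blast
  then have "path_bound (h / 2 ^ n) B"
    using h r h0 by (intro path_bound_of_remainder[of _ r]) auto
  then show path: "path_bound h B" by (rule up)
  then have "path_bound h (2 * B)"
    using B_ge_1 by (auto elim!: path_bound_mono)
  then show "remainder_bound h (2 * b (2 * B))" using step assms by blast
qed

text \<open>From the local scale to [0, T]. The growth by 2^n is harmless, as \<open>n\<close> will
  depend on T / h only.\<close>

lemma path_bound_iterate: "path_bound h N \<Longrightarrow> 0 \<le> N \<Longrightarrow> path_bound (2 ^ n * h) (2 ^ n * N)"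
proof (induction n)
  case (Suc n)
  then show ?case using path_bound_double[of "2 ^ n * h" "2 ^ n * N"] by (simp add: mult.assoc)
qed simp

text \<open>On intervals shorter than \<delta> the sewing error is at most a w(u,v) + d (v - u): one
  power \<delta>^\<beta>, respectively \<delta>^(\<mu> - 1), is split off as a small factor. The
  rest is a control and sums to at most a c + d T.\<close>

lemma partition_error:
  assumes path: "path_bound h N" "0 \<le> N" "h \<le> 1" and rem: "remainder_bound h r" "0 \<le> r"
    and w0: "w 0 T \<le> c" and t: "0 \<le> t" "t \<le> T" and p: "p \<in> partitions 0 t" "mesh_less \<delta> p"
    and \<delta>: "0 < \<delta>" "\<delta> \<le> h"
  shows "norm (Z t - Z 0 - partition_sum \<Xi> p) \<le>
    \<kappa> * (M * K * c * \<delta> powr \<beta> + defect_const (N + W N + 1) r * T * \<delta> powr (\<mu> - 1))"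
proof -
  define a where "a = \<kappa> * (M * K * \<delta> powr \<beta>)"
  define d where "d = \<kappa> * (defect_const (N + W N + 1) r * \<delta> powr (\<mu> - 1))"
  have mu: "1 < \<mu>" using beta by (simp add: \<mu>_def)
  have const: "0 \<le> defect_const (N + W N + 1) r"
    using path rem W_nonneg by (intro defect_const_nonneg) auto
  have a: "0 \<le> a" and d: "0 \<le> d"
    unfolding a_def d_def using kappa_pos MK_nonneg const by (auto intro!: mult_nonneg_nonneg)
  have control: "control 0 t (\<lambda>u v. a * w u v + d * (v - u))"
    using a d t by (intro control_add control_scale control_length control_subset[OF w]) auto
  have "Z t - Z 0 - partition_sum \<Xi> p = partition_sum (\<lambda>u v. (Z v - Z u) - \<Xi> u v) p"
    by (simp only: partition_sum_diff[of "\<lambda>u v. Z v - Z u" \<Xi>] partition_sum_increments[OF p(1)])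
  also have "norm \<dots> \<le> a * w 0 t + d * (t - 0)"
  proof (rule partition_sum_norm_le[OF p control])
    fix u v assume uv: "0 \<le> u" "u < v" "v \<le> t" "v - u < \<delta>"
    have w_uv: "0 \<le> w u v" using control_nonneg[OF w] uv t by auto
    have "norm (Z v - Z u - \<Xi> u v) \<le>
        \<kappa> * (M * K * w u v * (v - u) powr \<beta> + defect_const (N + W N + 1) r * (v - u) powr \<mu>)"
      using uv t \<delta> path rem by (intro increment_local[OF path(1) rem(1)]) auto
    also have "\<dots> \<le> \<kappa> * (M * K * w u v * \<delta> powr \<beta> + defect_const (N + W N + 1) r * (\<delta> powr (\<mu> - 1) * (v - u)))"
    proof (intro mult_left_mono add_mono)
      show "(v - u) powr \<beta> \<le> \<delta> powr \<beta>" using uv beta by (intro powr_mono2) auto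
      have "(v - u) powr \<mu> = (v - u) powr (\<mu> - 1) * (v - u)" using uv by (simp add: powr_diff)
      also have "\<dots> \<le> \<delta> powr (\<mu> - 1) * (v - u)"
        using uv mu by (intro mult_right_mono powr_mono2) auto
      finally show "(v - u) powr \<mu> \<le> \<delta> powr (\<mu> - 1) * (v - u)" .
    qed (use kappa_pos MK_nonneg w_uv const in auto)
    also have "\<dots> = a * w u v + d * (v - u)" by (simp add: a_def d_def algebra_simps)
    finally show "norm (Z v - Z u - \<Xi> u v) \<le> a * w u v + d * (v - u)" .
  qed
  also have "\<dots> \<le> a * c + d * T"
    using a d t w0 control_mono[OF w, of 0 0 t T] by (intro add_mono mult_left_mono) auto
  finally show ?thesis by (simp add: a_def d_def algebra_simps)
qed

end

text \<open>\<open>C\<close> and \<open>h\<close> are obtained before any solution or driver is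
  named; this order of quantifiers is what compactness relies on.\<close>

theorem (in rough_setting) a_priori:
  obtains C h where "0 \<le> C" "0 < h"
    "\<And>Z \<Psi> X XX w s t. reduced_solution \<sigma> D M \<alpha> T \<beta> K F Z \<Psi> X XX w \<Longrightarrow>
       0 \<le> s \<Longrightarrow> s < t \<Longrightarrow> t \<le> T \<Longrightarrow> norm (Z t - Z s) \<le> C * (t - s) powr \<beta>"
    "\<And>Z \<Psi> X XX w s t. reduced_solution \<sigma> D M \<alpha> T \<beta> K F Z \<Psi> X XX w \<Longrightarrow>
       0 \<le> s \<Longrightarrow> s < t \<Longrightarrow> t \<le> T \<Longrightarrow>
       norm (Z t - Z s - blinfun_apply (\<sigma> (Z s, \<Psi> s)) (X s t)) \<le> C * (t - s) powr (2 * \<beta>)"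
    "\<And>Z \<Psi> X XX w t p \<delta>. reduced_solution \<sigma> D M \<alpha> T \<beta> K F Z \<Psi> X XX w \<Longrightarrow>
       0 \<le> t \<Longrightarrow> t \<le> T \<Longrightarrow> p \<in> partitions 0 t \<Longrightarrow> mesh_less \<delta> p \<Longrightarrow> 0 < \<delta> \<Longrightarrow> \<delta> \<le> h \<Longrightarrow>
       norm (Z t - Z 0 - partition_sum (reduced_germ \<sigma> D Z \<Psi> X XX) p) \<le>
         C * \<delta> powr \<beta> + C * \<delta> powr ((2 + \<alpha>) * \<beta> - 1)"
proof -
  obtain h where h: "admissible h" using ex_admissible by blast
  then have h': "0 < h" "h \<le> 1" by (auto simp: admissible_def)
  \<comment> \<open>Number of doublings that carry the scale \<open>h\<close> beyond T.\<close>
  obtain n where "T / h < 2 ^ n" using real_arch_pow[of 2 "T / h"] by auto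
  then have n: "T \<le> 2 ^ n * h" using h' by (simp add: field_simps)
  define r where "r = 2 * b (2 * B)"
  define N where "N = 2 ^ n * B"
  \<comment> \<open>Bound for the total variation \<open>w 0 T\<close>, from the global Hoelder
    constant \<open>N\<close>.\<close>
  define c where "c = F (N * T powr \<beta>) * (N * T powr \<beta>)"
  define e where "e = defect_const (B + W B + 1) r"
  have nonneg: "0 \<le> r" "0 \<le> B" "0 \<le> N" "0 \<le> c" "0 \<le> e"
  proof -
    show B: "0 \<le> B" using B_ge_1 by simp
    then show r: "0 \<le> r" using b_nonneg by (simp add: r_def)
    show N: "0 \<le> N" using B by (simp add: N_def)
    then show "0 \<le> c" using F_nonneg by (simp add: c_def)
    show "0 \<le> e" using B r W_nonneg defect_const_nonneg by (simp add: e_def)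
  qed
  \<comment> \<open>For t - s > h the remainder is estimated by its two terms, of order \<beta>
    only. The factor h^(-\<beta>) |t - s|^\<beta> \<ge> 1 raises the order to 2\<beta>.\<close>
  define C2 where "C2 = (N + M * K) * h powr - \<beta>"
  define C where "C = N + r + C2 + \<kappa> * (M * K * c) + \<kappa> * (e * T)"
  have C2: "0 \<le> C2" using nonneg MK_nonneg by (simp add: C2_def)
  have C3: "0 \<le> \<kappa> * (M * K * c)" "0 \<le> \<kappa> * (e * T)"
    using nonneg MK_nonneg kappa_pos T_pos by (auto intro!: mult_nonneg_nonneg)
  have C_ge: "0 \<le> C" "N \<le> C" "r \<le> C" "C2 \<le> C" "\<kappa> * (M * K * c) \<le> C" "\<kappa> * (e * T) \<le> C"
    using nonneg C2 C3 by (auto simp: C_def)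
  show ?thesis
  proof (rule that[of C h])
    fix Z \<Psi> :: "real \<Rightarrow> real^'n" and X :: "real \<Rightarrow> real \<Rightarrow> real^'d" and XX w
    assume sol: "reduced_solution \<sigma> D M \<alpha> T \<beta> K F Z \<Psi> X XX w"
    then interpret reduced_solution \<sigma> D M \<alpha> T \<beta> K F Z \<Psi> X XX w .
    have local: "path_bound h B" "remainder_bound h r"
      using uniform_local_bounds[OF h] by (auto simp: r_def)
    have global: "path_bound (2 ^ n * h) N"
      unfolding N_def using local nonneg by (intro path_bound_iterate)
    have path: "norm (Z t - Z s) \<le> N * (t - s) powr \<beta>" if "0 \<le> s" "s < t" "t \<le> T" for s t
      using global that n by (auto simp: path_bound_def)
    show "norm (Z t - Z s) \<le> C * (t - s) powr \<beta>" if "0 \<le> s" "s < t" "t \<le> T" for s t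
      using path[OF that] C_ge by (elim order_trans) (auto intro: mult_right_mono)
    show "norm (Z t - Z s - blinfun_apply (\<sigma> (Z s, \<Psi> s)) (X s t)) \<le> C * (t - s) powr (2 * \<beta>)"
      if st: "0 \<le> s" "s < t" "t \<le> T" for s t
    proof (cases "t - s \<le> h")
      case True
      then have "norm (R s t) \<le> r * (t - s) powr (2 * \<beta>)"
        using local st by (auto simp: remainder_bound_def)
      also have "\<dots> \<le> C * (t - s) powr (2 * \<beta>)" using C_ge by (intro mult_right_mono) auto
      finally show ?thesis by (simp add: R_def Y_def)
    next
      case False
      have "norm (Z t - Z s - blinfun_apply (\<sigma> (Z s, \<Psi> s)) (X s t)) \<le>
          N * (t - s) powr \<beta> + M * (K * (t - s) powr \<beta>)"
        using M_nonneg st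
        by (intro norm_triangle_le_diff add_mono path order_trans[OF sigma_apply_bound] mult_left_mono X_bound)
      also have "\<dots> = (N + M * K) * 1 * (t - s) powr \<beta>" by (simp add: algebra_simps)
      also have "\<dots> \<le> (N + M * K) * (h powr - \<beta> * (t - s) powr \<beta>) * (t - s) powr \<beta>"
      proof (intro mult_right_mono mult_left_mono)
        have "h powr \<beta> \<le> (t - s) powr \<beta>" using False h' beta by (intro powr_mono2) auto
        then show "1 \<le> h powr - \<beta> * (t - s) powr \<beta>"
          using h' by (simp add: powr_minus field_simps)
      qed (use nonneg MK_nonneg in auto)
      also have "\<dots> = C2 * (t - s) powr (2 * \<beta>)"
        using powr_add[of "t - s" \<beta> \<beta>] by (simp add: C2_def mult_ac)
      also have "\<dots> \<le> C * (t - s) powr (2 * \<beta>)" using C_ge by (intro mult_right_mono) auto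
      finally show ?thesis .
    qed
    have w_c: "w 0 T \<le> c"
      unfolding c_def using w_bound[of 0 T N] path nonneg T_pos by auto
    show "norm (Z t - Z 0 - partition_sum (reduced_germ \<sigma> D Z \<Psi> X XX) p) \<le>
         C * \<delta> powr \<beta> + C * \<delta> powr ((2 + \<alpha>) * \<beta> - 1)"
      if "0 \<le> t" "t \<le> T" "p \<in> partitions 0 t" "mesh_less \<delta> p" "0 < \<delta>" "\<delta> \<le> h" for t p \<delta>
    proof -
      have "norm (Z t - Z 0 - partition_sum \<Xi> p) \<le>
          \<kappa> * (M * K * c * \<delta> powr \<beta> + e * T * \<delta> powr (\<mu> - 1))"
        unfolding e_def using that local nonneg h' w_c by (intro partition_error[where h = h]) auto
      also have "\<dots> = (\<kappa> * (M * K * c)) * \<delta> powr \<beta> + (\<kappa> * (e * T)) * \<delta> powr (\<mu> - 1)"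
        by (simp add: algebra_simps)
      also have "\<dots> \<le> C * \<delta> powr \<beta> + C * \<delta> powr (\<mu> - 1)"
        using C_ge by (intro add_mono mult_right_mono) auto
      finally show ?thesis by (simp add: \<Xi>_def \<mu>_def)
    qed
  qed (use C_ge h' in auto)
qed

subsection \<open>Rough integrals and reduced germs\<close>

text \<open>Joint continuity: the linear maps are uniformly bounded in the direction and Hoelder in
  the base point.\<close>

lemma (in lip_field) D_tendsto:
  assumes "y \<longlonglongrightarrow> y0" "v \<longlonglongrightarrow> v0"
  shows "(\<lambda>n::nat. D (y n) (v n)) \<longlonglongrightarrow> D y0 v0"
proof -
  have "(\<lambda>n. M * norm (v n - v0) + M * norm (y n - y0) powr \<alpha> * norm v0) \<longlonglongrightarrow>
      M * norm (v0 - v0) + M * norm (y0 - y0) powr \<alpha> * norm v0"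
    using assms alpha by (intro tendsto_intros tendsto_powr') auto
  then have lim: "(\<lambda>n. M * norm (v n - v0) + M * norm (y n - y0) powr \<alpha> * norm v0) \<longlonglongrightarrow> 0"
    by simp
  have "norm (D (y n) (v n) - D y0 v0) \<le> M * norm (v n - v0) + M * norm (y n - y0) powr \<alpha> * norm v0" for n
  proof -
    have "D (y n) (v n) - D y0 v0 = D (y n) (v n - v0) + (D (y n) v0 - D y0 v0)"
      by (simp add: linear_diff[OF linear_D])
    then show ?thesis
      by (simp only:) (intro norm_triangle_le add_mono deriv_bound deriv_holder)
  qed
  then have "(\<lambda>n. D (y n) (v n) - D y0 v0) \<longlonglongrightarrow> 0"
    by (intro Lim_null_comparison[OF _ lim]) auto
  then show ?thesis by (simp add: Lim_null[symmetric])
qed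

lemma (in lip_field) sigma_tendsto: "(y \<longlongrightarrow> y0) G \<Longrightarrow> ((\<lambda>n. \<sigma> (y n)) \<longlongrightarrow> \<sigma> y0) G"
  using has_derivative_continuous[OF deriv] isCont_tendsto_compose by blast

text \<open>A partition is a finite list, so pointwise convergence of the germs is enough.\<close>

lemma partition_sum_tendsto:
  fixes f :: "nat \<Rightarrow> real \<Rightarrow> real \<Rightarrow> 'v::real_normed_vector"
  assumes "p \<in> partitions s t"
    and "\<And>u v. s \<le> u \<Longrightarrow> u < v \<Longrightarrow> v \<le> t \<Longrightarrow> (\<lambda>n. f n u v) \<longlonglongrightarrow> g u v"
  shows "(\<lambda>n. partition_sum (f n) p) \<longlonglongrightarrow> partition_sum g p"
  using assms
proof (induction rule: partitions_induct)
  case (Cons s u p)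
  then show ?case by (auto intro!: tendsto_add)
qed auto

context rough_setting
begin

lemma reduced_germ_tendsto:
  assumes "(\<lambda>n. Z n s) \<longlonglongrightarrow> Z0 s" "(\<lambda>n. \<Psi> n s) \<longlonglongrightarrow> \<Psi>0 s"
    and "(\<lambda>n. X n s t) \<longlonglongrightarrow> X0 s t" "(\<lambda>n. XX n s t) \<longlonglongrightarrow> XX0 s t"
  shows "(\<lambda>n. reduced_germ \<sigma> D (Z n) (\<Psi> n) (X n) (XX n) s t) \<longlonglongrightarrow> reduced_germ \<sigma> D Z0 \<Psi>0 X0 XX0 s t"
  unfolding reduced_germ_def tensor_apply_def
  by (intro tendsto_intros blinfun.tendsto D_tendsto sigma_tendsto tendsto_vec_nth assms)

lemma partial_derivatives:
  shows "frechet_derivative (\<lambda>z. \<sigma> (z, \<psi>)) (at z) = (\<lambda>v. D (z, \<psi>) (v, 0))"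
    and "frechet_derivative (\<lambda>\<psi>. \<sigma> (z, \<psi>)) (at \<psi>) = (\<lambda>v. D (z, \<psi>) (0, v))"
proof -
  have "((\<lambda>z. (z, \<psi>)) has_derivative (\<lambda>v. (v, 0))) (at z)"
    "((\<lambda>\<psi>. (z, \<psi>)) has_derivative (\<lambda>v. (0, v))) (at \<psi>)"
    by (auto intro!: derivative_eq_intros)
  from this[THEN has_derivative_compose[OF _ deriv]]
  show "frechet_derivative (\<lambda>z. \<sigma> (z, \<psi>)) (at z) = (\<lambda>v. D (z, \<psi>) (v, 0))"
    and "frechet_derivative (\<lambda>\<psi>. \<sigma> (z, \<psi>)) (at \<psi>) = (\<lambda>v. D (z, \<psi>) (0, v))"
    by (auto dest!: frechet_derivative_at)
qed

text \<open>The Young terms of a partition sum to at most a constant times the mesh to the power \<open>\<beta>\<close>, so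
  they can be dropped from the germ.\<close>

lemma has_rough_integral_iff_reduced:
  fixes Z \<Psi> :: "real \<Rightarrow> real^'n" and XXX :: "'d rough"
  assumes t: "0 \<le> t" "t \<le> T" and w: "control 0 T w"
    and \<Psi>: "\<And>u v. 0 \<le> u \<Longrightarrow> u \<le> v \<Longrightarrow> v \<le> T \<Longrightarrow> norm (\<Psi> v - \<Psi> u) \<le> w u v"
    and X_add: "\<And>s u t. 0 \<le> s \<Longrightarrow> s \<le> u \<Longrightarrow> u \<le> t \<Longrightarrow> t \<le> T \<Longrightarrow> fst XXX s t = fst XXX s u + fst XXX u t"
    and X_bound: "\<And>s t. 0 \<le> s \<Longrightarrow> s < t \<Longrightarrow> t \<le> T \<Longrightarrow> norm (fst XXX s t) \<le> K * (t - s) powr \<beta>"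
    and Z': "\<And>s. 0 \<le> s \<Longrightarrow> s \<le> T \<Longrightarrow> Z' s = \<sigma> (Z s, \<Psi> s)"
  shows "has_rough_integral \<sigma> Z Z' \<Psi> XXX 0 t I \<longleftrightarrow>
    (partition_sum (reduced_germ \<sigma> D Z \<Psi> (fst XXX) (snd XXX)) \<longlongrightarrow> I) (mesh_filter 0 t)"
proof -
  define f where "f = rough_germ \<sigma> Z Z' \<Psi> XXX"
  define g where "g = reduced_germ \<sigma> D Z \<Psi> (fst XXX) (snd XXX)"
  define c where "c = real CARD('n) * real CARD('d) * M * K * w 0 T"
  have w0: "0 \<le> w 0 T" using control_nonneg[OF w] T_pos by auto
  have c: "0 \<le> c" unfolding c_def using w0 M_nonneg K_nonneg by simp
  have "((\<lambda>p. partition_sum f p - partition_sum g p) \<longlongrightarrow> 0) (mesh_filter 0 t)"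
    unfolding tendsto_iff eventually_mesh_filter
  proof (intro allI impI)
    fix \<epsilon> :: real assume "0 < \<epsilon>"
    then obtain \<delta> where "0 < \<delta>" "\<forall>x. 0 \<le> x \<and> x \<le> \<delta> \<longrightarrow> c * x powr \<beta> \<le> \<epsilon> / 2"
      using ex_small_powr[OF beta(1) c, of "\<epsilon> / 2"] by auto
    then have \<delta>: "0 < \<delta>" "c * \<delta> powr \<beta> \<le> \<epsilon> / 2" by simp_all
    have "dist (partition_sum f p - partition_sum g p) 0 < \<epsilon>"
      if p: "p \<in> partitions 0 t" "mesh_less \<delta> p" for p
    proof -
      define a where "a = real CARD('n) * real CARD('d) * M * (K * \<delta> powr \<beta>)"
      have a: "0 \<le> a" unfolding a_def using M_nonneg K_nonneg by simp
      have "norm (partition_sum (\<lambda>u v. f u v - g u v) p) \<le> a * w 0 t"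
      proof (rule partition_sum_norm_le[OF p])
        show "control 0 t (\<lambda>u v. a * w u v)"
          using a t by (intro control_scale control_subset[OF w]) auto
      next
        fix u v assume uv: "0 \<le> u" "u < v" "v \<le> t" "v - u < \<delta>"
        have w_uv: "0 \<le> w u v" using control_nonneg[OF w] uv t by auto
        have "norm (young_integral \<Psi> (fst XXX) u v) \<le> K * (v - u) powr \<beta> * w u v"
        proof (rule young_integral_bound[OF uv(2) _ _ _ _ beta(1) K_nonneg])
          show "control u v w" using uv t by (intro control_subset[OF w]) auto
          show "norm (\<Psi> b - \<Psi> a) \<le> w a b" if "u \<le> a" "a \<le> b" "b \<le> v" for a b
            by (rule \<Psi>) (use that uv t in auto)
          show "fst XXX a c = fst XXX a b + fst XXX b c" if "u \<le> a" "a \<le> b" "b \<le> c" "c \<le> v" for a b c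
            by (rule X_add) (use that uv t in auto)
          show "norm (fst XXX a b) \<le> K * (b - a) powr \<beta>" if "u \<le> a" "a < b" "b \<le> v" for a b
            by (rule X_bound) (use that uv t in auto)
        qed
        also have "\<dots> \<le> K * \<delta> powr \<beta> * w u v"
          using uv K_nonneg beta w_uv by (intro mult_right_mono mult_left_mono powr_mono2) auto
        finally have young: "norm (young_integral \<Psi> (fst XXX) u v) \<le> K * \<delta> powr \<beta> * w u v" .
        \<comment> \<open>The first two terms of both germs agree once Z' is replaced by \<sigma>(Z,
          \<Psi>); the Young term alone is left.\<close>
        have "f u v - g u v = tensor_apply (\<lambda>a. D (Z u, \<Psi> u) (0, a)) (young_integral \<Psi> (fst XXX) u v)"
          using uv t by (simp add: f_def g_def rough_germ_def reduced_germ_def partial_derivatives Z')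
        also have "norm \<dots> \<le> real CARD('n) * real CARD('d) * M * norm (young_integral \<Psi> (fst XXX) u v)"
        proof (rule norm_tensor_apply_le)
          show "norm (D (Z u, \<Psi> u) (0, a)) \<le> M * norm a" for a
            using deriv_bound[of "(Z u, \<Psi> u)" "(0, a)"] by (simp add: norm_Pair)
        qed (rule M_nonneg)
        also have "\<dots> \<le> real CARD('n) * real CARD('d) * M * (K * \<delta> powr \<beta> * w u v)"
          using M_nonneg by (intro mult_left_mono young) auto
        finally show "norm (f u v - g u v) \<le> a * w u v" by (simp add: a_def mult_ac)
      qed
      also have "\<dots> \<le> a * w 0 T"
        using a t control_mono[OF w, of 0 0 t T] by (intro mult_left_mono) auto
      also have "\<dots> = c * \<delta> powr \<beta>" by (simp add: a_def c_def mult_ac)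
      finally show ?thesis using \<delta> \<open>0 < \<epsilon>\<close> by (simp add: partition_sum_diff)
    qed
    then show "\<exists>\<delta>>0. \<forall>p\<in>partitions 0 t. mesh_less \<delta> p \<longrightarrow>
        dist (partition_sum f p - partition_sum g p) 0 < \<epsilon>"
      using \<delta>(1) by blast
  qed
  then have "(partition_sum f \<longlongrightarrow> I) (mesh_filter 0 t) \<longleftrightarrow> (partition_sum g \<longlongrightarrow> I) (mesh_filter 0 t)"
    by (rule Lim_transform_eq)
  then show ?thesis by (simp add: has_rough_integral_def f_def g_def)
qed

end

subsection \<open>Path-dependent equations\<close>

text \<open>For \<tau> \<le> h the Hoelder bound wins, as C \<tau>^(\<beta> - \<beta>') \<le>
  \<epsilon>. For \<tau> > h the uniform bound d = \<epsilon> h^\<beta>' does. Both the convergence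
  of A(Z) and the final norms use it.\<close>

lemma holder_interpolation:
  fixes \<beta> \<beta>' C \<epsilon> :: real
  assumes "0 < \<beta>'" "\<beta>' < \<beta>" "0 \<le> C" "0 < \<epsilon>"
  obtains d where "0 < d"
    "\<And>x \<tau>. 0 < \<tau> \<Longrightarrow> x \<le> d \<Longrightarrow> x \<le> C * \<tau> powr \<beta> \<Longrightarrow> x \<le> \<epsilon> * \<tau> powr \<beta>'"
proof -
  obtain h where h: "0 < h" "\<And>x. 0 \<le> x \<Longrightarrow> x \<le> h \<Longrightarrow> C * x powr (\<beta> - \<beta>') \<le> \<epsilon>"
    using ex_small_powr[of "\<beta> - \<beta>'" C \<epsilon>] assms by auto
  show ?thesis
  proof (rule that[of "\<epsilon> * h powr \<beta>'"])
    fix x \<tau> :: real assume \<tau>: "0 < \<tau>" "x \<le> \<epsilon> * h powr \<beta>'" "x \<le> C * \<tau> powr \<beta>"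
    show "x \<le> \<epsilon> * \<tau> powr \<beta>'"
    proof (cases "\<tau> \<le> h")
      case True
      have "C * \<tau> powr \<beta> = C * \<tau> powr (\<beta> - \<beta>') * \<tau> powr \<beta>'"
        by (simp add: mult.assoc flip: powr_add)
      also have "\<dots> \<le> \<epsilon> * \<tau> powr \<beta>'" using h True \<tau> by (intro mult_right_mono) auto
      finally show ?thesis using \<tau> by simp
    next
      case False
      then have "\<epsilon> * h powr \<beta>' \<le> \<epsilon> * \<tau> powr \<beta>'"
        using h assms by (intro mult_left_mono powr_mono2) auto
      then show ?thesis using \<tau> by simp
    qed
  qed (use assms h in auto)
qed

locale path_dependent = rough_setting \<sigma> D M \<alpha> T \<beta> K F
  for \<sigma> :: "(real^'n) \<times> (real^'n) \<Rightarrow> (real^'d) \<Rightarrow>\<^sub>L (real^'n)" and D M \<alpha> T \<beta> K F +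
  fixes \<beta>\<^sub>0 :: real and \<xi> :: "real^'n" and A :: "(real \<Rightarrow> real^'n) \<Rightarrow> real \<Rightarrow> real^'n"
  assumes beta0: "0 < \<beta>\<^sub>0" "\<beta>\<^sub>0 < \<beta>"
    and A_continuous: "\<And>x \<epsilon>. \<lbrakk>x \<in> holder_paths_from T \<beta>\<^sub>0 \<xi>; 0 < \<epsilon>\<rbrakk> \<Longrightarrow>
          \<exists>\<delta>>0. \<forall>y\<in>holder_paths_from T \<beta>\<^sub>0 \<xi>.
            holder_norm T \<beta>\<^sub>0 (\<lambda>t. y t - x t) < ennreal \<delta> \<longrightarrow>
            (\<forall>t\<in>{0..T}. norm (A y t - A x t) < \<epsilon>)"
    and A_variation: "\<And>x s t. \<lbrakk>x \<in> holder_paths_from T \<beta>\<^sub>0 \<xi>; 0 \<le> s; s \<le> t; t \<le> T\<rbrakk> \<Longrightarrow>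
          pvar 1 (A x) s t \<le> ennreal (F (enn2real (pvar (1 / \<beta>\<^sub>0) x s t))) * infvar x s t"
begin

text \<open>The Hoelder constant is a parameter, since compactness needs the same one for a whole
  sequence.\<close>

definition holder_start :: "real \<Rightarrow> (real \<Rightarrow> real^'n) \<Rightarrow> bool" where
  "holder_start C Z \<longleftrightarrow> 0 \<le> C \<and> Z 0 = \<xi> \<and>
     (\<forall>s t. 0 \<le> s \<and> s < t \<and> t \<le> T \<longrightarrow> norm (Z t - Z s) \<le> C * (t - s) powr \<beta>)"

definition w :: "(real \<Rightarrow> real^'n) \<Rightarrow> real \<Rightarrow> real \<Rightarrow> real" where
  "w Z s t = enn2real (pvar 1 (A Z) s t)"

text \<open>On a bounded interval the exponent drops from \<beta> to \<open>\<beta>\<^sub>0\<close>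
  at the price of T^(\<beta> - \<open>\<beta>\<^sub>0\<close>). This places the path where the
  hypotheses on \<open>A\<close> apply.\<close>

lemma holder_start_in_paths:
  assumes "holder_start C Z"
  shows "Z \<in> holder_paths_from T \<beta>\<^sub>0 \<xi>"
proof -
  have "norm (Z t - Z s) \<le> C * T powr (\<beta> - \<beta>\<^sub>0) * (t - s) powr \<beta>\<^sub>0" if "0 \<le> s" "s < t" "t \<le> T" for s t
  proof -
    have "norm (Z t - Z s) \<le> C * (t - s) powr \<beta>" using assms that by (auto simp: holder_start_def)
    also have "\<dots> = C * (t - s) powr (\<beta> - \<beta>\<^sub>0) * (t - s) powr \<beta>\<^sub>0"
      by (simp add: mult.assoc flip: powr_add)
    also have "\<dots> \<le> C * T powr (\<beta> - \<beta>\<^sub>0) * (t - s) powr \<beta>\<^sub>0"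
      using that assms beta0 by (intro mult_right_mono mult_left_mono powr_mono2) (auto simp: holder_start_def)
    finally show ?thesis .
  qed
  then have "holder2_norm T \<beta>\<^sub>0 (\<lambda>s t. Z t - Z s) < \<infinity>"
    by (rule holder2_norm_finiteI)
  then show ?thesis
    using assms by (simp add: holder_paths_from_def holder_paths_def holder_norm_def holder_start_def)
qed

text \<open>Under a local Hoelder bound, N |t - s|^\<beta> dominates both the variation inside
  \<open>F\<close> and the maximal increment, so the growth hypothesis takes the form required of
  solutions.\<close>

lemma pvar_A_le:
  assumes Z: "holder_start C Z" and st: "0 \<le> s" "s \<le> t" "t \<le> T" and "0 \<le> N"
    and N: "\<And>u v. s \<le> u \<Longrightarrow> u < v \<Longrightarrow> v \<le> t \<Longrightarrow> norm (Z v - Z u) \<le> N * (v - u) powr \<beta>"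
  shows "pvar 1 (A Z) s t \<le> ennreal (F (N * (t - s) powr \<beta>) * (N * (t - s) powr \<beta>))"
proof -
  have "pvar (1 / \<beta>\<^sub>0) Z s t \<le> ennreal (N * (t - s) powr \<beta>)"
    using beta0 \<open>0 \<le> N\<close> by (intro pvar_holder_le N) auto
  then have "F (enn2real (pvar (1 / \<beta>\<^sub>0) Z s t)) \<le> F (N * (t - s) powr \<beta>)"
    using \<open>0 \<le> N\<close> by (intro mono_onD[OF F_mono] enn2real_leI) auto
  moreover have "infvar Z s t \<le> ennreal (N * (t - s) powr \<beta>)"
    using beta \<open>0 \<le> N\<close> by (intro infvar_holder_le N) auto
  ultimately have "ennreal (F (enn2real (pvar (1 / \<beta>\<^sub>0) Z s t))) * infvar Z s t \<le>
      ennreal (F (N * (t - s) powr \<beta>)) * ennreal (N * (t - s) powr \<beta>)"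
    by (intro mult_mono ennreal_leI) auto
  also have "\<dots> = ennreal (F (N * (t - s) powr \<beta>) * (N * (t - s) powr \<beta>))"
    using \<open>0 \<le> N\<close> F_nonneg by (intro ennreal_mult[symmetric]) auto
  finally show ?thesis
    using A_variation[OF holder_start_in_paths[OF Z] st] by (rule order_trans[rotated])
qed

lemma w_facts:
  assumes Z: "holder_start C Z"
  shows "control 0 T (w Z)"
    and "0 \<le> s \<Longrightarrow> s \<le> t \<Longrightarrow> t \<le> T \<Longrightarrow> norm (A Z t - A Z s) \<le> w Z s t"
    and "0 \<le> s \<Longrightarrow> s \<le> t \<Longrightarrow> t \<le> T \<Longrightarrow> 0 \<le> N \<Longrightarrow>
      (\<And>u v. s \<le> u \<Longrightarrow> u < v \<Longrightarrow> v \<le> t \<Longrightarrow> norm (Z v - Z u) \<le> N * (v - u) powr \<beta>) \<Longrightarrow>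
      w Z s t \<le> F (N * (t - s) powr \<beta>) * (N * (t - s) powr \<beta>)"
proof -
  have fin: "pvar 1 (A Z) s t < \<infinity>" if "0 \<le> s" "s \<le> t" "t \<le> T" for s t
  proof -
    have "pvar 1 (A Z) s t \<le> ennreal (F (C * (t - s) powr \<beta>) * (C * (t - s) powr \<beta>))"
      using Z that by (intro pvar_A_le[OF Z]) (auto simp: holder_start_def)
    then show ?thesis by (metis ennreal_less_top infinity_ennreal_def le_less_trans)
  qed
  show "control 0 T (w Z)"
    unfolding w_def[abs_def] by (rule variation_control(1)) (rule fin)
  show "norm (A Z t - A Z s) \<le> w Z s t" if "0 \<le> s" "s \<le> t" "t \<le> T"
    unfolding w_def by (rule variation_control(2)[OF fin that])
  show "w Z s t \<le> F (N * (t - s) powr \<beta>) * (N * (t - s) powr \<beta>)"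
    if "0 \<le> s" "s \<le> t" "t \<le> T" "0 \<le> N"
      "\<And>u v. s \<le> u \<Longrightarrow> u < v \<Longrightarrow> v \<le> t \<Longrightarrow> norm (Z v - Z u) \<le> N * (v - u) powr \<beta>"
    unfolding w_def using pvar_A_le[OF Z that] F_nonneg that(4) by (intro enn2real_leI) auto
qed

definition driver :: "'d rough \<Rightarrow> bool" where
  "driver XXX \<longleftrightarrow> XXX \<in> rough_paths T \<beta> \<and> (\<forall>s t. 0 \<le> s \<and> s < t \<and> t \<le> T \<longrightarrow>
     norm (fst XXX s t) \<le> K * (t - s) powr \<beta> \<and> norm (snd XXX s t) \<le> K * (t - s) powr (2 * \<beta>))"

lemma driverD:
  assumes "driver XXX"
  shows "0 \<le> s \<Longrightarrow> s \<le> u \<Longrightarrow> u \<le> t \<Longrightarrow> t \<le> T \<Longrightarrow> fst XXX s t = fst XXX s u + fst XXX u t"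
    and "0 \<le> s \<Longrightarrow> s \<le> u \<Longrightarrow> u \<le> t \<Longrightarrow> t \<le> T \<Longrightarrow>
      snd XXX s t = snd XXX s u + snd XXX u t + tensor (fst XXX s u) (fst XXX u t)"
    and "0 \<le> s \<Longrightarrow> s < t \<Longrightarrow> t \<le> T \<Longrightarrow> norm (fst XXX s t) \<le> K * (t - s) powr \<beta>"
    and "0 \<le> s \<Longrightarrow> s < t \<Longrightarrow> t \<le> T \<Longrightarrow> norm (snd XXX s t) \<le> K * (t - s) powr (2 * \<beta>)"
proof -
  obtain X XX where XXX: "XXX = (X, XX)" by force
  show "0 \<le> s \<Longrightarrow> s \<le> u \<Longrightarrow> u \<le> t \<Longrightarrow> t \<le> T \<Longrightarrow> fst XXX s t = fst XXX s u + fst XXX u t"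
    "0 \<le> s \<Longrightarrow> s \<le> u \<Longrightarrow> u \<le> t \<Longrightarrow> t \<le> T \<Longrightarrow>
      snd XXX s t = snd XXX s u + snd XXX u t + tensor (fst XXX s u) (fst XXX u t)"
    "0 \<le> s \<Longrightarrow> s < t \<Longrightarrow> t \<le> T \<Longrightarrow> norm (fst XXX s t) \<le> K * (t - s) powr \<beta>"
    "0 \<le> s \<Longrightarrow> s < t \<Longrightarrow> t \<le> T \<Longrightarrow> norm (snd XXX s t) \<le> K * (t - s) powr (2 * \<beta>)"
    using assms unfolding driver_def rough_paths_def XXX by auto
qed

text \<open>The Hoelder norm of Z, finite for a controlled path, serves only to make the variation
  of A(Z) finite; its size is forgotten afterwards.\<close>

lemma Sol_imp_reduced_solution:
  assumes X: "driver XXX" and sol: "(Z, Z') \<in> Sol T \<beta> \<sigma> A \<xi> XXX"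
  shows "reduced_solution \<sigma> D M \<alpha> T \<beta> K F Z (A Z) (fst XXX) (snd XXX) (w Z)"
    and "Z 0 = \<xi>" and "\<And>t. 0 \<le> t \<Longrightarrow> t \<le> T \<Longrightarrow> Z' t = \<sigma> (Z t, A Z t)"
proof -
  have paths: "(Z, Z') \<in> controlled_paths T \<beta> (fst XXX)"
    and int: "\<And>t. 0 \<le> t \<Longrightarrow> t \<le> T \<Longrightarrow> \<exists>I. has_rough_integral \<sigma> Z Z' (A Z) XXX 0 t I \<and> Z t = \<xi> + I"
    and Z': "\<And>t. 0 \<le> t \<Longrightarrow> t \<le> T \<Longrightarrow> Z' t = \<sigma> (Z t, A Z t)"
    using sol by (auto simp: Sol_def)
  obtain I where I: "has_rough_integral \<sigma> Z Z' (A Z) XXX 0 0 I" "Z 0 = \<xi> + I"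
    using int[of 0] T_pos by auto
  \<comment> \<open>The only partition of [0, 0] has an empty sum. As the filter is proper, the
    integral up to time 0 is 0 and the initial value follows.\<close>
  have "eventually (\<lambda>p. partition_sum (rough_germ \<sigma> Z Z' (A Z) XXX) p = 0) (mesh_filter 0 0)"
    unfolding eventually_mesh_filter by (intro exI[of _ 1]) auto
  then have "(partition_sum (rough_germ \<sigma> Z Z' (A Z) XXX) \<longlongrightarrow> 0) (mesh_filter 0 0)"
    by (rule tendsto_eventually)
  then have "I = 0"
    using I(1) tendsto_unique[of "mesh_filter 0 0"] unfolding has_rough_integral_def by simp
  with I show Z0: "Z 0 = \<xi>" by simp
  show "Z' t = \<sigma> (Z t, A Z t)" if "0 \<le> t" "t \<le> T" for t using that by (rule Z')
  have fin: "holder2_norm T \<beta> (\<lambda>s t. Z t - Z s) < \<infinity>"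
    "holder2_norm T (2 * \<beta>) (remainder Z Z' (fst XXX)) < \<infinity>"
    using paths by (auto simp: controlled_paths_def holder_paths_def holder_norm_def)
  have start: "holder_start (enn2real (holder2_norm T \<beta> (\<lambda>s t. Z t - Z s))) Z"
    using holder2_normD[OF fin(1)] Z0 by (auto simp: holder_start_def)
  show "reduced_solution \<sigma> D M \<alpha> T \<beta> K F Z (A Z) (fst XXX) (snd XXX) (w Z)"
  proof (unfold_locales, fact driverD(1)[OF X], fact driverD(2)[OF X], fact driverD(3)[OF X],
      fact driverD(4)[OF X], fact w_facts(1)[OF start], fact w_facts(2)[OF start], fact w_facts(3)[OF start])
    show "(partition_sum (reduced_germ \<sigma> D Z (A Z) (fst XXX) (snd XXX)) \<longlongrightarrow> Z t - Z 0) (mesh_filter 0 t)"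
      if t: "0 \<le> t" "t \<le> T" for t
    proof -
      obtain I where "has_rough_integral \<sigma> Z Z' (A Z) XXX 0 t I" "Z t = \<xi> + I"
        using int[OF t] by blast
      then show ?thesis
        using has_rough_integral_iff_reduced[OF t w_facts(1,2)[OF start] driverD(1,3)[OF X] Z', where I = I] Z0
        by simp
    qed
    have "norm (Z t - Z s - blinfun_apply (\<sigma> (Z s, A Z s)) (fst XXX s t)) \<le>
        enn2real (holder2_norm T (2 * \<beta>) (remainder Z Z' (fst XXX))) * (t - s) powr (2 * \<beta>)"
      if "0 \<le> s" "s < t" "t \<le> T" for s t
      using holder2_normD[OF fin(2) that] that Z'[of s] by (simp add: remainder_def)
    then show "\<exists>R. \<forall>s t. 0 \<le> s \<and> s < t \<and> t \<le> T \<longrightarrow>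
      norm (Z t - Z s - blinfun_apply (\<sigma> (Z s, A Z s)) (fst XXX s t)) \<le> R * (t - s) powr (2 * \<beta>)"
      by blast
  qed
qed

text \<open>Besides the given estimates, membership requires the derivative path to be
  \<beta>-Hoelder. That follows from the Lipschitz bound on \<sigma> and the variation of A(Z),
  which is of order |t - s|^\<beta>.\<close>

lemma Sol_intro:
  assumes X: "driver XXX" and Z: "holder_start C Z"
    and rem: "\<And>s t. 0 \<le> s \<Longrightarrow> s < t \<Longrightarrow> t \<le> T \<Longrightarrow>
      norm (Z t - Z s - blinfun_apply (\<sigma> (Z s, A Z s)) (fst XXX s t)) \<le> C * (t - s) powr (2 * \<beta>)"
    and lim: "\<And>t. 0 \<le> t \<Longrightarrow> t \<le> T \<Longrightarrow>
      (partition_sum (reduced_germ \<sigma> D Z (A Z) (fst XXX) (snd XXX)) \<longlongrightarrow> Z t - \<xi>) (mesh_filter 0 t)"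
  shows "(Z, \<lambda>t. \<sigma> (Z t, A Z t)) \<in> Sol T \<beta> \<sigma> A \<xi> XXX"
proof -
  have incr: "norm (Z t - Z s) \<le> C * (t - s) powr \<beta>" if "0 \<le> s" "s < t" "t \<le> T" for s t
    using Z that by (auto simp: holder_start_def)
  have C: "0 \<le> C" using Z by (simp add: holder_start_def)
  have "norm (\<sigma> (Z t, A Z t) - \<sigma> (Z s, A Z s)) \<le> M * (C + F (C * T powr \<beta>) * C) * (t - s) powr \<beta>"
    if st: "0 \<le> s" "s < t" "t \<le> T" for s t
  proof -
    have "norm (A Z t - A Z s) \<le> w Z s t" using w_facts(2)[OF Z] st by auto
    also have "\<dots> \<le> F (C * (t - s) powr \<beta>) * (C * (t - s) powr \<beta>)"
      using st C incr by (intro w_facts(3)[OF Z]) auto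
    also have "\<dots> \<le> F (C * T powr \<beta>) * (C * (t - s) powr \<beta>)"
      using C st beta by (intro mult_right_mono mono_onD[OF F_mono] mult_left_mono powr_mono2) auto
    finally have AZ: "norm (A Z t - A Z s) \<le> F (C * T powr \<beta>) * (C * (t - s) powr \<beta>)" .
    have "norm ((Z t, A Z t) - (Z s, A Z s)) \<le> norm (Z t - Z s) + norm (A Z t - A Z s)"
      by (simp add: norm_Pair sqrt_sum_squares_le_sum)
    also have "\<dots> \<le> C * (t - s) powr \<beta> + F (C * T powr \<beta>) * (C * (t - s) powr \<beta>)"
      by (intro add_mono incr[OF st] AZ)
    finally have "M * norm ((Z t, A Z t) - (Z s, A Z s)) \<le>
        M * (C * (t - s) powr \<beta> + F (C * T powr \<beta>) * (C * (t - s) powr \<beta>))"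
      using M_nonneg by (rule mult_left_mono)
    from order_trans[OF lipschitz this] show ?thesis by (simp add: algebra_simps)
  qed
  then have "holder2_norm T \<beta> (\<lambda>s t. \<sigma> (Z t, A Z t) - \<sigma> (Z s, A Z s)) < \<infinity>"
    by (rule holder2_norm_finiteI)
  moreover have "holder2_norm T \<beta> (\<lambda>s t. Z t - Z s) < \<infinity>"
    using incr by (rule holder2_norm_finiteI)
  moreover have "holder2_norm T (2 * \<beta>) (remainder Z (\<lambda>t. \<sigma> (Z t, A Z t)) (fst XXX)) < \<infinity>"
    unfolding remainder_def using rem by (rule holder2_norm_finiteI)
  ultimately have "(Z, \<lambda>t. \<sigma> (Z t, A Z t)) \<in> controlled_paths T \<beta> (fst XXX)"
    by (simp add: controlled_paths_def holder_paths_def holder_norm_def)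
  moreover have "has_rough_integral \<sigma> Z (\<lambda>t. \<sigma> (Z t, A Z t)) (A Z) XXX 0 t (Z t - \<xi>)"
    if t: "0 \<le> t" "t \<le> T" for t
    using has_rough_integral_iff_reduced[OF t w_facts(1,2)[OF Z] driverD(1,3)[OF X],
        where Z = Z and Z' = "\<lambda>t. \<sigma> (Z t, A Z t)" and I = "Z t - \<xi>"] lim[OF t] by simp
  ultimately show ?thesis
    unfolding Sol_def by (auto intro!: exI[of _ "Z _ - \<xi>"])
qed

end

subsection \<open>Compactness\<close>

context path_dependent
begin

text \<open>\<open>A\<close> is continuous for the \<open>\<beta>\<^sub>0\<close>-Hoelder norm,
  whereas compactness yields uniform convergence. The common \<beta>-Hoelder bound and interpolation
  bridge the gap; this is where \<open>\<beta>\<^sub>0\<close> < \<beta> is used.\<close>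

lemma A_uniformly_convergent:
  assumes Z: "\<And>n::nat. holder_start C (Z n)" and g: "holder_start C g"
    and conv: "\<And>e. 0 < e \<Longrightarrow> \<exists>N. \<forall>n\<ge>N. \<forall>t\<in>{0..T}. norm (Z n t - g t) < e"
    and "0 < e"
  shows "\<exists>N. \<forall>n\<ge>N. \<forall>t\<in>{0..T}. norm (A (Z n) t - A g t) < e"
proof -
  obtain \<delta> where "0 < \<delta>" and \<delta>: "\<And>y. y \<in> holder_paths_from T \<beta>\<^sub>0 \<xi> \<Longrightarrow>
      holder_norm T \<beta>\<^sub>0 (\<lambda>t. y t - g t) < ennreal \<delta> \<Longrightarrow> \<forall>t\<in>{0..T}. norm (A y t - A g t) < e"
    using A_continuous[OF holder_start_in_paths[OF g] \<open>0 < e\<close>] by blast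
  have C: "0 \<le> C" using g by (simp add: holder_start_def)
  obtain d where d: "0 < d"
    "\<And>x \<tau>. 0 < \<tau> \<Longrightarrow> x \<le> d \<Longrightarrow> x \<le> 2 * C * \<tau> powr \<beta> \<Longrightarrow> x \<le> \<delta> / 2 * \<tau> powr \<beta>\<^sub>0"
    using holder_interpolation[OF beta0, of "2 * C" "\<delta> / 2"] C \<open>0 < \<delta>\<close> by auto
  obtain N where N: "\<And>n t. N \<le> n \<Longrightarrow> t \<in> {0..T} \<Longrightarrow> norm (Z n t - g t) < d / 2"
    using conv[OF half_gt_zero[OF d(1)]] by blast
  have "\<forall>t\<in>{0..T}. norm (A (Z n) t - A g t) < e" if n: "N \<le> n" for n
  proof (rule \<delta>)
    have "norm ((Z n t - g t) - (Z n s - g s)) \<le> \<delta> / 2 * (t - s) powr \<beta>\<^sub>0"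
      if st: "0 \<le> s" "s < t" "t \<le> T" for s t
    proof (rule d(2))
      show "norm ((Z n t - g t) - (Z n s - g s)) \<le> d"
        using N[OF n, of t] N[OF n, of s] st norm_triangle_ineq4[of "Z n t - g t" "Z n s - g s"] by auto
      have "(Z n t - g t) - (Z n s - g s) = (Z n t - Z n s) - (g t - g s)" by simp
      also have "norm \<dots> \<le> C * (t - s) powr \<beta> + C * (t - s) powr \<beta>"
        using Z[of n] g st by (intro order_trans[OF norm_triangle_ineq4 add_mono]) (auto simp: holder_start_def)
      finally show "norm ((Z n t - g t) - (Z n s - g s)) \<le> 2 * C * (t - s) powr \<beta>" by simp
    qed (use st in auto)
    then have "holder_norm T \<beta>\<^sub>0 (\<lambda>t. Z n t - g t) \<le> ennreal (\<delta> / 2)"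
      unfolding holder_norm_def using \<open>0 < \<delta>\<close> by (subst holder2_norm_le_iff) auto
    also have "\<dots> < ennreal \<delta>" using \<open>0 < \<delta>\<close> by (intro ennreal_lessI) auto
    finally show "holder_norm T \<beta>\<^sub>0 (\<lambda>t. Z n t - g t) < ennreal \<delta>" .
  qed (rule holder_start_in_paths[OF Z])
  then show ?thesis by blast
qed

text \<open>Hoelder bound, remainder bound and partition error are inequalities between finitely
  many values, with constants independent of \<open>n\<close>, so each passes to the limit
  separately. The error then tends to 0 with the mesh, which identifies the limit as a
  solution.\<close>

lemma limit_solution:
  fixes XXX :: "nat \<Rightarrow> 'd rough" and XXX0 :: "'d rough"
  assumes X: "\<And>n. driver (XXX n)" and X0: "driver XXX0"
    and conv_X: "\<And>s t. 0 \<le> s \<Longrightarrow> s < t \<Longrightarrow> t \<le> T \<Longrightarrow> (\<lambda>n. fst (XXX n) s t) \<longlonglongrightarrow> fst XXX0 s t"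
    and conv_XX: "\<And>s t. 0 \<le> s \<Longrightarrow> s < t \<Longrightarrow> t \<le> T \<Longrightarrow> (\<lambda>n. snd (XXX n) s t) \<longlonglongrightarrow> snd XXX0 s t"
    and sol: "\<And>n. (Z n, Z' n) \<in> Sol T \<beta> \<sigma> A \<xi> (XXX n)"
  obtains g k C where "strict_mono (k :: nat \<Rightarrow> nat)"
    "(g, \<lambda>t. \<sigma> (g t, A g t)) \<in> Sol T \<beta> \<sigma> A \<xi> XXX0"
    "holder_start C g" "\<And>n. holder_start C (Z n)"
    "\<And>s t. 0 \<le> s \<Longrightarrow> s < t \<Longrightarrow> t \<le> T \<Longrightarrow>
      norm (g t - g s - blinfun_apply (\<sigma> (g s, A g s)) (fst XXX0 s t)) \<le> C * (t - s) powr (2 * \<beta>)"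
    "\<And>n s t. 0 \<le> s \<Longrightarrow> s < t \<Longrightarrow> t \<le> T \<Longrightarrow>
      norm (Z n t - Z n s - blinfun_apply (\<sigma> (Z n s, A (Z n) s)) (fst (XXX n) s t)) \<le> C * (t - s) powr (2 * \<beta>)"
    "\<And>e. 0 < e \<Longrightarrow> \<exists>N. \<forall>n\<ge>N. \<forall>t\<in>{0..T}. norm (Z (k n) t - g t) < e"
    "\<And>e. 0 < e \<Longrightarrow> \<exists>N. \<forall>n\<ge>N. \<forall>t\<in>{0..T}. norm (A (Z (k n)) t - A g t) < e"
proof -
  note red = Sol_imp_reduced_solution(1)[OF X sol]
  note start = Sol_imp_reduced_solution(2)[OF X sol]
  obtain C h where C: "0 \<le> C" "0 < h"
    and path: "\<And>n s t. 0 \<le> s \<Longrightarrow> s < t \<Longrightarrow> t \<le> T \<Longrightarrow> norm (Z n t - Z n s) \<le> C * (t - s) powr \<beta>"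
    and rem: "\<And>n s t. 0 \<le> s \<Longrightarrow> s < t \<Longrightarrow> t \<le> T \<Longrightarrow>
      norm (Z n t - Z n s - blinfun_apply (\<sigma> (Z n s, A (Z n) s)) (fst (XXX n) s t)) \<le> C * (t - s) powr (2 * \<beta>)"
    and error: "\<And>n t p \<delta>. 0 \<le> t \<Longrightarrow> t \<le> T \<Longrightarrow> p \<in> partitions 0 t \<Longrightarrow> mesh_less \<delta> p \<Longrightarrow> 0 < \<delta> \<Longrightarrow> \<delta> \<le> h \<Longrightarrow>
       norm (Z n t - Z n 0 - partition_sum (reduced_germ \<sigma> D (Z n) (A (Z n)) (fst (XXX n)) (snd (XXX n))) p) \<le>
         C * \<delta> powr \<beta> + C * \<delta> powr ((2 + \<alpha>) * \<beta> - 1)"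
    apply (rule a_priori)
    subgoal premises prems
      by (rule that[OF prems(2,3) prems(4)[OF red] prems(5)[OF red] prems(6)[OF red]])
    done
  have Z_start: "holder_start C (Z n)" for n
    using C path start by (auto simp: holder_start_def)
  obtain g k where k: "strict_mono (k :: nat \<Rightarrow> nat)"
    and conv: "\<And>e. 0 < e \<Longrightarrow> \<exists>N. \<forall>n x. N \<le> n \<and> x \<in> {0..T} \<longrightarrow> norm (Z (k n) x - g x) < e"
  proof (rule Arzela_Ascoli[of "{0..T}" Z "norm \<xi> + C * T powr \<beta>"])
    fix n x assume x: "x \<in> {0..T}"
    have "norm (Z n x - Z n 0) \<le> C * T powr \<beta>"
    proof (cases "x = 0")
      case False
      then have "norm (Z n x - Z n 0) \<le> C * (x - 0) powr \<beta>" using x by (intro path) auto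
      also have "\<dots> \<le> C * T powr \<beta>" using x C beta by (intro mult_left_mono powr_mono2) auto
      finally show ?thesis .
    qed (use C in auto)
    then show "norm (Z n x) \<le> norm \<xi> + C * T powr \<beta>"
      using start[of n] norm_triangle_sub[of "Z n x" "\<xi>"] by simp
  next
    fix x e :: real assume x: "x \<in> {0..T}" "0 < e"
    obtain h where h: "0 < h" "\<And>x. 0 \<le> x \<Longrightarrow> x \<le> h \<Longrightarrow> C * x powr \<beta> \<le> e / 2"
      using ex_small_powr[OF beta(1) C(1), of "e / 2"] x by auto
    have "norm (Z n x - Z n y) < e" if y: "y \<in> {0..T}" "norm (x - y) < h" for n y
    proof -
      have "norm (Z n x - Z n y) \<le> C * \<bar>x - y\<bar> powr \<beta>"
      proof (cases x y rule: linorder_cases)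
        case less
        then show ?thesis using path[of x y n] x y by (simp add: norm_minus_commute)
      next
        case greater
        then show ?thesis using path[of y x n] x y by simp
      qed (use C in auto)
      also have "\<dots> \<le> e / 2" using h y by auto
      finally show ?thesis using x by simp
    qed
    then show "\<exists>d>0. \<forall>n y. y \<in> {0..T} \<and> norm (x - y) < d \<longrightarrow> norm (Z n x - Z n y) < e"
      using h(1) by blast
  qed auto
  have unif: "\<exists>N. \<forall>n\<ge>N. \<forall>t\<in>{0..T}. norm (Z (k n) t - g t) < e" if "0 < e" for e
    using conv[OF that] by blast
  have pointwise: "(\<lambda>n. Z (k n) t) \<longlonglongrightarrow> g t" if "t \<in> {0..T}" for t
    using unif that by (intro LIMSEQ_I) blast
  have g0: "g 0 = \<xi>"
    using pointwise[of 0] T_pos by (simp add: start LIMSEQ_const_iff)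
  have "norm (g t - g s) \<le> C * (t - s) powr \<beta>" if "0 \<le> s" "s < t" "t \<le> T" for s t
    using that path pointwise
    by (intro tendsto_upperbound[OF tendsto_norm[OF tendsto_diff[OF pointwise pointwise]]]) auto
  then have g: "holder_start C g" using C g0 by (simp add: holder_start_def)
  have unif_A: "\<exists>N. \<forall>n\<ge>N. \<forall>t\<in>{0..T}. norm (A (Z (k n)) t - A g t) < e" if "0 < e" for e
    by (rule A_uniformly_convergent[OF _ g unif that]) (use Z_start in auto)
  have pointwise_A: "(\<lambda>n. A (Z (k n)) t) \<longlonglongrightarrow> A g t" if "t \<in> {0..T}" for t
    using unif_A that by (intro LIMSEQ_I) blast
  note sub_X = LIMSEQ_subseq_LIMSEQ[OF conv_X k, unfolded o_def]
  note sub_XX = LIMSEQ_subseq_LIMSEQ[OF conv_XX k, unfolded o_def]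
  have g_rem: "norm (g t - g s - blinfun_apply (\<sigma> (g s, A g s)) (fst XXX0 s t)) \<le> C * (t - s) powr (2 * \<beta>)"
    if st: "0 \<le> s" "s < t" "t \<le> T" for s t
  proof (rule tendsto_upperbound)
    show "(\<lambda>n. norm (Z (k n) t - Z (k n) s - blinfun_apply (\<sigma> (Z (k n) s, A (Z (k n)) s)) (fst (XXX (k n)) s t)))
        \<longlonglongrightarrow> norm (g t - g s - blinfun_apply (\<sigma> (g s, A g s)) (fst XXX0 s t))"
      using st by (intro tendsto_intros blinfun.tendsto sigma_tendsto pointwise pointwise_A sub_X) auto
  qed (use rem[OF st] in auto)
  have g_error: "norm (g t - g 0 - partition_sum (reduced_germ \<sigma> D g (A g) (fst XXX0) (snd XXX0)) p) \<le>
         C * \<delta> powr \<beta> + C * \<delta> powr ((2 + \<alpha>) * \<beta> - 1)"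
    if t: "0 \<le> t" "t \<le> T" and p: "p \<in> partitions 0 t" "mesh_less \<delta> p" "0 < \<delta>" "\<delta> \<le> h" for t p \<delta>
  proof (rule tendsto_upperbound)
    show "(\<lambda>n. norm (Z (k n) t - Z (k n) 0 - partition_sum (reduced_germ \<sigma> D (Z (k n)) (A (Z (k n)))
        (fst (XXX (k n))) (snd (XXX (k n)))) p))
      \<longlonglongrightarrow> norm (g t - g 0 - partition_sum (reduced_germ \<sigma> D g (A g) (fst XXX0) (snd XXX0)) p)"
      using t by (intro tendsto_intros pointwise partition_sum_tendsto[OF p(1)] reduced_germ_tendsto
          pointwise_A sub_X sub_XX) auto
  qed (use error[OF t p] in auto)
  have g_solves: "(partition_sum (reduced_germ \<sigma> D g (A g) (fst XXX0) (snd XXX0)) \<longlongrightarrow> g t - \<xi>) (mesh_filter 0 t)"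
    if t: "0 \<le> t" "t \<le> T" for t
    unfolding tendsto_iff eventually_mesh_filter
  proof (intro allI impI)
    fix \<epsilon> :: real assume "0 < \<epsilon>"
    have "0 < (2 + \<alpha>) * \<beta> - 1" using beta by simp
    from ex_small_powr[OF this C(1), of "\<epsilon> / 3"] obtain h1 where h1: "0 < h1"
      "\<And>x. 0 \<le> x \<Longrightarrow> x \<le> h1 \<Longrightarrow> C * x powr ((2 + \<alpha>) * \<beta> - 1) \<le> \<epsilon> / 3" using \<open>0 < \<epsilon>\<close> by auto
    from ex_small_powr[OF beta(1) C(1), of "\<epsilon> / 3"] obtain h2 where h2: "0 < h2"
      "\<And>x. 0 \<le> x \<Longrightarrow> x \<le> h2 \<Longrightarrow> C * x powr \<beta> \<le> \<epsilon> / 3" using \<open>0 < \<epsilon>\<close> by auto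
    define \<delta> where "\<delta> = min h (min h1 h2)"
    have \<delta>: "0 < \<delta>" "\<delta> \<le> h" "\<delta> \<le> h1" "\<delta> \<le> h2" using C h1 h2 by (auto simp: \<delta>_def)
    have "dist (partition_sum (reduced_germ \<sigma> D g (A g) (fst XXX0) (snd XXX0)) p) (g t - \<xi>) < \<epsilon>"
      if p: "p \<in> partitions 0 t" "mesh_less \<delta> p" for p
      using g_error[OF t p \<delta>(1,2)] h1(2)[of \<delta>] h2(2)[of \<delta>] \<delta> \<open>0 < \<epsilon>\<close>
      by (simp add: dist_norm norm_minus_commute g0)
    then show "\<exists>\<delta>>0. \<forall>p\<in>partitions 0 t. mesh_less \<delta> p \<longrightarrow>
        dist (partition_sum (reduced_germ \<sigma> D g (A g) (fst XXX0) (snd XXX0)) p) (g t - \<xi>) < \<epsilon>"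
      using \<delta>(1) by blast
  qed
  show ?thesis
    by (rule that[OF k Sol_intro[OF X0 g g_rem g_solves] g Z_start g_rem rem unif unif_A])
qed

text \<open>The summands of the constant: the two end points of the path, the change of \<sigma>
  (twice, for Z and A(Z)) against the first level, and the change of the first level against the
  bound on \<sigma>.\<close>

lemma remainder_difference_le:
  assumes X: "driver XXX" and X0: "driver XXX0" and st: "0 \<le> s" "s < t" "t \<le> T"
    and dZ: "\<And>t. t \<in> {0..T} \<Longrightarrow> norm (Z t - g t) \<le> d"
    and dA: "\<And>t. t \<in> {0..T} \<Longrightarrow> norm (A Z t - A g t) \<le> d"
    and dX: "norm (fst XXX s t - fst XXX0 s t) \<le> d"
  shows "norm ((Z t - Z s - blinfun_apply (\<sigma> (Z s, A Z s)) (fst XXX s t))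
      - (g t - g s - blinfun_apply (\<sigma> (g s, A g s)) (fst XXX0 s t)))
    \<le> (2 + 2 * M * K * T powr \<beta> + M) * d"
proof -
  have d: "0 \<le> d" using dX norm_ge_zero order_trans by blast
  define a where "a = \<sigma> (Z s, A Z s)"
  define b where "b = \<sigma> (g s, A g s)"
  have "norm ((Z s, A Z s) - (g s, A g s)) \<le> norm (Z s - g s) + norm (A Z s - A g s)"
    by (simp add: norm_Pair sqrt_sum_squares_le_sum)
  also have "\<dots> \<le> 2 * d" using dZ[of s] dA[of s] st by auto
  finally have "M * norm ((Z s, A Z s) - (g s, A g s)) \<le> M * (2 * d)"
    using M_nonneg by (rule mult_left_mono)
  then have ab: "norm (a - b) \<le> M * (2 * d)"
    unfolding a_def b_def using lipschitz order_trans by blast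
  have "norm (fst XXX s t) \<le> K * (t - s) powr \<beta>" using driverD(3)[OF X] st by auto
  also have "\<dots> \<le> K * T powr \<beta>" using st K_nonneg beta by (intro mult_left_mono powr_mono2) auto
  finally have XT: "norm (fst XXX s t) \<le> K * T powr \<beta>" .
  have "norm (blinfun_apply (a - b) (fst XXX s t)) \<le> M * (2 * d) * (K * T powr \<beta>)"
    using ab XT M_nonneg d by (intro order_trans[OF norm_blinfun] mult_mono) auto
  moreover have "norm (blinfun_apply b (fst XXX s t - fst XXX0 s t)) \<le> M * d"
    using dX M_nonneg bound by (intro order_trans[OF norm_blinfun] mult_mono) (auto simp: b_def)
  moreover have "(Z t - Z s - blinfun_apply a (fst XXX s t)) - (g t - g s - blinfun_apply b (fst XXX0 s t)) =
      (Z t - g t) - (Z s - g s) - blinfun_apply (a - b) (fst XXX s t) - blinfun_apply b (fst XXX s t - fst XXX0 s t)"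
    by (simp add: blinfun.diff_left blinfun.diff_right)
  moreover have "norm ((Z t - g t) - (Z s - g s) - blinfun_apply (a - b) (fst XXX s t) - blinfun_apply b (fst XXX s t - fst XXX0 s t))
     \<le> d + d + M * (2 * d) * (K * T powr \<beta>) + M * d"
  proof -
    have "norm (x - y - z - u) \<le> norm x + norm y + norm z + norm u" for x y z u :: "real^'n"
      using norm_triangle_ineq4[of "x - y - z" u] norm_triangle_ineq4[of "x - y" z] norm_triangle_ineq4[of x y]
      by linarith
    then show ?thesis
      by (rule order_trans) (use dZ[of t] dZ[of s] st calculation(1,2) in \<open>auto intro!: add_mono\<close>)
  qed
  ultimately have "norm ((Z t - Z s - blinfun_apply a (fst XXX s t)) - (g t - g s - blinfun_apply b (fst XXX0 s t)))
      \<le> d + d + M * (2 * d) * (K * T powr \<beta>) + M * d" by (simp only:)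
  also have "\<dots> = (2 + 2 * M * K * T powr \<beta> + M) * d" by (simp add: algebra_simps)
  finally show ?thesis unfolding a_def b_def .
qed

end

section \<open>Contradiction along drivers converging to the given one\<close>

lemma rough_paths_bound:
  assumes "XXX \<in> rough_paths T \<beta>"
  obtains K where "0 \<le> K"
    "\<And>s t. 0 \<le> s \<Longrightarrow> s < t \<Longrightarrow> t \<le> T \<Longrightarrow> norm (fst XXX s t) \<le> K * (t - s) powr \<beta>"
    "\<And>s t. 0 \<le> s \<Longrightarrow> s < t \<Longrightarrow> t \<le> T \<Longrightarrow> norm (snd XXX s t) \<le> K * (t - s) powr (2 * \<beta>)"
proof -
  define K1 where "K1 = enn2real (holder2_norm T \<beta> (fst XXX))"
  define K2 where "K2 = enn2real (holder2_norm T (2 * \<beta>) (snd XXX))"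
  have fin: "holder2_norm T \<beta> (fst XXX) < \<infinity>" "holder2_norm T (2 * \<beta>) (snd XXX) < \<infinity>"
    using assms by (auto simp: rough_paths_def)
  show ?thesis
  proof (rule that[of "K1 + K2"])
    show "norm (fst XXX s t) \<le> (K1 + K2) * (t - s) powr \<beta>" if "0 \<le> s" "s < t" "t \<le> T" for s t
      using holder2_normD[OF fin(1) that] by (rule order_trans) (auto simp: K1_def K2_def intro!: mult_right_mono)
    show "norm (snd XXX s t) \<le> (K1 + K2) * (t - s) powr (2 * \<beta>)" if "0 \<le> s" "s < t" "t \<le> T" for s t
      using holder2_normD[OF fin(2) that] by (rule order_trans) (auto simp: K1_def K2_def intro!: mult_right_mono)
  qed (auto simp: K1_def K2_def)
qed

theorem proposition4p2:
  fixes T \<beta> \<gamma> \<beta>\<^sub>0 :: real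
    and \<sigma> :: "(real^'n) \<times> (real^'n) \<Rightarrow> (real^'d) \<Rightarrow>\<^sub>L (real^'n)"
    and \<xi> :: "real^'n"
    and A :: "(real \<Rightarrow> real^'n) \<Rightarrow> real \<Rightarrow> real^'n"
    and F :: "real \<Rightarrow> real"
    and XXX\<^sub>0 :: "'d rough"
    and Z\<^sub>0 :: "real \<Rightarrow> real^'n"
    and Z\<^sub>0' :: "real \<Rightarrow> (real^'d) \<Rightarrow>\<^sub>L (real^'n)"
  assumes "0 < T"
    and "1 / 3 < \<beta>" and "\<beta> \<le> 1 / 2" and "1 / \<beta> < \<gamma>"
    and "\<sigma> \<in> lip_functions (\<gamma> - 1)"
    and adapted: "\<And>t x y. \<lbrakk>0 \<le> t; t \<le> T; x \<in> holder_paths_from T \<beta> \<xi>; y \<in> holder_paths_from T \<beta> \<xi>;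
          \<And>s. \<lbrakk>0 \<le> s; s \<le> t\<rbrakk> \<Longrightarrow> x s = y s\<rbrakk> \<Longrightarrow> \<forall>s\<in>{0..t}. A x s = A y s"
    and "1 / 3 < \<beta>\<^sub>0" and "\<beta>\<^sub>0 < \<beta>"
    and A_values: "\<And>x. x \<in> holder_paths_from T \<beta>\<^sub>0 \<xi> \<Longrightarrow> continuous_on {0..T} (A x)"
    and A_continuous: "\<And>x \<epsilon>. \<lbrakk>x \<in> holder_paths_from T \<beta>\<^sub>0 \<xi>; 0 < \<epsilon>\<rbrakk> \<Longrightarrow>
          \<exists>\<delta>>0. \<forall>y\<in>holder_paths_from T \<beta>\<^sub>0 \<xi>.
            holder_norm T \<beta>\<^sub>0 (\<lambda>t. y t - x t) < ennreal \<delta> \<longrightarrow>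
            (\<forall>t\<in>{0..T}. norm (A y t - A x t) < \<epsilon>)"
    and "mono_on {0..} F" and "continuous_on {0..} F" and "\<And>r. 0 \<le> r \<Longrightarrow> 0 < F r"
    and A_variation: "\<And>x s t. \<lbrakk>x \<in> holder_paths_from T \<beta>\<^sub>0 \<xi>; 0 \<le> s; s \<le> t; t \<le> T\<rbrakk> \<Longrightarrow>
          pvar 1 (A x) s t \<le> ennreal (F (enn2real (pvar (1 / \<beta>\<^sub>0) x s t))) * infvar x s t"
    and "XXX\<^sub>0 \<in> rough_paths T \<beta>"
    and solution: "(Z\<^sub>0, Z\<^sub>0') \<in> Sol T \<beta> \<sigma> A \<xi> XXX\<^sub>0"
    and unique: "\<And>Z Z'. (Z, Z') \<in> Sol T \<beta> \<sigma> A \<xi> XXX\<^sub>0 \<Longrightarrow>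
          \<forall>t\<in>{0..T}. Z t = Z\<^sub>0 t \<and> Z' t = Z\<^sub>0' t"
  shows "\<forall>\<beta>' \<theta>' \<epsilon>. 0 < \<beta>' \<and> \<beta>' < \<beta> \<and> 0 < \<theta>' \<and> \<theta>' < 2 * \<beta> \<and> 0 < \<epsilon> \<longrightarrow>
    (\<exists>\<delta>>0. \<forall>XXX\<in>rough_paths T \<beta>. rough_dist T \<beta> XXX XXX\<^sub>0 \<le> \<delta> \<longrightarrow>
      (\<forall>(Z, Z')\<in>Sol T \<beta> \<sigma> A \<xi> XXX.
        holder_norm T \<beta>' (\<lambda>t. Z t - Z\<^sub>0 t) +
        holder2_norm T \<theta>'
          (\<lambda>s t. remainder Z Z' (fst XXX) s t - remainder Z\<^sub>0 Z\<^sub>0' (fst XXX\<^sub>0) s t)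
        \<le> ennreal \<epsilon>))"
proof (intro allI impI, elim conjE)
  fix \<beta>' \<theta>' \<epsilon> :: real
  assume exps: "0 < \<beta>'" "\<beta>' < \<beta>" "0 < \<theta>'" "\<theta>' < 2 * \<beta>" "0 < \<epsilon>"
  define close where "close XXX Z Z' \<longleftrightarrow> holder_norm T \<beta>' (\<lambda>t. Z t - Z\<^sub>0 t) +
        holder2_norm T \<theta>' (\<lambda>s t. remainder Z Z' (fst XXX) s t - remainder Z\<^sub>0 Z\<^sub>0' (fst XXX\<^sub>0) s t)
        \<le> ennreal \<epsilon>" for XXX :: "'d rough" and Z Z'
  obtain M \<alpha> where lip: "lip_field \<sigma> (\<lambda>y. frechet_derivative \<sigma> (at y)) M \<alpha>" and \<alpha>: "1 < (2 + \<alpha>) * \<beta>"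
    using lip_functions_lip_field[OF \<open>\<sigma> \<in> lip_functions (\<gamma> - 1)\<close> \<open>1 / 3 < \<beta>\<close> \<open>\<beta> \<le> 1 / 2\<close> \<open>1 / \<beta> < \<gamma>\<close>] .
  obtain K0 where K0: "0 \<le> K0"
    "\<And>s t. 0 \<le> s \<Longrightarrow> s < t \<Longrightarrow> t \<le> T \<Longrightarrow> norm (fst XXX\<^sub>0 s t) \<le> K0 * (t - s) powr \<beta>"
    "\<And>s t. 0 \<le> s \<Longrightarrow> s < t \<Longrightarrow> t \<le> T \<Longrightarrow> norm (snd XXX\<^sub>0 s t) \<le> K0 * (t - s) powr (2 * \<beta>)"
    using rough_paths_bound[OF \<open>XXX\<^sub>0 \<in> rough_paths T \<beta>\<close>] by blast
  interpret lip_field \<sigma> "\<lambda>y. frechet_derivative \<sigma> (at y)" M \<alpha> by (rule lip)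
  \<comment> \<open>\<open>K0 + 1\<close> bounds every driver at distance at most 1, since such a
    distance changes either level by at most 1 in its norm.\<close>
  interpret path_dependent \<sigma> "\<lambda>y. frechet_derivative \<sigma> (at y)" M \<alpha> T \<beta> "K0 + 1" F \<beta>\<^sub>0 \<xi> A
  proof (unfold_locales, fact \<open>0 < T\<close>, use \<open>1 / 3 < \<beta>\<close> in simp, fact \<alpha>, use K0 in simp,
      fact \<open>mono_on {0..} F\<close>)
    show "0 \<le> F r" if "0 \<le> r" for r using \<open>\<And>r. 0 \<le> r \<Longrightarrow> 0 < F r\<close> that less_imp_le by blast
    show "0 < \<beta>\<^sub>0" using \<open>1 / 3 < \<beta>\<^sub>0\<close> by simp
  qed (fact \<open>\<beta>\<^sub>0 < \<beta>\<close>, fact A_continuous, fact A_variation)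
  have driver: "driver XXX" if "XXX \<in> rough_paths T \<beta>" "rough_dist T \<beta> XXX XXX\<^sub>0 \<le> 1" for XXX
    unfolding driver_def
  proof (intro conjI allI impI that(1); elim conjE)
    fix s t assume st: "0 \<le> s" "s < t" "t \<le> T"
    note d = rough_dist_bounds[OF that(1) \<open>XXX\<^sub>0 \<in> rough_paths T \<beta>\<close> that(2) st]
    show "norm (fst XXX s t) \<le> (K0 + 1) * (t - s) powr \<beta>"
      using d(1) K0(2)[OF st] norm_triangle_sub[of "fst XXX s t" "fst XXX\<^sub>0 s t"] by (simp add: distrib_right)
    show "norm (snd XXX s t) \<le> (K0 + 1) * (t - s) powr (2 * \<beta>)"
      using d(2) K0(3)[OF st] norm_triangle_sub[of "snd XXX s t" "snd XXX\<^sub>0 s t"] by (simp add: distrib_right)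
  qed
  have driver0: "driver XXX\<^sub>0"
    using driver[OF \<open>XXX\<^sub>0 \<in> rough_paths T \<beta>\<close>]
    by (simp add: rough_dist_def holder2_norm_def bot_ennreal SUP_constant)
  have "\<exists>\<delta>>0. \<forall>XXX\<in>rough_paths T \<beta>. rough_dist T \<beta> XXX XXX\<^sub>0 \<le> \<delta> \<longrightarrow>
      (\<forall>(Z, Z')\<in>Sol T \<beta> \<sigma> A \<xi> XXX. close XXX Z Z')"
  proof (rule ccontr)
    assume no: "\<not> ?thesis"
    \<comment> \<open>Driver, path and derivative are packed into one triple, so a single choice
      produces all three sequences.\<close>
    define bad where "bad n q \<longleftrightarrow> (case q of (XXX, Z, Z') \<Rightarrow>
        XXX \<in> rough_paths T \<beta> \<and> rough_dist T \<beta> XXX XXX\<^sub>0 \<le> 1 / Suc n \<and>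
        (Z, Z') \<in> Sol T \<beta> \<sigma> A \<xi> XXX \<and> \<not> close XXX Z Z')" for n :: nat and q
    have "\<exists>q. bad n q" for n
    proof -
      have "0 < 1 / real (Suc n)" by simp
      with no obtain XXX Z Z' where "XXX \<in> rough_paths T \<beta>" "rough_dist T \<beta> XXX XXX\<^sub>0 \<le> 1 / Suc n"
        "(Z, Z') \<in> Sol T \<beta> \<sigma> A \<xi> XXX" "\<not> close XXX Z Z'" by blast
      then show ?thesis by (intro exI[of _ "(XXX, Z, Z')"]) (simp add: bad_def)
    qed
    then obtain q where q: "\<And>n. bad n (q n)" by metis
    define XXX where "XXX n = fst (q n)" for n
    define Z where "Z n = fst (snd (q n))" for n
    define Z' where "Z' n = snd (snd (q n))" for n
    have rp: "XXX n \<in> rough_paths T \<beta>" and dist: "rough_dist T \<beta> (XXX n) XXX\<^sub>0 \<le> 1 / Suc n"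
      and sol: "(Z n, Z' n) \<in> Sol T \<beta> \<sigma> A \<xi> (XXX n)" and far: "\<not> close (XXX n) (Z n) (Z' n)" for n
      using q[of n] by (auto simp: bad_def XXX_def Z_def Z'_def split: prod.splits)
    have X: "driver (XXX n)" for n
    proof (rule driver[OF rp])
      have "1 / Suc n \<le> (1::real)" by simp
      then show "rough_dist T \<beta> (XXX n) XXX\<^sub>0 \<le> 1" using dist[of n] by linarith
    qed
    have dX: "norm (fst (XXX n) s t - fst XXX\<^sub>0 s t) \<le> 1 / Suc n * T powr \<beta>"
      and dXX: "norm (snd (XXX n) s t - snd XXX\<^sub>0 s t) \<le> (1 / Suc n)\<^sup>2 * T powr (2 * \<beta>)"
      if st: "0 \<le> s" "s < t" "t \<le> T" for n s t
    proof -
      note d = rough_dist_bounds[OF rp \<open>XXX\<^sub>0 \<in> rough_paths T \<beta>\<close> dist st, of n]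
      show "norm (fst (XXX n) s t - fst XXX\<^sub>0 s t) \<le> 1 / Suc n * T powr \<beta>"
        using st beta by (intro order_trans[OF d(1)] mult_left_mono powr_mono2) auto
      show "norm (snd (XXX n) s t - snd XXX\<^sub>0 s t) \<le> (1 / Suc n)\<^sup>2 * T powr (2 * \<beta>)"
        using st beta by (intro order_trans[OF d(2)] mult_left_mono powr_mono2) auto
    qed
    have null: "(\<lambda>n. 1 / Suc n * c) \<longlonglongrightarrow> 0" "(\<lambda>n. (1 / Suc n)\<^sup>2 * c) \<longlonglongrightarrow> 0" for c :: real
      by real_asymp+
    have conv_X: "(\<lambda>n. fst (XXX n) s t) \<longlonglongrightarrow> fst XXX\<^sub>0 s t"
      and conv_XX: "(\<lambda>n. snd (XXX n) s t) \<longlonglongrightarrow> snd XXX\<^sub>0 s t" if st: "0 \<le> s" "s < t" "t \<le> T" for s t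
    proof -
      have "(\<lambda>n. fst (XXX n) s t - fst XXX\<^sub>0 s t) \<longlonglongrightarrow> 0"
        by (rule Lim_null_comparison[OF always_eventually null(1)[of "T powr \<beta>"]]) (use dX[OF st] in blast)
      then show "(\<lambda>n. fst (XXX n) s t) \<longlonglongrightarrow> fst XXX\<^sub>0 s t" by (simp add: LIM_zero_iff)
      have "(\<lambda>n. snd (XXX n) s t - snd XXX\<^sub>0 s t) \<longlonglongrightarrow> 0"
        by (rule Lim_null_comparison[OF always_eventually null(2)[of "T powr (2 * \<beta>)"]]) (use dXX[OF st] in blast)
      then show "(\<lambda>n. snd (XXX n) s t) \<longlonglongrightarrow> snd XXX\<^sub>0 s t" by (simp add: LIM_zero_iff)
    qed
    obtain g k C where k: "strict_mono (k :: nat \<Rightarrow> nat)"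
      and g_sol: "(g, \<lambda>t. \<sigma> (g t, A g t)) \<in> Sol T \<beta> \<sigma> A \<xi> XXX\<^sub>0"
      and g: "holder_start C g" and Z_start: "\<And>n. holder_start C (Z n)"
      and g_rem: "\<And>s t. 0 \<le> s \<Longrightarrow> s < t \<Longrightarrow> t \<le> T \<Longrightarrow>
        norm (g t - g s - blinfun_apply (\<sigma> (g s, A g s)) (fst XXX\<^sub>0 s t)) \<le> C * (t - s) powr (2 * \<beta>)"
      and Z_rem: "\<And>n s t. 0 \<le> s \<Longrightarrow> s < t \<Longrightarrow> t \<le> T \<Longrightarrow>
        norm (Z n t - Z n s - blinfun_apply (\<sigma> (Z n s, A (Z n) s)) (fst (XXX n) s t)) \<le> C * (t - s) powr (2 * \<beta>)"
      and unif: "\<And>e. 0 < e \<Longrightarrow> \<exists>N. \<forall>n\<ge>N. \<forall>t\<in>{0..T}. norm (Z (k n) t - g t) < e"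
      and unif_A: "\<And>e. 0 < e \<Longrightarrow> \<exists>N. \<forall>n\<ge>N. \<forall>t\<in>{0..T}. norm (A (Z (k n)) t - A g t) < e"
      apply (rule limit_solution[OF X driver0 _ _ sol])
        apply (rule conv_X; assumption)
       apply (rule conv_XX; assumption)
      subgoal premises prems by (rule that[OF prems(2-9)])
      done
    \<comment> \<open>Uniqueness identifies the limit with the given solution on [0, T] only, so the
      replacement is made under these bounds on t.\<close>
    have g_eq: "Z\<^sub>0 t = g t" "Z\<^sub>0' t = \<sigma> (g t, A g t)" if "0 \<le> t" "t \<le> T" for t
      using unique[OF g_sol] that by (metis atLeastAtMost_iff)+
    have C: "0 \<le> C" using g by (simp add: holder_start_def)
    define c where "c = 2 + 2 * M * (K0 + 1) * T powr \<beta> + M"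
    have c: "0 < c" unfolding c_def using M_nonneg K0 by (simp add: add_pos_nonneg)
    \<comment> \<open>Each of the two norms gets \<epsilon>/2; \<open>2 * C\<close> bounds a
      difference of two quantities that each have constant \<open>C\<close>.\<close>
    obtain d1 where d1: "0 < d1"
      "\<And>x \<tau>. 0 < \<tau> \<Longrightarrow> x \<le> d1 \<Longrightarrow> x \<le> 2 * C * \<tau> powr \<beta> \<Longrightarrow> x \<le> \<epsilon> / 2 * \<tau> powr \<beta>'"
      using holder_interpolation[OF exps(1,2), of "2 * C" "\<epsilon> / 2"] C exps by auto
    obtain d2 where d2: "0 < d2"
      "\<And>x \<tau>. 0 < \<tau> \<Longrightarrow> x \<le> d2 \<Longrightarrow> x \<le> 2 * C * \<tau> powr (2 * \<beta>) \<Longrightarrow> x \<le> \<epsilon> / 2 * \<tau> powr \<theta>'"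
      using holder_interpolation[OF exps(3,4), of "2 * C" "\<epsilon> / 2"] C exps by auto
    \<comment> \<open>An increment of the difference of paths is at most 2 d, and the difference of
      remainders at most c d.\<close>
    define d where "d = min (d1 / 2) (d2 / c)"
    have d: "0 < d" "2 * d \<le> d1" "c * d \<le> d2"
      using d1 d2 c by (auto simp: d_def min_def field_simps)
    obtain N1 where N1: "\<forall>n\<ge>N1. \<forall>t\<in>{0..T}. norm (Z (k n) t - g t) < d" using unif[OF d(1)] by blast
    obtain N2 where N2: "\<forall>n\<ge>N2. \<forall>t\<in>{0..T}. norm (A (Z (k n)) t - A g t) < d" using unif_A[OF d(1)] by blast
    obtain N3 where N3: "\<forall>n\<ge>N3. 1 / Suc n * T powr \<beta> < d"
      using order_tendstoD(2)[OF null(1) d(1)] unfolding eventually_sequentially by blast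
    define n where "n = max N1 (max N2 N3)"
    define m where "m = k n"
    have n: "N1 \<le> n" "N2 \<le> n" "N3 \<le> n" by (simp_all add: n_def)
    \<comment> \<open>The bound on the drivers refers to the original index, so it is applied at k
      n, which is at least n.\<close>
    have "n \<le> m" unfolding m_def using k by (rule seq_suble)
    have Zd: "norm (Z m t - g t) \<le> d" and Ad: "norm (A (Z m) t - A g t) \<le> d" if "t \<in> {0..T}" for t
      using N1[rule_format, of n t] N2[rule_format, of n t] that n by (auto simp: m_def)
    have Xd: "norm (fst (XXX m) s t - fst XXX\<^sub>0 s t) \<le> d" if "0 \<le> s" "s < t" "t \<le> T" for s t
      using dX[OF that, of m] N3[rule_format, of m] \<open>n \<le> m\<close> n by auto
    have "norm ((Z m t - Z\<^sub>0 t) - (Z m s - Z\<^sub>0 s)) \<le> \<epsilon> / 2 * (t - s) powr \<beta>'"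
      if st: "0 \<le> s" "s < t" "t \<le> T" for s t
    proof (rule d1(2))
      have "norm ((Z m t - g t) - (Z m s - g s)) \<le> d + d"
        using st by (intro order_trans[OF norm_triangle_ineq4 add_mono] Zd) auto
      then show "norm ((Z m t - Z\<^sub>0 t) - (Z m s - Z\<^sub>0 s)) \<le> d1" using d st by (simp add: g_eq)
      have "norm ((Z m t - Z m s) - (g t - g s)) \<le> C * (t - s) powr \<beta> + C * (t - s) powr \<beta>"
        using Z_start[of m] g st by (intro order_trans[OF norm_triangle_ineq4 add_mono]) (auto simp: holder_start_def)
      moreover have "(Z m t - Z m s) - (g t - g s) = (Z m t - Z\<^sub>0 t) - (Z m s - Z\<^sub>0 s)"
        using st by (simp add: g_eq)
      ultimately show "norm ((Z m t - Z\<^sub>0 t) - (Z m s - Z\<^sub>0 s)) \<le> 2 * C * (t - s) powr \<beta>"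
        by (simp only: mult_2 distrib_right)
    qed (use st in auto)
    then have path: "holder_norm T \<beta>' (\<lambda>t. Z m t - Z\<^sub>0 t) \<le> ennreal (\<epsilon> / 2)"
      unfolding holder_norm_def using exps by (subst holder2_norm_le_iff) auto
    have "norm (remainder (Z m) (Z' m) (fst (XXX m)) s t - remainder Z\<^sub>0 Z\<^sub>0' (fst XXX\<^sub>0) s t)
        \<le> \<epsilon> / 2 * (t - s) powr \<theta>'" if st: "0 \<le> s" "s < t" "t \<le> T" for s t
    proof -
      define r where "r = Z m t - Z m s - blinfun_apply (\<sigma> (Z m s, A (Z m) s)) (fst (XXX m) s t)"
      define r0 where "r0 = g t - g s - blinfun_apply (\<sigma> (g s, A g s)) (fst XXX\<^sub>0 s t)"
      have "norm (r - r0) \<le> \<epsilon> / 2 * (t - s) powr \<theta>'"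
      proof (rule d2(2))
        have "norm (r - r0) \<le> c * d"
          unfolding r_def r0_def c_def
          by (rule remainder_difference_le[OF X driver0 st Zd Ad Xd[OF st]])
        then show "norm (r - r0) \<le> d2" using d by simp
        have "norm (r - r0) \<le> C * (t - s) powr (2 * \<beta>) + C * (t - s) powr (2 * \<beta>)"
          unfolding r_def r0_def
          by (rule order_trans[OF norm_triangle_ineq4 add_mono[OF Z_rem[OF st] g_rem[OF st]]])
        then show "norm (r - r0) \<le> 2 * C * (t - s) powr (2 * \<beta>)" by simp
      qed (use st in auto)
      moreover have "remainder (Z m) (Z' m) (fst (XXX m)) s t = r" "remainder Z\<^sub>0 Z\<^sub>0' (fst XXX\<^sub>0) s t = r0"
        using st Sol_imp_reduced_solution(3)[OF X sol, of s m]
        by (simp_all add: remainder_def r_def r0_def g_eq)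
      ultimately show ?thesis by simp
    qed
    then have "holder2_norm T \<theta>' (\<lambda>s t. remainder (Z m) (Z' m) (fst (XXX m)) s t -
        remainder Z\<^sub>0 Z\<^sub>0' (fst XXX\<^sub>0) s t) \<le> ennreal (\<epsilon> / 2)"
      using exps by (subst holder2_norm_le_iff) auto
    from add_mono[OF path this] have "close (XXX m) (Z m) (Z' m)"
      unfolding close_def using exps by (simp flip: ennreal_plus)
    with far show False by blast
  qed
  then show "\<exists>\<delta>>0. \<forall>XXX\<in>rough_paths T \<beta>. rough_dist T \<beta> XXX XXX\<^sub>0 \<le> \<delta> \<longrightarrow>
      (\<forall>(Z, Z')\<in>Sol T \<beta> \<sigma> A \<xi> XXX.
        holder_norm T \<beta>' (\<lambda>t. Z t - Z\<^sub>0 t) +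
        holder2_norm T \<theta>'
          (\<lambda>s t. remainder Z Z' (fst XXX) s t - remainder Z\<^sub>0 Z\<^sub>0' (fst XXX\<^sub>0) s t)
        \<le> ennreal \<epsilon>)"
    by (simp only: close_def)
qed

end
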